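(* There is a choice of (sufficiently large) absolute constants $c,C,L$ with $\tilde L:=L/(\sqrt3+1)>2(\sqrt3+1)$ such that the following holds for Algorithm E (described in the context) run with these constants. Let $K\subset\mathbb R^n$ be an origin-symmetric convex body with $rB_2\subseteq K\subseteq RB_2$ for known $r,R>0$, and let $Y=\mu+\xi$ with $\mu\in K$, where $\xi$ has i.i.d. mean-zero sub-Gaussian components with known sub-Gaussian parameter $\sigma^2$. Let $\overline\kappa:=\max_{k\in[M]}\kappa(K_{(k)})$, and suppose that $\log(R/r)$ is polynomial in $n$, while $\overline\kappa$ and $T_2(K)$ are polylogarithmic in $n$. Define $$\Lambda_K:=1+\left\lceil \log_c\!\left(\overline\kappa^{1/2}\sqrt2\,T_2(K)\right)\right\rceil,\qquad \Upsilon(K):=\left(1\vee\left(2\sqrt2\,T_2(K)\overline\kappa^{1/2}\right)\vee\left(2C\sqrt{\Lambda_K}\right)\right)^2 .$$ Then the output $\hat\mu$ of Algorithm E satisfies, for every $\mu\in K$, $$\mathbb E\|\hat\mu-\mu\|_2^2\lesssim \Upsilon(K)\,\eta^{\star2}(K),$$ and is thus nearly minimax optimal (that is, it attains the minimax rate $\eta^{\star 2}(K)$ up to the factor $\Upsilon(K)$).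
   Context: Notation. $a\wedge b$, $a\vee b$ are min and max; $\lesssim$ hides absolute constants; $B_2(x,s)$ is the closed Euclidean ball, $B_2=B_2(0,1)$; matrix inequalities are in the psd sense; $[M]=\{1,\dots,M\}$. Sub-Gaussian parameter. A real mean-zero $\xi_i$ has sub-Gaussian parameter $\sigma^2$ if $\sigma^2$ is the smallest constant with $\mathbb E e^{\lambda\xi_i}\le e^{\lambda^2\sigma^2/2}$ for all $\lambda\in\mathbb R$. Gauge and type-2 constant. $\rho_K$ is the Minkowski gauge of $K$ (a norm), for which an evaluation oracle is assumed. $T_2(K)$ is the smallest $T\ge1$ with $\mathbb E_\epsilon\rho_K^2(\sum_i\epsilon_ix_i)\le T^2\sum_i\rho_K^2(x_i)$ for all finite collections $x_i\in\mathbb R^n$, $\epsilon_i$ i.i.d. Rademacher signs. Local entropy and $\eta^\star$. $M(\eta,S)$ is the maximal cardinality of a set $\{\nu_i\}\subset S$ with $\|\nu_i-\nu_j\|_2>\eta$ for $i\neq j$. For the fixed sufficiently large constant $c$, $M_K^{\rm loc}(\eta)=\sup_{\nu\in K}M(\eta/c,B_2(\nu,\eta)\cap K)$, and $\eta^\star(K)=\sup\{\eta\ge0:\eta^2/\sigma^2\le\log M_K^{\rm loc}(\eta)\}$. For Gaussian noise $N(0,\sigma^2I_n)$, the minimax squared-error risk over $K$ is of order $\eta^{\star2}(K)$. QFM oracle. For a convex body $K'$, a quadratic-form-maximization oracle $\mathcal O_{K'}$ with factor $\kappa(K')\ge1$ and failure probability $q$ takes a symmetric psd matrix $X$ and returns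 $\mathcal O_{K'}(X)\in K'$ such that $\mathcal O_{K'}(X)^\top X\,\mathcal O_{K'}(X)\ge\kappa(K')^{-1}\max_{p\in K'}p^\top Xp$ with probability at least $1-q$. The oracles below are assumed available, with randomness independent of the data. Procedure SDP$(K',m)$ (with $\kappa=\kappa(K')$). Put $\gamma=1/(\kappa C^2)$, $M'=1\vee\lceil4(n-m)C^4\kappa^2\rceil$, $X^{(1)}=\frac{n-m}{n}I_n$. If $m=n$ return $X^{(1)}$. For $k=1,\dots,M'$: let $p_k=\mathcal O_{K'}(X^{(k)})$, $\gamma_k=\gamma/\|p_k\|_2^2$, eigendecompose $X^{(k)}-\gamma_kp_kp_k^\top=U\Lambda U^\top$, let $v$ be the Euclidean projection of $\mathrm{diag}(\Lambda)$ onto $\{w\in[0,1]^n:\sum_iw_i=n-m\}$, and set $X^{(k+1)}=U\,\mathrm{diag}(v)U^\top$. Return $X^{\star\star}=\sum_{k=1}^{M'}\gamma_kX^{(k)}/\sum_{k=1}^{M'}\gamma_k$. Weak projection. For a convex body $K'$ and $\epsilon>0$, $\Pi_{K'}(z)$ denotes a point $p\in K'$ with $\|z-p\|_2\le\min_{x\in K'}\|z-x\|_2+\epsilon$. Algorithm E. Input $K,r,R,\sigma,Y$. Set $\tilde d_1=2R$, $K_{(1)}=K$, $M=\lceil\log_{\tilde L/(2(\sqrt3+1))}(R/r)\rceil$, $\hat\mu_1=0$. If $\sigma\le r/\sqrt n$, return $\hat\mu=Y$. For $j=1,\dots,M$: (1) $m=\lceil\tilde d_j^2/(C^2\sigma^2)\rceil\wedge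 n$; compute $X_j^{\star\star}$ by SDP$(K_{(j)},m)$, where each of its $M'$ oracle calls has failure probability at most $q=\frac{1/M'}{1+\tilde d_j^3/\sigma^3}$; set $A_j^{\star\star}=(I-X_j^{\star\star})^{1/2}$. (2) $\tilde\mu_{j+1}=(A_j^{\star\star}Y-A_j^{\star\star}\hat\mu_j)/2$. (3) $\bar\mu_{j+1}=\Pi_{K_{(j)}}\tilde\mu_{j+1}$ with $\epsilon=\tilde d_j/L$. (4) $\hat\mu_{j+1}=\Pi_K(2\bar\mu_{j+1}+\hat\mu_j)$ with $\epsilon=2\tilde d_j/\tilde L$. (5) $\tilde d_{j+1}=2(\sqrt3+1)\tilde d_j/\tilde L$, $K_{(j+1)}=K\cap B_2(0,\tilde d_{j+1}/2)$. (6) If $\tilde d_{j+1}\le(2r)\vee(C\sigma)$, return $\hat\mu=\hat\mu_{j+1}$. After the loop, return $\hat\mu=\hat\mu_{M+1}$. *)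

theory Defs
  imports "HOL-Probability.Probability" "HOL-Computational_Algebra.Polynomial"
begin

text \<open>
  The dimension \<open>n\<close> has to be quantified inside the theorem, after the absolute constants, so
  it cannot be a type. A vector of \<open>R^n\<close> is a function \<open>nat \<Rightarrow> real\<close> that vanishes from index
  \<open>n\<close> on, and an \<open>n \<times> n\<close> matrix vanishes outside \<open>{..<n} \<times> {..<n}\<close>. On these sets the product
  topology and the Borel sets of the function type are the usual ones of \<open>R^n\<close> and \<open>R^(n \<times> n)\<close>.
\<close>

type_synonym rvec = "nat \<Rightarrow> real"
type_synonym rmat = "nat \<Rightarrow> nat \<Rightarrow> real"

definition Rn :: "nat \<Rightarrow> rvec set" where
  "Rn n = {x. \<forall>i\<ge>n. x i = 0}"

definition Mn :: "nat \<Rightarrow> rmat set" where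
  "Mn n = {A. \<forall>i j. i \<ge> n \<or> j \<ge> n \<longrightarrow> A i j = 0}"

definition enorm :: "nat \<Rightarrow> rvec \<Rightarrow> real" where
  "enorm n x = L2_set x {..<n}"

definition edist :: "nat \<Rightarrow> rvec \<Rightarrow> rvec \<Rightarrow> real" where
  "edist n x y = enorm n (\<lambda>i. x i - y i)"

definition ecball :: "nat \<Rightarrow> rvec \<Rightarrow> real \<Rightarrow> rvec set" where
  "ecball n x s = {y \<in> Rn n. edist n x y \<le> s}"

definition matmul :: "nat \<Rightarrow> rmat \<Rightarrow> rmat \<Rightarrow> rmat" where
  "matmul n A B = (\<lambda>i j. \<Sum>k<n. A i k * B k j)"

definition matvec :: "nat \<Rightarrow> rmat \<Rightarrow> rvec \<Rightarrow> rvec" where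
  "matvec n A x = (\<lambda>i. \<Sum>j<n. A i j * x j)"

definition mtrans :: "rmat \<Rightarrow> rmat" where
  "mtrans A = (\<lambda>i j. A j i)"

definition diagm :: "nat \<Rightarrow> rvec \<Rightarrow> rmat" where
  "diagm n v = (\<lambda>i j. if i = j \<and> i < n then v i else 0)"

definition idm :: "nat \<Rightarrow> rmat" where
  "idm n = diagm n (\<lambda>_. 1)"

definition quad :: "nat \<Rightarrow> rmat \<Rightarrow> rvec \<Rightarrow> real" where
  "quad n X x = (\<Sum>i<n. \<Sum>j<n. x i * X i j * x j)"

definition psd :: "nat \<Rightarrow> rmat \<Rightarrow> bool" where
  "psd n X \<longleftrightarrow> X \<in> Mn n \<and> mtrans X = X \<and> (\<forall>x\<in>Rn n. 0 \<le> quad n X x)"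

definition orthogonal_mat :: "nat \<Rightarrow> rmat \<Rightarrow> bool" where
  "orthogonal_mat n U \<longleftrightarrow>
     U \<in> Mn n \<and> matmul n (mtrans U) U = idm n \<and> matmul n U (mtrans U) = idm n"

definition psd_sqrt :: "nat \<Rightarrow> rmat \<Rightarrow> rmat" where
  "psd_sqrt n B = (THE A. psd n A \<and> matmul n A A = B)"

text \<open>
  The interior of a convex body is taken in \<open>R^n\<close>; as a subset of \<open>nat \<Rightarrow> real\<close> every body has
  empty interior, hence the explicit ball.
\<close>

definition convex_body :: "nat \<Rightarrow> rvec set \<Rightarrow> bool" where
  "convex_body n K \<longleftrightarrow> K \<subseteq> Rn n \<and> compact K \<and>
     (\<forall>x\<in>K. \<forall>y\<in>K. \<forall>t\<in>{0..1}. (\<lambda>i. (1 - t) * x i + t * y i) \<in> K) \<and>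
     (\<exists>x\<in>Rn n. \<exists>e>0. ecball n x e \<subseteq> K)"

definition origin_symmetric :: "rvec set \<Rightarrow> bool" where
  "origin_symmetric K \<longleftrightarrow> (\<forall>x\<in>K. (\<lambda>i. - x i) \<in> K)"

definition minkowski_gauge :: "rvec set \<Rightarrow> rvec \<Rightarrow> real" where
  "minkowski_gauge K x = Inf {t. 0 < t \<and> (\<exists>y\<in>K. x = (\<lambda>i. t * y i))}"

definition rademacher :: "real pmf" where
  "rademacher = pmf_of_set {-1, 1}"

definition type2_bound :: "nat \<Rightarrow> rvec set \<Rightarrow> real \<Rightarrow> bool" where
  "type2_bound n K T \<longleftrightarrow>
     (\<forall>(N::nat) (x::nat \<Rightarrow> rvec). (\<forall>i<N. x i \<in> Rn n) \<longrightarrow>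
        measure_pmf.expectation (Pi_pmf {..<N} 0 (\<lambda>_. rademacher))
          (\<lambda>\<epsilon>. (minkowski_gauge K (\<lambda>l. \<Sum>i<N. \<epsilon> i * x i l))\<^sup>2)
        \<le> T\<^sup>2 * (\<Sum>i<N. (minkowski_gauge K (x i))\<^sup>2))"

definition T2 :: "nat \<Rightarrow> rvec set \<Rightarrow> real" where
  "T2 n K = Inf {T. 1 \<le> T \<and> type2_bound n K T}"

text \<open>
  All suprema below are over nonempty bounded sets when \<open>K\<close> is a convex body and \<open>c > 1\<close>:
  for \<open>\<eta> > 0\<close> packings of compact sets have bounded size, and at \<open>\<eta> = 0\<close> the local ball is
  a single point.
\<close>

definition packing_number :: "nat \<Rightarrow> real \<Rightarrow> rvec set \<Rightarrow> nat" where
  "packing_number n \<eta> S =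
     Sup {card A | A. finite A \<and> A \<subseteq> S \<and> (\<forall>x\<in>A. \<forall>y\<in>A. x \<noteq> y \<longrightarrow> edist n x y > \<eta>)}"

definition local_packing :: "real \<Rightarrow> nat \<Rightarrow> rvec set \<Rightarrow> real \<Rightarrow> nat" where
  "local_packing c n K \<eta> = (SUP \<nu>\<in>K. packing_number n (\<eta> / c) (ecball n \<nu> \<eta> \<inter> K))"

definition eta_star :: "real \<Rightarrow> nat \<Rightarrow> real \<Rightarrow> rvec set \<Rightarrow> real" where
  "eta_star c n \<sigma> K = Sup {\<eta>. 0 \<le> \<eta> \<and> \<eta>\<^sup>2 / \<sigma>\<^sup>2 \<le> ln (real (local_packing c n K \<eta>))}"

definition subgaussian_bound :: "real measure \<Rightarrow> real \<Rightarrow> bool" where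
  "subgaussian_bound \<nu> s \<longleftrightarrow>
     (\<forall>t. integrable \<nu> (\<lambda>x. exp (t * x)) \<and> (\<integral>x. exp (t * x) \<partial>\<nu>) \<le> exp (t\<^sup>2 * s / 2))"

definition has_subgaussian_parameter :: "real measure \<Rightarrow> real \<Rightarrow> bool" where
  "has_subgaussian_parameter \<nu> s \<longleftrightarrow>
     subgaussian_bound \<nu> s \<and> (\<forall>s'. subgaussian_bound \<nu> s' \<longrightarrow> s \<le> s')"

definition subgaussian_law :: "real measure \<Rightarrow> real \<Rightarrow> bool" where
  "subgaussian_law \<nu> s \<longleftrightarrow> prob_space \<nu> \<and> sets \<nu> = sets borel \<and>
     integrable \<nu> (\<lambda>x. x) \<and> (\<integral>x. x \<partial>\<nu>) = 0 \<and> has_subgaussian_parameter \<nu> s"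

text \<open>
  A randomized oracle is a jointly measurable function of its input matrix and of a random seed
  with law \<open>S\<close>; every call will use a fresh independent seed. Real seeds are general enough:
  every Borel probability kernel with values in \<open>R^n\<close> arises in this way.
\<close>

definition qfm_oracle ::
  "real measure \<Rightarrow> nat \<Rightarrow> rvec set \<Rightarrow> real \<Rightarrow> real \<Rightarrow> (rmat \<Rightarrow> real \<Rightarrow> rvec) \<Rightarrow> bool" where
  "qfm_oracle S n K' \<kappa> q Q \<longleftrightarrow> 1 \<le> \<kappa> \<and>
     (\<lambda>(X, s). Q X s) \<in> borel_measurable (borel \<Otimes>\<^sub>M S) \<and>
     (\<forall>X. psd n X \<longrightarrow>
        (\<forall>s\<in>space S. Q X s \<in> K') \<and>
        measure S {s \<in> space S. quad n X (Q X s) \<ge> (1 / \<kappa>) * (SUP p\<in>K'. quad n X p)} \<ge> 1 - q)"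

text \<open>\<open>P K' \<epsilon> z\<close> is the point that the approximate projection onto \<open>K'\<close> with tolerance \<open>\<epsilon>\<close> returns.\<close>

definition weak_projection :: "nat \<Rightarrow> (rvec set \<Rightarrow> real \<Rightarrow> rvec \<Rightarrow> rvec) \<Rightarrow> bool" where
  "weak_projection n P \<longleftrightarrow>
     (\<forall>K' \<epsilon>. convex_body n K' \<and> 0 < \<epsilon> \<longrightarrow>
        P K' \<epsilon> \<in> borel_measurable borel \<and>
        (\<forall>z\<in>Rn n. P K' \<epsilon> z \<in> K' \<and>
           edist n z (P K' \<epsilon> z) \<le> (INF x\<in>K'. edist n z x) + \<epsilon>))"

definition is_projection :: "nat \<Rightarrow> rvec set \<Rightarrow> rvec \<Rightarrow> rvec \<Rightarrow> bool" where
  "is_projection n S z p \<longleftrightarrow> p \<in> S \<and> (\<forall>w\<in>S. edist n z p \<le> edist n z w)"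

definition capped_simplex :: "nat \<Rightarrow> nat \<Rightarrow> rvec set" where
  "capped_simplex n m =
     {w \<in> Rn n. (\<forall>i<n. 0 \<le> w i \<and> w i \<le> 1) \<and> (\<Sum>i<n. w i) = real n - real m}"

text \<open>
  The matrix chosen below does not depend on the eigendecomposition: the projection onto the
  capped simplex commutes with permutations and gives equal values to equal eigenvalues.
\<close>

definition sdp_update :: "nat \<Rightarrow> nat \<Rightarrow> real \<Rightarrow> rvec \<Rightarrow> rmat \<Rightarrow> rmat" where
  "sdp_update n m g p X =
     (SOME X'. \<exists>U l v. orthogonal_mat n U \<and> l \<in> Rn n \<and>
        (\<lambda>i j. X i j - g * (p i * p j)) = matmul n (matmul n U (diagm n l)) (mtrans U) \<and>
        is_projection n (capped_simplex n m) l v \<and>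
        X' = matmul n (matmul n U (diagm n v)) (mtrans U))"

definition sdp_start :: "nat \<Rightarrow> nat \<Rightarrow> rmat" where
  "sdp_start n m = (\<lambda>i j. (real n - real m) / real n * idm n i j)"

definition sdp_step :: "nat \<Rightarrow> real \<Rightarrow> real \<Rightarrow> rvec \<Rightarrow> real" where
  "sdp_step n C \<kappa> p = (1 / (\<kappa> * C\<^sup>2)) / (enorm n p)\<^sup>2"

definition sdp_iters :: "nat \<Rightarrow> nat \<Rightarrow> real \<Rightarrow> real \<Rightarrow> nat" where
  "sdp_iters n m C \<kappa> = max 1 (nat \<lceil>4 * (real n - real m) * C ^ 4 * \<kappa>\<^sup>2\<rceil>)"

text \<open>
  Iterations (and below the rounds of the algorithm) are numbered from \<open>0\<close>: \<open>sdp_iterate \<dots> k\<close> is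
  the iterate number \<open>k + 1\<close>. The argument \<open>Q k\<close> answers the oracle call of that iteration. An
  answer \<open>p = 0\<close>, possible only when the call fails, gets step size \<open>0\<close> by \<open>x / 0 = 0\<close>.
\<close>

primrec sdp_iterate :: "nat \<Rightarrow> nat \<Rightarrow> real \<Rightarrow> real \<Rightarrow> (nat \<Rightarrow> rmat \<Rightarrow> rvec) \<Rightarrow> nat \<Rightarrow> rmat" where
  "sdp_iterate n m C \<kappa> Q 0 = sdp_start n m"
| "sdp_iterate n m C \<kappa> Q (Suc k) =
     (let X = sdp_iterate n m C \<kappa> Q k; p = Q k X
      in sdp_update n m (sdp_step n C \<kappa> p) p X)"

definition SDP :: "nat \<Rightarrow> nat \<Rightarrow> real \<Rightarrow> real \<Rightarrow> (nat \<Rightarrow> rmat \<Rightarrow> rvec) \<Rightarrow> rmat" where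
  "SDP n m C \<kappa> Q =
     (if m = n then sdp_start n m
      else let X = sdp_iterate n m C \<kappa> Q;
               g = (\<lambda>k. sdp_step n C \<kappa> (Q k (X k)));
               N = sdp_iters n m C \<kappa>
           in (\<lambda>i j. (\<Sum>k<N. g k * X k i j) / (\<Sum>k<N. g k)))"

definition Ltil :: "real \<Rightarrow> real" where
  "Ltil L = L / (sqrt 3 + 1)"

primrec dtil :: "real \<Rightarrow> real \<Rightarrow> nat \<Rightarrow> real" where
  "dtil L R 0 = 2 * R"
| "dtil L R (Suc j) = 2 * (sqrt 3 + 1) * dtil L R j / Ltil L"

definition rounds :: "real \<Rightarrow> real \<Rightarrow> real \<Rightarrow> nat" where
  "rounds L r R = nat \<lceil>log (Ltil L / (2 * (sqrt 3 + 1))) (R / r)\<rceil>"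

definition body :: "nat \<Rightarrow> real \<Rightarrow> rvec set \<Rightarrow> real \<Rightarrow> nat \<Rightarrow> rvec set" where
  "body n L K R j = (if j = 0 then K else K \<inter> ecball n (\<lambda>_. 0) (dtil L R j / 2))"

definition round_dim :: "nat \<Rightarrow> real \<Rightarrow> real \<Rightarrow> real \<Rightarrow> real \<Rightarrow> nat \<Rightarrow> nat" where
  "round_dim n C L \<sigma> R j = min n (nat \<lceil>(dtil L R j)\<^sup>2 / (C\<^sup>2 * \<sigma>\<^sup>2)\<rceil>)"

definition fail_prob ::
  "nat \<Rightarrow> real \<Rightarrow> real \<Rightarrow> (rvec set \<Rightarrow> real) \<Rightarrow> rvec set \<Rightarrow> real \<Rightarrow> real \<Rightarrow> nat \<Rightarrow> real" where
  "fail_prob n C L \<kappa> K \<sigma> R j =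
     (1 / real (sdp_iters n (round_dim n C L \<sigma> R j) C (\<kappa> (body n L K R j))))
       / (1 + (dtil L R j) ^ 3 / \<sigma> ^ 3)"

text \<open>
  \<open>\<kappa> K'\<close> is the factor of the oracle for \<open>K'\<close>, \<open>Orc K' q\<close> the oracle for \<open>K'\<close> with failure
  probability \<open>q\<close>, and \<open>s (j, k)\<close> the seed of its \<open>k\<close>-th call in round \<open>j\<close>.
\<close>

definition round_update ::
  "nat \<Rightarrow> real \<Rightarrow> real \<Rightarrow> (rvec set \<Rightarrow> real) \<Rightarrow> (rvec set \<Rightarrow> real \<Rightarrow> rmat \<Rightarrow> real \<Rightarrow> rvec) \<Rightarrow>
   (rvec set \<Rightarrow> real \<Rightarrow> rvec \<Rightarrow> rvec) \<Rightarrow> rvec set \<Rightarrow> real \<Rightarrow> real \<Rightarrow> rvec \<Rightarrow> (nat \<times> nat \<Rightarrow> real) \<Rightarrow>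
   nat \<Rightarrow> rvec \<Rightarrow> rvec" where
  "round_update n C L \<kappa> Orc P K R \<sigma> Y s j \<mu>hat =
     (let d = dtil L R j;
          Kj = body n L K R j;
          m = round_dim n C L \<sigma> R j;
          q = fail_prob n C L \<kappa> K \<sigma> R j;
          X = SDP n m C (\<kappa> Kj) (\<lambda>k Z. Orc Kj q Z (s (j, k)));
          A = psd_sqrt n (\<lambda>i l. idm n i l - X i l);
          \<mu>tilde = (\<lambda>i. (matvec n A Y i - matvec n A \<mu>hat i) / 2);
          \<mu>bar = P Kj (d / L) \<mu>tilde
      in P K (2 * d / Ltil L) (\<lambda>i. 2 * \<mu>bar i + \<mu>hat i))"

text \<open>The first argument of the loop counts the rounds that remain, \<open>j\<close> is the current round.\<close>

primrec algE_loop ::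
  "nat \<Rightarrow> nat \<Rightarrow> real \<Rightarrow> real \<Rightarrow> (rvec set \<Rightarrow> real) \<Rightarrow> (rvec set \<Rightarrow> real \<Rightarrow> rmat \<Rightarrow> real \<Rightarrow> rvec) \<Rightarrow>
   (rvec set \<Rightarrow> real \<Rightarrow> rvec \<Rightarrow> rvec) \<Rightarrow> rvec set \<Rightarrow> real \<Rightarrow> real \<Rightarrow> real \<Rightarrow> rvec \<Rightarrow>
   (nat \<times> nat \<Rightarrow> real) \<Rightarrow> nat \<Rightarrow> rvec \<Rightarrow> rvec" where
  "algE_loop 0 n C L \<kappa> Orc P K r R \<sigma> Y s j \<mu>hat = \<mu>hat"
| "algE_loop (Suc i) n C L \<kappa> Orc P K r R \<sigma> Y s j \<mu>hat =
     (let \<mu>hat' = round_update n C L \<kappa> Orc P K R \<sigma> Y s j \<mu>hat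
      in if dtil L R (Suc j) \<le> max (2 * r) (C * \<sigma>) then \<mu>hat'
         else algE_loop i n C L \<kappa> Orc P K r R \<sigma> Y s (Suc j) \<mu>hat')"

definition algE ::
  "nat \<Rightarrow> real \<Rightarrow> real \<Rightarrow> (rvec set \<Rightarrow> real) \<Rightarrow> (rvec set \<Rightarrow> real \<Rightarrow> rmat \<Rightarrow> real \<Rightarrow> rvec) \<Rightarrow>
   (rvec set \<Rightarrow> real \<Rightarrow> rvec \<Rightarrow> rvec) \<Rightarrow> rvec set \<Rightarrow> real \<Rightarrow> real \<Rightarrow> real \<Rightarrow> rvec \<Rightarrow>
   (nat \<times> nat \<Rightarrow> real) \<Rightarrow> rvec" where
  "algE n C L \<kappa> Orc P K r R \<sigma> Y s =
     (if \<sigma> \<le> r / sqrt (real n) then Y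
      else algE_loop (rounds L r R) n C L \<kappa> Orc P K r R \<sigma> Y s 0 (\<lambda>_. 0))"

text \<open>
  The noise has i.i.d. components with law \<open>\<nu>\<close>; the oracle seeds are i.i.d. with law \<open>S\<close> and
  independent of the noise.
\<close>

definition sample_space :: "nat \<Rightarrow> real measure \<Rightarrow> real measure \<Rightarrow> (rvec \<times> (nat \<times> nat \<Rightarrow> real)) measure" where
  "sample_space n \<nu> S = (\<Pi>\<^sub>M i\<in>{..<n}. \<nu>) \<Otimes>\<^sub>M (\<Pi>\<^sub>M jk\<in>UNIV. S)"

text \<open>Points of the product over \<open>{..<n}\<close> are \<open>undefined\<close> from index \<open>n\<close> on, whence the conditional.\<close>

definition observation :: "nat \<Rightarrow> rvec \<Rightarrow> rvec \<Rightarrow> rvec" where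
  "observation n \<mu> \<xi> = (\<lambda>i. if i < n then \<mu> i + \<xi> i else 0)"

text \<open>
  Factors are at least \<open>1\<close>; the element \<open>1\<close> only matters when there are no rounds at all, that
  is, when \<open>R = r\<close>.
\<close>

definition kappa_bar ::
  "nat \<Rightarrow> real \<Rightarrow> (rvec set \<Rightarrow> real) \<Rightarrow> rvec set \<Rightarrow> real \<Rightarrow> real \<Rightarrow> real" where
  "kappa_bar n L \<kappa> K r R = Max (insert 1 ((\<lambda>j. \<kappa> (body n L K R j)) ` {..<rounds L r R}))"

definition Lambda_fac :: "real \<Rightarrow> real \<Rightarrow> real \<Rightarrow> real" where
  "Lambda_fac c kb T = 1 + of_int \<lceil>log c (sqrt kb * sqrt 2 * T)\<rceil>"

definition Upsilon_fac :: "real \<Rightarrow> real \<Rightarrow> real \<Rightarrow> real \<Rightarrow> real" where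
  "Upsilon_fac c C kb T =
     (max 1 (max (2 * sqrt 2 * T * sqrt kb) (2 * C * sqrt (Lambda_fac c kb T))))\<^sup>2"

end

theory Submission imports Defs begin

text \<open>
  The SDP procedure is projected gradient descent on the set of matrices \<open>0 \<le> X \<le> I\<close> of trace
  \<open>n - m\<close>. Its regret against the projector on the lowest \<open>n - m\<close> eigenvectors of the weighted sum
  of the oracle answers \<open>p p\<^sup>T\<close> bounds the quadratic form of \<open>X\<^sup>\<star>\<^sup>\<star>\<close> on the body by the tail of the
  spectrum of that sum. If the tail were large, then a Gaussian vector with this covariance would,
  by type 2, lie in a multiple of \<open>K\<close> with probability at least 1/2, and by a small ball estimate no
  small ball would carry much of its mass; so \<open>K\<close> would have larger local packings than \<open>\<eta>\<^sup>\<star>\<close> permits.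
  Hence in every round above the scale \<open>\<eta>\<^sup>\<star>\<close> the bias is small, while the projected noise is small
  outside an event of probability \<open>O((\<sigma> / d)\<^sup>3)\<close> by a sub-Gaussian bound for quadratic forms. A good
  round halves the error, a bad one moves the estimate by at most three times its scale, and the
  resulting geometric series gives the risk bound.
\<close>

subsection \<open>The spectral theorem\<close>

text \<open>Two terms of \<open>Upsilon_fac\<close> do the geometric work. A piece of
  \<open>K\<close> of radius about \<open>d / T2\<close> is covered by refining local packings by
  the factor \<open>c\<close> down to a radius fixed by the spectral tail. The term with
  \<open>T2\<close> and \<open>sqrt kb\<close> keeps all intermediate scales above
  \<open>2 * eta_star\<close>, where the local entropy is controlled. The number of refinements is
  of order \<open>Lambda_fac\<close>, and the term \<open>2 * C * sqrt (Lambda_fac ...)\<close>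
  keeps their total entropy below \<open>m\<close>, which is about
  \<open>d^2 / (C \<sigma>)^2\<close>. The exponent 3 comes from the summation over rounds: a bad
  round costs \<open>d^2\<close>, so probability \<open>(\<sigma> / d)^2\<close> would cost
  \<open>\<sigma>^2\<close> per round and bring in the number of rounds, whereas the costs
  \<open>\<sigma>^3 / d\<close> form a geometric series dominated by its last term. The same noise
  is used in every round. The matrix of a round depends on the oracle seeds alone, so its noise
  bound holds although the current estimate depends on the data. The dimension is a bound variable,
  so linear algebra is done with functions that vanish from index \<open>n\<close> on. The update
  and the square root are defined by choice, so the measurability of the estimator needs an argument
  of its own.\<close>

definition ip :: "nat \<Rightarrow> rvec \<Rightarrow> rvec \<Rightarrow> real" where
  "ip n x y = (\<Sum>i<n. x i * y i)"

lemma enorm_sq: "(enorm n x)\<^sup>2 = ip n x x"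
  unfolding enorm_def L2_set_def ip_def by (simp add: sum_nonneg power2_eq_square)

lemma enorm_eq_sqrt: "enorm n x = sqrt (ip n x x)"
  unfolding enorm_def L2_set_def ip_def by (simp add: power2_eq_square)

lemma enorm_nonneg [simp]: "0 \<le> enorm n x"
  by (simp add: enorm_def)

lemma ip_nonneg [simp]: "0 \<le> ip n x x"
  by (simp flip: enorm_sq)

lemma ip_commute: "ip n x y = ip n y x"
  by (simp add: ip_def mult.commute)

lemma ip_add_left: "ip n (\<lambda>i. x i + y i) z = ip n x z + ip n y z"
  and ip_diff_left: "ip n (\<lambda>i. x i - y i) z = ip n x z - ip n y z"
  and ip_scale_left: "ip n (\<lambda>i. a * x i) z = a * ip n x z"
  and ip_minus_left: "ip n (\<lambda>i. - x i) z = - ip n x z"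
  and ip_sum_left: "ip n (\<lambda>i. \<Sum>k\<in>I. f k i) z = (\<Sum>k\<in>I. ip n (f k) z)"
  by (simp_all add: ip_def algebra_simps sum.distrib sum_subtractf sum_distrib_left sum_negf)
    (subst sum.swap, simp)

lemma ip_add_right: "ip n z (\<lambda>i. x i + y i) = ip n z x + ip n z y"
  and ip_diff_right: "ip n z (\<lambda>i. x i - y i) = ip n z x - ip n z y"
  and ip_scale_right: "ip n z (\<lambda>i. a * x i) = a * ip n z x"
  and ip_minus_right: "ip n z (\<lambda>i. - x i) = - ip n z x"
  and ip_sum_right: "ip n z (\<lambda>i. \<Sum>k\<in>I. f k i) = (\<Sum>k\<in>I. ip n z (f k))"
  using ip_add_left ip_diff_left ip_scale_left ip_minus_left ip_sum_left
  by (metis ip_commute, metis ip_commute, metis ip_commute, metis ip_commute)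
    (simp only: ip_commute[of n z] ip_sum_left)

lemmas ip_linear = ip_add_left ip_diff_left ip_scale_left ip_minus_left ip_sum_left
  ip_add_right ip_diff_right ip_scale_right ip_minus_right ip_sum_right

lemma ip_eq_0_iff: "ip n x x = 0 \<longleftrightarrow> (\<forall>i<n. x i = 0)"
  unfolding ip_def by (subst sum_nonneg_eq_0_iff) auto

lemma ip_pos: "ip n x x \<noteq> 0 \<Longrightarrow> 0 < ip n x x"
  by (simp add: less_le)

lemma enorm_triangle: "enorm n (\<lambda>i. x i + y i) \<le> enorm n x + enorm n y"
  unfolding enorm_def by (rule L2_set_triangle_ineq)

lemma enorm_scale: "enorm n (\<lambda>i. a * x i) = \<bar>a\<bar> * enorm n x"
  by (simp add: enorm_eq_sqrt ip_linear flip: mult.assoc) (simp add: real_sqrt_mult)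

lemma enorm_minus: "enorm n (\<lambda>i. - x i) = enorm n x"
  by (simp add: enorm_eq_sqrt ip_linear)

lemma enorm_zero [simp]: "enorm n (\<lambda>_. 0) = 0"
  by (simp add: enorm_eq_sqrt ip_def)

lemma edist_commute: "edist n x y = edist n y x"
  unfolding edist_def using enorm_minus[of n "\<lambda>i. x i - y i"] by simp

lemma edist_nonneg [simp]: "0 \<le> edist n x y"
  by (simp add: edist_def)

lemma edist_self [simp]: "edist n x x = 0"
  by (simp add: edist_def)

lemma edist_triangle: "edist n x z \<le> edist n x y + edist n y z"
  using enorm_triangle[of n "\<lambda>i. x i - y i" "\<lambda>i. y i - z i"] by (simp add: edist_def)

lemma edist_zero [simp]: "edist n x (\<lambda>_. 0) = enorm n x" "edist n (\<lambda>_. 0) x = enorm n x"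
  by (simp_all add: edist_def enorm_minus)

lemma edist_scale: "edist n (\<lambda>i. a * x i) (\<lambda>i. a * y i) = \<bar>a\<bar> * edist n x y"
  using enorm_scale[of n a "\<lambda>i. x i - y i"] by (simp add: edist_def algebra_simps)

lemma abs_le_enorm: "i < n \<Longrightarrow> \<bar>x i\<bar> \<le> enorm n x"
  unfolding enorm_def L2_set_def
  by (rule real_le_rsqrt) (auto intro: member_le_sum)

lemma Rn_add: "x \<in> Rn n \<Longrightarrow> y \<in> Rn n \<Longrightarrow> (\<lambda>i. x i + y i) \<in> Rn n"
  and Rn_diff: "x \<in> Rn n \<Longrightarrow> y \<in> Rn n \<Longrightarrow> (\<lambda>i. x i - y i) \<in> Rn n"
  and Rn_scale: "x \<in> Rn n \<Longrightarrow> (\<lambda>i. a * x i) \<in> Rn n"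
  and Rn_minus: "x \<in> Rn n \<Longrightarrow> (\<lambda>i. - x i) \<in> Rn n"
  and Rn_zero: "(\<lambda>_. 0) \<in> Rn n"
  and Rn_sum: "(\<And>k. k \<in> I \<Longrightarrow> f k \<in> Rn n) \<Longrightarrow> (\<lambda>i. \<Sum>k\<in>I. f k i) \<in> Rn n"
  by (simp_all add: Rn_def)

lemma Rn_matvec: "A \<in> Mn n \<Longrightarrow> matvec n A x \<in> Rn n"
  by (simp add: Rn_def Mn_def matvec_def)

section \<open>Topology of R^n inside the function space\<close>

lemma closed_Rn: "closed (Rn n)"
proof -
  have "Rn n = (\<Inter>i\<in>{n..}. {x. x i = 0})" by (auto simp: Rn_def)
  moreover have "closed {x::rvec. x i = 0}" for i
    by (intro closed_Collect_eq continuous_on_product_coordinates continuous_on_const)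
  ultimately show ?thesis by (simp add: closed_INT)
qed

lemma continuous_on_ip:
  assumes f: "continuous_on S f" and g: "continuous_on S g"
  shows "continuous_on S (\<lambda>x. ip n (f x) (g x))"
  unfolding ip_def
  by (intro continuous_on_sum continuous_on_mult f[THEN continuous_on_product_then_coordinatewise]
      g[THEN continuous_on_product_then_coordinatewise])

lemma continuous_on_enorm: "continuous_on S f \<Longrightarrow> continuous_on S (\<lambda>x. enorm n (f x))"
  unfolding enorm_eq_sqrt by (intro continuous_on_real_sqrt continuous_on_ip)

lemma continuous_on_edist:
  assumes f: "continuous_on S f" and g: "continuous_on S g"
  shows "continuous_on S (\<lambda>x. edist n (f x) (g x))"
  unfolding edist_def
  by (rule continuous_on_enorm, rule continuous_on_coordinatewise_then_product)
    (intro continuous_on_diff f[THEN continuous_on_product_then_coordinatewise]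
      g[THEN continuous_on_product_then_coordinatewise])

lemma continuous_on_coord: "continuous_on S (\<lambda>x. x i)"
  by (rule continuous_on_product_then_coordinatewise[OF continuous_on_id])

lemma continuous_on_quad: "continuous_on S (quad n A)"
  unfolding quad_def
  by (intro continuous_on_sum continuous_on_mult continuous_on_coord continuous_on_const)

text \<open>Tychonoff: the coordinates from \<open>n\<close> on range over the compact set
  \<open>{0}\<close>, so bounds on the first \<open>n\<close> suffice. Maximizing eigenvectors and
  nearest points of the capped simplex are obtained from it.\<close>

lemma compact_Rn_bounded:
  assumes "closed S" "S \<subseteq> Rn n" "\<And>x i. x \<in> S \<Longrightarrow> i < n \<Longrightarrow> \<bar>x i\<bar> \<le> B"
  shows "compact S"
proof -
  define I where "I = (\<lambda>i::nat. if i < n then {-B..B} else {0::real})"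
  have "compactin euclidean (I i)" for i by (simp add: I_def)
  then have "compactin (product_topology (\<lambda>i. euclidean) UNIV) (PiE UNIV I)"
    by (subst compactin_PiE) blast
  then have "compact (PiE UNIV I)"
    by (simp add: euclidean_product_topology)
  then have "compact (S \<inter> PiE UNIV I)"
    by (rule closed_Int_compact[OF assms(1)])
  moreover have "S \<subseteq> PiE UNIV I"
  proof
    fix x assume x: "x \<in> S"
    have "x i \<in> I i" for i
      using assms(3)[OF x, of i] assms(2) x by (auto simp: Rn_def abs_le_iff I_def)
    then show "x \<in> PiE UNIV I" by (intro PiE_I) simp_all
  qed
  ultimately show ?thesis by (simp add: Int_absorb2)
qed

lemma quad_ip: "quad n A x = ip n x (matvec n A x)"
  by (simp add: quad_def ip_def matvec_def sum_distrib_left algebra_simps)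

lemma ip_matvec_sym: "mtrans A = A \<Longrightarrow> ip n (matvec n A x) y = ip n x (matvec n A y)"
proof -
  assume "mtrans A = A"
  then have A: "A i j = A j i" for i j by (metis mtrans_def)
  have "ip n (matvec n A x) y = (\<Sum>i<n. \<Sum>j<n. A i j * x j * y i)"
    by (simp add: ip_def matvec_def sum_distrib_right)
  also have "\<dots> = (\<Sum>j<n. \<Sum>i<n. A i j * x j * y i)" by (rule sum.swap)
  also have "\<dots> = ip n x (matvec n A y)"
    by (simp add: ip_def matvec_def sum_distrib_left A algebra_simps)
  finally show ?thesis .
qed

lemma matvec_add: "matvec n A (\<lambda>i. x i + y i) = (\<lambda>i. matvec n A x i + matvec n A y i)"
  and matvec_scale: "matvec n A (\<lambda>i. a * x i) = (\<lambda>i. a * matvec n A x i)"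
  and matvec_diff: "matvec n A (\<lambda>i. x i - y i) = (\<lambda>i. matvec n A x i - matvec n A y i)"
  by (simp_all add: matvec_def algebra_simps sum.distrib sum_subtractf sum_distrib_left fun_eq_iff)

section \<open>Eigenbasis by successive maximization of the quadratic form\<close>

definition orthonormal :: "nat \<Rightarrow> nat \<Rightarrow> (nat \<Rightarrow> rvec) \<Rightarrow> bool" where
  "orthonormal n k u \<longleftrightarrow> (\<forall>a<k. u a \<in> Rn n) \<and>
     (\<forall>a<k. \<forall>b<k. ip n (u a) (u b) = (if a = b then 1 else 0))"

text \<open>For orthonormal \<open>u\<close>, the component of the \<open>i\<close>-th standard
  basis vector orthogonal to the span of the first \<open>k\<close> vectors.\<close>

definition resid :: "nat \<Rightarrow> (nat \<Rightarrow> rvec) \<Rightarrow> nat \<Rightarrow> rvec" where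
  "resid k u i = (\<lambda>j. (if j = i then 1 else 0) - (\<Sum>a<k. u a i * u a j))"

lemma ip_unit: "i < n \<Longrightarrow> ip n (\<lambda>j. if j = i then 1 else 0) x = x i"
  by (simp add: ip_def if_distrib[of "\<lambda>t. t * _"] cong: if_cong)

lemma resid_orth:
  assumes "orthonormal n k u" "i < n" "b < k"
  shows "ip n (resid k u i) (u b) = 0"
proof -
  have "ip n (resid k u i) (u b) = u b i - (\<Sum>a<k. u a i * ip n (u a) (u b))"
    by (simp add: resid_def ip_linear ip_unit assms)
  also have "(\<Sum>a<k. u a i * ip n (u a) (u b)) = (\<Sum>a<k. if a = b then u b i else 0)"
    using assms by (intro sum.cong) (auto simp: orthonormal_def)
  finally show ?thesis using assms by simp
qed

lemma resid_Rn:
  assumes "orthonormal n k u" "i < n"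
  shows "resid k u i \<in> Rn n"
  using assms by (auto simp: orthonormal_def resid_def Rn_def)

lemma resid_norm:
  assumes "orthonormal n k u" "i < n"
  shows "ip n (resid k u i) (resid k u i) = 1 - (\<Sum>a<k. (u a i)\<^sup>2)"
proof -
  have "ip n (resid k u i) (resid k u i) =
     ip n (resid k u i) (\<lambda>j. (if j = i then 1 else 0) - (\<Sum>a<k. u a i * u a j))"
    by (simp add: resid_def)
  also have "\<dots> = ip n (\<lambda>j. if j = i then 1 else 0) (resid k u i)
      - (\<Sum>a<k. u a i * ip n (resid k u i) (u a))"
    by (simp add: ip_linear ip_commute)
  also have "\<dots> = resid k u i i"
    using assms by (simp add: resid_orth ip_unit)
  finally show ?thesis by (simp add: resid_def power2_eq_square)
qed

text \<open>The sum is the trace of the projector onto the orthogonal complement, hence its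
  dimension. For \<open>k < n\<close> this yields a further orthogonal direction, for
  \<open>k = n\<close> completeness of the system.\<close>

lemma sum_resid_norm:
  assumes "orthonormal n k u"
  shows "(\<Sum>i<n. ip n (resid k u i) (resid k u i)) = real n - real k"
proof -
  have "(\<Sum>i<n. \<Sum>a<k. (u a i)\<^sup>2) = (\<Sum>a<k. ip n (u a) (u a))"
    by (subst sum.swap) (simp add: ip_def power2_eq_square)
  also have "\<dots> = real k" using assms by (simp add: orthonormal_def)
  finally show ?thesis
    using assms by (simp add: resid_norm sum_subtractf)
qed

lemma exists_orthogonal_unit:
  assumes "orthonormal n k u" "k < n"
  obtains x where "x \<in> Rn n" "ip n x x = 1" "\<forall>a<k. ip n x (u a) = 0"
proof -
  have "\<exists>i<n. 0 < ip n (resid k u i) (resid k u i)"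
  proof (rule ccontr)
    assume "\<not> ?thesis"
    then have "(\<Sum>i<n. ip n (resid k u i) (resid k u i)) \<le> 0"
      by (intro sum_nonpos) (meson lessThan_iff not_less)
    then show False using assms by (simp add: sum_resid_norm)
  qed
  then obtain i where i: "i < n" "0 < ip n (resid k u i) (resid k u i)" by blast
  let ?s = "1 / sqrt (ip n (resid k u i) (resid k u i))"
  let ?x = "\<lambda>j. ?s * resid k u i j"
  have "?x \<in> Rn n" using assms i by (intro Rn_scale resid_Rn)
  moreover have "ip n ?x ?x = 1"
    using i(2) by (simp only: ip_scale_left ip_scale_right) simp
  moreover have "\<forall>a<k. ip n ?x (u a) = 0"
    using assms i(1) by (simp only: ip_scale_left) (simp add: resid_orth)
  ultimately show ?thesis using that by blast
qed

lemma orthonormal_complete: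
  assumes "orthonormal n n u" "i < n" "j < n"
  shows "(\<Sum>a<n. u a i * u a j) = (if i = j then 1 else 0)"
proof -
  have "\<forall>i\<in>{..<n}. ip n (resid n u i) (resid n u i) = 0"
    using sum_resid_norm[OF assms(1)] sum_nonneg_eq_0_iff[of "{..<n}" "\<lambda>i. ip n (resid n u i) (resid n u i)"]
    by simp
  then have "resid n u i j = 0" using assms by (simp add: ip_eq_0_iff)
  then show ?thesis using assms by (auto simp: resid_def)
qed

text \<open>Obtained by maximizing the quadratic form over the unit sphere of the orthogonal
  complement: a symmetric \<open>A\<close> leaves the complement invariant, and at a maximizer the
  gradient within it is radial.\<close>

lemma next_eigenvector:
  assumes A: "A \<in> Mn n" "mtrans A = A" and u: "orthonormal n k u" "k < n"
    and ev: "\<And>a. a < k \<Longrightarrow> matvec n A (u a) = (\<lambda>i. l a * u a i)"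
  obtains x c where "x \<in> Rn n" "ip n x x = 1" "\<forall>a<k. ip n x (u a) = 0"
    "matvec n A x = (\<lambda>i. c * x i)"
proof -
  let ?S = "{x \<in> Rn n. ip n x x = 1 \<and> (\<forall>a<k. ip n x (u a) = 0)}"
  have "?S = Rn n \<inter> {x. ip n x x = 1} \<inter> (\<Inter>a\<in>{..<k}. {x. ip n x (u a) = 0})" by auto
  then have "closed ?S"
    by (simp only:) (intro closed_Int closed_INT ballI closed_Rn closed_Collect_eq continuous_on_ip
        continuous_on_const continuous_on_id)
  moreover have "\<bar>x i\<bar> \<le> 1" if "x \<in> ?S" "i < n" for x i
    using abs_le_enorm[OF that(2), of x] that(1) by (simp add: enorm_eq_sqrt)
  ultimately have "compact ?S" by (intro compact_Rn_bounded[of _ n 1]) auto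
  moreover have "?S \<noteq> {}"
  proof -
    obtain y where "y \<in> Rn n" "ip n y y = 1" "\<forall>a<k. ip n y (u a) = 0"
      using exists_orthogonal_unit[OF u] .
    then have "y \<in> ?S" by simp
    then show ?thesis by (metis empty_iff)
  qed
  ultimately have "\<exists>x\<in>?S. \<forall>y\<in>?S. quad n A y \<le> quad n A x"
    by (rule continuous_attains_sup) (rule continuous_on_quad)
  then obtain x where x: "x \<in> ?S" and sup: "\<forall>y\<in>?S. quad n A y \<le> quad n A x"
    by (rule bexE)
  define c where "c = quad n A x"
  have le: "quad n A y \<le> c * ip n y y" if y: "y \<in> Rn n" "\<forall>a<k. ip n y (u a) = 0" for y
  proof (cases "ip n y y = 0")
    case True
    then have "quad n A y = 0" by (simp add: ip_eq_0_iff quad_def)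
    then show ?thesis using True by simp
  next
    case False
    define t where "t = 1 / sqrt (ip n y y)"
    have pos: "0 < ip n y y" using False by (rule ip_pos)
    have t2: "t * (t * ip n y y) = 1" using pos by (simp add: t_def)
    have "(\<lambda>i. t * y i) \<in> ?S" using y t2 by (simp add: ip_scale_left ip_scale_right Rn_scale)
    from bspec[OF sup this] have "t * (t * quad n A y) \<le> c"
      by (simp add: c_def quad_ip matvec_scale ip_scale_left ip_scale_right)
    then have "ip n y y * (t * (t * quad n A y)) \<le> ip n y y * c"
      using pos by simp
    also have "ip n y y * (t * (t * quad n A y)) = (t * (t * ip n y y)) * quad n A y"
      by (simp add: mult_ac)
    finally show ?thesis by (simp add: t2 mult.commute)
  qed
  \<comment> \<open>Half the gradient of the Rayleigh quotient at \<open>x\<close>. Symmetry of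
    \<open>A\<close> makes it orthogonal to the earlier eigenvectors, so a move along it stays in
    the complement.\<close>
  define w where "w = (\<lambda>i. matvec n A x i - c * x i)"
  have wR: "w \<in> Rn n" unfolding w_def using x A by (intro Rn_diff Rn_scale Rn_matvec) auto
  have wu: "ip n w (u a) = 0" if "a < k" for a
    using x that by (simp add: w_def ip_linear ip_matvec_sym[OF A(2)] ev)
  have wx: "ip n x w = 0"
    using x by (simp add: w_def ip_linear c_def quad_ip)
  have Axw: "ip n (matvec n A x) w = ip n w w"
    using wx by (simp add: w_def ip_linear)
  have "ip n w w = 0"
  proof (rule ccontr)
    assume "ip n w w \<noteq> 0"
    then have pos: "0 < ip n w w" by (rule ip_pos)
    define b where "b = c * ip n w w - quad n A w"
    \<comment> \<open>A move by \<open>t * w\<close> gains \<open>2 * t * ip n w w\<close> to first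
      order, and maximality of \<open>x\<close> leaves only second-order terms to pay for
      it.\<close>
    have key: "2 * t * ip n w w \<le> t\<^sup>2 * b" for t
    proof -
      let ?y = "\<lambda>i. x i + t * w i"
      have "quad n A ?y = c + 2 * t * ip n w w + t\<^sup>2 * quad n A w"
        using Axw ip_matvec_sym[OF A(2), of n x w] ip_commute[of n w "matvec n A x"]
        by (simp add: quad_ip matvec_add matvec_scale ip_linear c_def algebra_simps power2_eq_square)
      moreover have "ip n ?y ?y = 1 + t\<^sup>2 * ip n w w"
        using x wx ip_commute[of n w x] by (simp add: ip_linear algebra_simps power2_eq_square)
      moreover have "quad n A ?y \<le> c * ip n ?y ?y"
        using x wR wu by (intro le Rn_add Rn_scale) (auto simp: ip_linear)
      ultimately show ?thesis by (simp add: b_def algebra_simps)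
    qed
    \<comment> \<open>Small enough that \<open>t * b\<close> is at most \<open>ip n w w\<close>,
      which contradicts \<open>key\<close> after division by \<open>t\<close>.\<close>
    define t where "t = ip n w w / (\<bar>b\<bar> + 1)"
    have t: "0 < t" using pos by (simp add: t_def)
    have "2 * ip n w w \<le> t * b"
      using key[of t] t by (simp add: power2_eq_square)
    also have "\<dots> \<le> t * (\<bar>b\<bar> + 1)" using t by (intro mult_left_mono) auto
    also have "\<dots> = ip n w w" by (simp add: t_def)
    finally show False using pos by simp
  qed
  then have "matvec n A x = (\<lambda>i. c * x i)"
  proof (intro ext)
    fix i
    have "w i = 0" using wR \<open>ip n w w = 0\<close> by (cases "i < n") (auto simp: ip_eq_0_iff Rn_def)
    then show "matvec n A x i = c * x i" by (simp add: w_def)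
  qed
  then show ?thesis using that[of x c] x(1) by auto
qed

lemma exists_eigenbasis:
  assumes A: "A \<in> Mn n" "mtrans A = A" and k: "k \<le> n"
  shows "\<exists>u l. orthonormal n k u \<and> (\<forall>a<k. matvec n A (u a) = (\<lambda>i. l a * u a i))"
  using k
proof (induction k)
  case 0
  then show ?case by (simp add: orthonormal_def)
next
  case (Suc k)
  then have kn: "k < n" by simp
  have "\<exists>u l. orthonormal n k u \<and> (\<forall>a<k. matvec n A (u a) = (\<lambda>i. l a * u a i))"
    by (rule Suc.IH) (use kn in simp)
  then obtain u l
    where ul: "orthonormal n k u \<and> (\<forall>a<k. matvec n A (u a) = (\<lambda>i. l a * u a i))"
    by (elim exE)
  then have u: "orthonormal n k u" "\<And>a. a < k \<Longrightarrow> matvec n A (u a) = (\<lambda>i. l a * u a i)"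
    by simp_all
  obtain x c where x: "x \<in> Rn n" "ip n x x = 1" "\<forall>a<k. ip n x (u a) = 0"
    "matvec n A x = (\<lambda>i. c * x i)"
    using next_eigenvector[OF A u(1) kn u(2)] .
  have "\<forall>a<k. ip n (u a) x = 0" using x(3) by (simp only: ip_commute[of n x])
  then have "orthonormal n (Suc k) (u(k := x))"
    using u(1) x(1-3) unfolding orthonormal_def
    by (simp add: less_Suc_eq)
  moreover have "\<forall>a<Suc k. matvec n A ((u(k := x)) a) = (\<lambda>i. (l(k := c)) a * (u(k := x)) a i)"
    using u(2) x(4) by (simp add: less_Suc_eq)
  ultimately show ?case by (intro exI conjI)
qed

text \<open>The matrix U diag(l) U^T as a sum of rank-one terms. With \<open>U\<close> fixed, a
  change of \<open>l\<close> applies a scalar function to the eigenvalues; projections and square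
  roots are handled in this form.\<close>

definition spec :: "nat \<Rightarrow> rmat \<Rightarrow> rvec \<Rightarrow> rmat" where
  "spec n U l = (\<lambda>i j. \<Sum>k<n. l k * (U i k * U j k))"

lemma matmul_spec: "matmul n (matmul n U (diagm n l)) (mtrans U) = spec n U l"
proof -
  have "matmul n U (diagm n l) i k = l k * U i k" if "k < n" for i k
    using that by (simp add: matmul_def diagm_def if_distrib[of "\<lambda>t. _ * t"] cong: if_cong)
  then show ?thesis
    by (simp add: matmul_def[of n "matmul n U (diagm n l)"] spec_def mtrans_def fun_eq_iff algebra_simps)
qed

lemma idm_entry: "idm n i j = (if i = j \<and> i < n then 1 else 0)"
  by (simp add: idm_def diagm_def)

lemma orthogonal_matD:
  assumes "orthogonal_mat n U"
  shows "U \<in> Mn n" "\<And>k l. k < n \<Longrightarrow> l < n \<Longrightarrow> (\<Sum>i<n. U i k * U i l) = (if k = l then 1 else 0)"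
    "\<And>i j. i < n \<Longrightarrow> j < n \<Longrightarrow> (\<Sum>k<n. U i k * U j k) = (if i = j then 1 else 0)"
proof -
  show "U \<in> Mn n" using assms by (simp add: orthogonal_mat_def)
  have "matmul n (mtrans U) U k l = idm n k l" "matmul n U (mtrans U) k l = idm n k l" for k l
    using assms by (simp_all add: orthogonal_mat_def)
  then show "\<And>k l. k < n \<Longrightarrow> l < n \<Longrightarrow> (\<Sum>i<n. U i k * U i l) = (if k = l then 1 else 0)"
    "\<And>i j. i < n \<Longrightarrow> j < n \<Longrightarrow> (\<Sum>k<n. U i k * U j k) = (if i = j then 1 else 0)"
    by (auto simp: matmul_def mtrans_def idm_entry)
qed

theorem spectral_theorem:
  assumes A: "A \<in> Mn n" "mtrans A = A"
  obtains U l where "orthogonal_mat n U" "l \<in> Rn n" "A = spec n U l"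
proof -
  obtain u l where u: "orthonormal n n u" and ev: "\<And>a. a < n \<Longrightarrow> matvec n A (u a) = (\<lambda>i. l a * u a i)"
    using exists_eigenbasis[OF A order_refl] by (elim exE conjE) simp
  define U where "U = (\<lambda>i a. if a < n then u a i else 0)"
  define l' where "l' = (\<lambda>a. if a < n then l a else 0)"
  have U: "U \<in> Mn n" using u by (auto simp: U_def Mn_def orthonormal_def Rn_def)
  then have Ui: "U i k = 0" if "i \<ge> n \<or> k \<ge> n" for i k using that by (auto simp: Mn_def)
  have "matmul n (mtrans U) U i j = idm n i j" for i j
  proof (cases "i < n \<and> j < n")
    case True
    then have "matmul n (mtrans U) U i j = ip n (u i) (u j)"
      by (simp add: matmul_def mtrans_def U_def ip_def)
    then show ?thesis using True u by (simp add: idm_entry orthonormal_def)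
  next
    case False
    then show ?thesis using Ui by (auto simp: matmul_def mtrans_def idm_entry)
  qed
  moreover have "matmul n U (mtrans U) i j = idm n i j" for i j
  proof (cases "i < n \<and> j < n")
    case True
    then have "matmul n U (mtrans U) i j = (\<Sum>a<n. u a i * u a j)"
      by (simp add: matmul_def mtrans_def U_def)
    then show ?thesis using True orthonormal_complete[OF u, of i j] by (simp add: idm_entry)
  next
    case False
    then show ?thesis using Ui by (auto simp: matmul_def mtrans_def idm_entry)
  qed
  ultimately have "orthogonal_mat n U" using U by (simp add: orthogonal_mat_def fun_eq_iff)
  moreover have "l' \<in> Rn n" by (simp add: l'_def Rn_def)
  moreover have Aij: "A i j = spec n U l' i j" for i j
  proof (cases "i < n \<and> j < n")
    case True
    have "A i j = (\<Sum>k<n. A i k * (if k = j then 1 else 0))"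
      using True by (simp add: if_distrib[of "\<lambda>t. _ * t"] cong: if_cong)
    also have "\<dots> = (\<Sum>k<n. A i k * (\<Sum>a<n. u a k * u a j))"
      using True by (intro sum.cong) (auto simp: orthonormal_complete[OF u])
    also have "\<dots> = (\<Sum>a<n. matvec n A (u a) i * u a j)"
      by (simp add: matvec_def sum_distrib_left sum_distrib_right mult.assoc) (rule sum.swap)
    also have "\<dots> = spec n U l' i j"
      by (simp add: ev spec_def U_def l'_def mult.assoc)
    finally show ?thesis .
  next
    case False
    then show ?thesis using A U by (auto simp: Mn_def spec_def not_less)
  qed
  then have "A = spec n U l'" by (intro ext)
  ultimately show ?thesis by (rule that)
qed

section \<open>Calculus in a fixed eigenbasis\<close>

abbreviation (input) col :: "rmat \<Rightarrow> nat \<Rightarrow> rvec" where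
  "col U k \<equiv> (\<lambda>i. U i k)"

definition frob :: "nat \<Rightarrow> rmat \<Rightarrow> rmat \<Rightarrow> real" where
  "frob n A B = (\<Sum>i<n. \<Sum>j<n. A i j * B i j)"

definition tr :: "nat \<Rightarrow> rmat \<Rightarrow> real" where
  "tr n A = (\<Sum>i<n. A i i)"

lemma sum_rotate3:
  "(\<Sum>k\<in>A. \<Sum>i\<in>B. \<Sum>j\<in>C. f k i j) = (\<Sum>i\<in>B. \<Sum>j\<in>C. \<Sum>k\<in>A. f k i j)"
proof -
  have "(\<Sum>k\<in>A. \<Sum>i\<in>B. \<Sum>j\<in>C. f k i j) = (\<Sum>i\<in>B. \<Sum>k\<in>A. \<Sum>j\<in>C. f k i j)"
    by (rule sum.swap)
  also have "\<dots> = (\<Sum>i\<in>B. \<Sum>j\<in>C. \<Sum>k\<in>A. f k i j)"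
    by (rule sum.cong[OF refl], rule sum.swap)
  finally show ?thesis .
qed

lemma col_orthonormal:
  assumes "orthogonal_mat n U" "k < n" "l < n"
  shows "ip n (col U k) (col U l) = (if k = l then 1 else 0)"
  using orthogonal_matD(2)[OF assms] by (simp add: ip_def)

lemma col_Rn: "U \<in> Mn n \<Longrightarrow> col U k \<in> Rn n"
  by (auto simp: Mn_def Rn_def)

lemma ip_ip_expand: "ip n a x * ip n b y = (\<Sum>i<n. \<Sum>j<n. (a i * b j) * (x i * y j))"
  unfolding ip_def sum_product by (intro sum.cong refl) (simp add: mult_ac)

lemma frob_spec: "frob n (spec n U l) Z = (\<Sum>k<n. l k * quad n Z (col U k))"
proof -
  have "(\<Sum>k<n. l k * quad n Z (col U k)) = (\<Sum>k<n. \<Sum>i<n. \<Sum>j<n. l k * (U i k * U j k) * Z i j)"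
    by (simp add: quad_def sum_distrib_left mult_ac)
  also have "\<dots> = (\<Sum>i<n. \<Sum>j<n. \<Sum>k<n. l k * (U i k * U j k) * Z i j)"
    by (rule sum_rotate3)
  finally show ?thesis by (simp add: frob_def spec_def sum_distrib_right)
qed

lemma quad_eq_frob: "quad n A x = frob n A (\<lambda>i j. x i * x j)"
  by (simp add: quad_def frob_def mult_ac)

lemma quad_spec: "quad n (spec n U l) x = (\<Sum>k<n. l k * (ip n (col U k) x)\<^sup>2)"
proof -
  have "quad n (\<lambda>i j. x i * x j) (col U k) = (ip n (col U k) x)\<^sup>2" for k
    by (simp add: quad_def power2_eq_square ip_ip_expand mult_ac)
  then show ?thesis by (simp add: quad_eq_frob frob_spec)
qed

lemma spec_Mn: "U \<in> Mn n \<Longrightarrow> spec n U l \<in> Mn n"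
  by (auto simp: Mn_def spec_def)

lemma spec_sym: "mtrans (spec n U l) = spec n U l"
  by (intro ext) (simp add: mtrans_def spec_def mult.commute)

lemma spec_one:
  assumes "orthogonal_mat n U"
  shows "spec n U (\<lambda>_. 1) = idm n"
proof (intro ext)
  fix i j
  show "spec n U (\<lambda>_. 1) i j = idm n i j"
  proof (cases "i < n \<and> j < n")
    case True
    then show ?thesis using orthogonal_matD(3)[OF assms, of i j] by (simp add: spec_def idm_entry)
  next
    case False
    moreover have "spec n U (\<lambda>_. 1) \<in> Mn n" using orthogonal_matD(1)[OF assms] by (rule spec_Mn)
    ultimately show ?thesis by (auto simp: Mn_def idm_entry not_less)
  qed
qed

lemma spec_diff: "spec n U (\<lambda>k. a k - b k) = (\<lambda>i j. spec n U a i j - spec n U b i j)"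
  and spec_add: "spec n U (\<lambda>k. a k + b k) = (\<lambda>i j. spec n U a i j + spec n U b i j)"
  and spec_scale: "spec n U (\<lambda>k. c * a k) = (\<lambda>i j. c * spec n U a i j)"
  by (simp_all add: spec_def fun_eq_iff algebra_simps sum.distrib sum_subtractf sum_distrib_left)

lemma spec_cong: "(\<And>k. k < n \<Longrightarrow> a k = b k) \<Longrightarrow> spec n U a = spec n U b"
  by (simp add: spec_def)

lemma spec_mult:
  assumes "orthogonal_mat n U"
  shows "matmul n (spec n U a) (spec n U b) = spec n U (\<lambda>k. a k * b k)"
proof (intro ext)
  fix i j
  have "matmul n (spec n U a) (spec n U b) i j =
      (\<Sum>m<n. \<Sum>k<n. \<Sum>l<n. (a k * U i k * (b l * U j l)) * (U m k * U m l))"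
    unfolding matmul_def spec_def sum_product by (intro sum.cong refl) (simp add: mult_ac)
  also have "\<dots> = (\<Sum>k<n. \<Sum>l<n. \<Sum>m<n. (a k * U i k * (b l * U j l)) * (U m k * U m l))"
    by (rule sum_rotate3)
  also have "\<dots> = (\<Sum>k<n. \<Sum>l<n. (a k * U i k * (b l * U j l)) * (if k = l then 1 else 0))"
    unfolding sum_distrib_left[symmetric]
    by (intro sum.cong refl) (simp add: orthogonal_matD(2)[OF assms])
  also have "\<dots> = (\<Sum>k<n. a k * U i k * (b k * U j k))"
    by (intro sum.cong refl) (simp add: if_distrib[of "\<lambda>t. _ * t"] cong: if_cong)
  finally show "matmul n (spec n U a) (spec n U b) i j = spec n U (\<lambda>k. a k * b k) i j"
    by (simp add: spec_def mult_ac)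
qed

lemma parseval:
  assumes "orthogonal_mat n U" "x \<in> Rn n"
  shows "(\<Sum>k<n. (ip n (col U k) x)\<^sup>2) = ip n x x"
proof -
  have "(\<Sum>k<n. (ip n (col U k) x)\<^sup>2) = quad n (idm n) x"
    using quad_spec[of n U "\<lambda>_. 1" x] by (simp add: spec_one[OF assms(1)])
  also have "\<dots> = ip n x x"
    by (simp add: quad_def ip_def idm_entry if_distrib[of "\<lambda>t. _ * t"] if_distrib[of "\<lambda>t. t * _"] cong: if_cong)
  finally show ?thesis .
qed

lemma sum_quad_col:
  assumes "orthogonal_mat n U"
  shows "(\<Sum>k<n. quad n Z (col U k)) = tr n Z"
proof -
  have "(\<Sum>k<n. quad n Z (col U k)) = frob n (idm n) Z"
    using frob_spec[of n U "\<lambda>_. 1" Z] by (simp add: spec_one[OF assms])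
  also have "\<dots> = tr n Z"
    by (simp add: frob_def tr_def idm_entry if_distrib[of "\<lambda>t. t * _"] cong: if_cong)
  finally show ?thesis .
qed

lemma quad_col_spec:
  assumes "orthogonal_mat n U" "k < n"
  shows "quad n (spec n U l) (col U k) = l k"
proof -
  have "quad n (spec n U l) (col U k) = (\<Sum>a<n. l a * (if a = k then 1 else 0)\<^sup>2)"
    using assms by (simp add: quad_spec col_orthonormal)
  also have "\<dots> = (\<Sum>a<n. if a = k then l a else 0)"
    by (intro sum.cong) auto
  finally show ?thesis using assms by simp
qed

lemma tr_spec:
  assumes "orthogonal_mat n U"
  shows "tr n (spec n U l) = (\<Sum>k<n. l k)"
  using sum_quad_col[OF assms, of "spec n U l"] by (simp add: quad_col_spec[OF assms])

lemma matvec_spec: "matvec n (spec n U l) y = (\<lambda>i. \<Sum>k<n. (l k * ip n (col U k) y) * U i k)"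
proof
  fix i
  have "matvec n (spec n U l) y i = (\<Sum>j<n. \<Sum>k<n. l k * (U i k * U j k) * y j)"
    by (simp add: matvec_def spec_def sum_distrib_right)
  also have "\<dots> = (\<Sum>k<n. \<Sum>j<n. l k * (U i k * U j k) * y j)" by (rule sum.swap)
  finally show "matvec n (spec n U l) y i = (\<Sum>k<n. (l k * ip n (col U k) y) * U i k)"
    by (simp add: ip_def sum_distrib_left sum_distrib_right mult_ac)
qed

lemma ip_combination:
  assumes "orthogonal_mat n U"
  shows "ip n (\<lambda>i. \<Sum>k<n. c k * U i k) (\<lambda>i. \<Sum>k<n. c k * U i k) = (\<Sum>k<n. (c k)\<^sup>2)"
proof -
  have "ip n (\<lambda>i. \<Sum>k<n. c k * U i k) (\<lambda>i. \<Sum>k<n. c k * U i k)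
      = (\<Sum>k<n. \<Sum>l<n. c k * (c l * ip n (col U k) (col U l)))"
    by (simp only: ip_sum_left ip_sum_right ip_scale_left ip_scale_right sum_distrib_left)
  also have "\<dots> = (\<Sum>k<n. \<Sum>l<n. if k = l then (c k)\<^sup>2 else 0)"
    by (intro sum.cong refl) (simp add: col_orthonormal[OF assms] power2_eq_square)
  finally show ?thesis by simp
qed

lemma norm_matvec_spec:
  assumes "orthogonal_mat n U"
  shows "ip n (matvec n (spec n U l) y) (matvec n (spec n U l) y) = (\<Sum>k<n. (l k)\<^sup>2 * (ip n (col U k) y)\<^sup>2)"
  unfolding matvec_spec ip_combination[OF assms] by (simp add: power_mult_distrib)

subsection \<open>Projection onto the constraint set and square roots\<close>

text \<open>The Fantope: for \<open>m \<le> n\<close> the convex hull of the orthogonal projectors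
  of rank \<open>n - m\<close>, that is, the convex relaxation over which the SDP procedure
  works.\<close>

definition fantope :: "nat \<Rightarrow> nat \<Rightarrow> rmat set" where
  "fantope n m = {X \<in> Mn n. mtrans X = X \<and>
     (\<forall>x\<in>Rn n. 0 \<le> quad n X x \<and> quad n X x \<le> ip n x x) \<and> tr n X = real n - real m}"

lemma spec_in_fantope:
  assumes "orthogonal_mat n U" "v \<in> capped_simplex n m"
  shows "spec n U v \<in> fantope n m"
proof -
  have v: "0 \<le> v k" "v k \<le> 1" if "k < n" for k
    using assms that by (auto simp: capped_simplex_def)
  have "0 \<le> quad n (spec n U v) x \<and> quad n (spec n U v) x \<le> ip n x x" if "x \<in> Rn n" for x
    unfolding quad_spec parseval[OF assms(1) that, symmetric]
    by (auto intro!: sum_nonneg sum_mono mult_left_le_one_le mult_nonneg_nonneg v)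
  moreover have "tr n (spec n U v) = real n - real m"
    using assms by (simp add: tr_spec capped_simplex_def)
  ultimately show ?thesis
    using orthogonal_matD(1)[OF assms(1)] by (simp add: fantope_def spec_Mn spec_sym)
qed

lemma capped_simplex_projection_exists:
  assumes "m \<le> n" "0 < n"
  shows "\<exists>v. is_projection n (capped_simplex n m) l v"
proof -
  let ?S = "capped_simplex n m"
  have "closed {w::rvec. 0 \<le> w i \<and> w i \<le> 1}" for i
    by (intro closed_Collect_conj closed_Collect_le continuous_on_coord continuous_on_const)
  moreover have "closed {w::rvec. (\<Sum>i<n. w i) = real n - real m}"
    by (intro closed_Collect_eq continuous_on_sum continuous_on_coord continuous_on_const)
  moreover have "?S = Rn n \<inter> (\<Inter>i\<in>{..<n}. {w. 0 \<le> w i \<and> w i \<le> 1}) \<inter> {w. (\<Sum>i<n. w i) = real n - real m}"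
    by (auto simp: capped_simplex_def)
  ultimately have "closed ?S" by (auto intro!: closed_Int closed_INT closed_Rn)
  then have "compact ?S"
    by (rule compact_Rn_bounded[of _ n 1]) (auto simp: capped_simplex_def)
  moreover have "(\<lambda>i. if i < n then (real n - real m) / real n else 0) \<in> ?S"
    using assms by (auto simp: capped_simplex_def Rn_def divide_simps)
  then have "?S \<noteq> {}" by (metis empty_iff)
  ultimately have "\<exists>v\<in>?S. \<forall>w\<in>?S. edist n l v \<le> edist n l w"
    by (rule continuous_attains_inf) (intro continuous_on_edist continuous_on_const continuous_on_id)
  then show ?thesis by (auto simp: is_projection_def)
qed

text \<open>Stands in for the limit of \<open>t\<close> to 0 when optimality along a segment is
  turned into a first-order condition.\<close>

lemma nonpos_if_small:
  fixes a B :: real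
  assumes "\<And>t. 0 < t \<Longrightarrow> t \<le> 1 \<Longrightarrow> 2 * a \<le> t * B"
  shows "a \<le> 0"
proof (rule ccontr)
  assume "\<not> a \<le> 0"
  then have a: "0 < a" by simp
  define t where "t = min 1 (a / (\<bar>B\<bar> + 1))"
  have t: "0 < t" "t \<le> 1" "t \<le> a / (\<bar>B\<bar> + 1)" using a by (auto simp: t_def)
  have "2 * a \<le> t * B" using assms t by blast
  also have "\<dots> \<le> t * (\<bar>B\<bar> + 1)" using t by (intro mult_left_mono) auto
  also have "\<dots> \<le> a / (\<bar>B\<bar> + 1) * (\<bar>B\<bar> + 1)" using t by (intro mult_right_mono) auto
  finally show False using a by simp
qed

text \<open>The obtuse-angle property: \<open>v\<close> is compared with the points of the segment
  from \<open>v\<close> to \<open>w\<close>, which lies in the simplex by convexity.\<close>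

lemma is_projection_variational:
  assumes "is_projection n (capped_simplex n m) l v" "w \<in> capped_simplex n m"
  shows "ip n (\<lambda>i. l i - v i) (\<lambda>i. w i - v i) \<le> 0"
proof (rule nonpos_if_small)
  fix t :: real assume t: "0 < t" "t \<le> 1"
  let ?a = "\<lambda>i. l i - v i" and ?b = "\<lambda>i. w i - v i"
  have v: "v \<in> capped_simplex n m" using assms by (simp add: is_projection_def)
  let ?u = "\<lambda>i. v i + t * (w i - v i)"
  have eq: "?u = (\<lambda>i. (1 - t) * v i + t * w i)" by (simp add: algebra_simps)
  have "?u \<in> capped_simplex n m"
    using v assms(2) t unfolding eq capped_simplex_def
    by (auto simp: Rn_def sum.distrib convex_bound_le simp flip: sum_distrib_left)
      (simp add: algebra_simps)
  then have "edist n l v \<le> edist n l ?u" using assms by (simp add: is_projection_def)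
  then have "(edist n l v)\<^sup>2 \<le> (edist n l ?u)\<^sup>2" by (intro power_mono) auto
  then have "ip n ?a ?a \<le> ip n (\<lambda>i. ?a i - t * ?b i) (\<lambda>i. ?a i - t * ?b i)"
    by (simp add: edist_def enorm_sq algebra_simps)
  also have "\<dots> = ip n ?a ?a - 2 * t * ip n ?a ?b + t * (t * ip n ?b ?b)"
    unfolding ip_diff_left[of n ?a "\<lambda>i. t * ?b i"] ip_diff_right[of n _ ?a "\<lambda>i. t * ?b i"]
      ip_scale_left[of n t ?b] ip_scale_right[of n _ t ?b] ip_commute[of n ?b ?a]
    by (simp add: algebra_simps)
  finally have "t * (2 * ip n ?a ?b) \<le> t * (t * ip n ?b ?b)" by simp
  then show "2 * ip n ?a ?b \<le> t * ip n ?b ?b" using t by simp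
qed

lemma frob_diff_left: "frob n (\<lambda>i j. A i j - B i j) Z = frob n A Z - frob n B Z"
  and frob_diff_right: "frob n Z (\<lambda>i j. A i j - B i j) = frob n Z A - frob n Z B"
  and frob_scale_left: "frob n (\<lambda>i j. c * A i j) Z = c * frob n A Z"
  and frob_scale_right: "frob n Z (\<lambda>i j. c * A i j) = c * frob n Z A"
  by (simp_all add: frob_def sum_subtractf algebra_simps sum_distrib_left)

lemma frob_commute: "frob n A B = frob n B A"
  by (simp add: frob_def mult.commute)

lemma frob_nonneg: "0 \<le> frob n A A"
  unfolding frob_def by (intro sum_nonneg) simp

lemma quad_diff: "quad n (\<lambda>i j. A i j - B i j) x = quad n A x - quad n B x"
  by (simp add: quad_eq_frob frob_diff_left)

text \<open>Projecting the eigenvalues amounts to the Frobenius projection of the matrix: a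
  difference of two matrices that are diagonal in \<open>U\<close> sees only the diagonal of
  \<open>Z\<close> in that basis, and this diagonal lies in the capped simplex. The inequality then
  reduces to the obtuse-angle property for vectors.\<close>

lemma sdp_update_projection:
  assumes X: "X \<in> Mn n" "mtrans X = X" and p: "p \<in> Rn n" and m: "m \<le> n" "0 < n"
  shows "sdp_update n m g p X \<in> fantope n m"
    and "Z \<in> fantope n m \<Longrightarrow>
      frob n (\<lambda>i j. (X i j - g * (p i * p j)) - sdp_update n m g p X i j)
            (\<lambda>i j. Z i j - sdp_update n m g p X i j) \<le> 0"
proof -
  let ?Y = "\<lambda>i j. X i j - g * (p i * p j)"
  have Xij: "X i j = X j i" for i j using X(2) by (metis mtrans_def)
  have Y: "?Y \<in> Mn n" "mtrans ?Y = ?Y"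
    using X(1) p Xij by (auto simp: Mn_def Rn_def mtrans_def mult.commute)
  obtain U0 l0 where U0: "orthogonal_mat n U0" "l0 \<in> Rn n" "?Y = spec n U0 l0"
    using spectral_theorem[OF Y] .
  obtain v0 where v0: "is_projection n (capped_simplex n m) l0 v0"
    using capped_simplex_projection_exists[OF m] by (rule exE)
  let ?P = "\<lambda>X'. \<exists>U l v. orthogonal_mat n U \<and> l \<in> Rn n \<and>
        ?Y = matmul n (matmul n U (diagm n l)) (mtrans U) \<and>
        is_projection n (capped_simplex n m) l v \<and>
        X' = matmul n (matmul n U (diagm n v)) (mtrans U)"
  define Q where "Q = ?P"
  \<comment> \<open>One admissible decomposition suffices to give the matrix selected by
    \<open>SOME\<close> its defining property; only that property is used afterwards.\<close>
  have "Q (spec n U0 v0)"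
    unfolding Q_def matmul_spec
    by (rule exI[of _ U0], rule exI[of _ l0], rule exI[of _ v0])
      (intro conjI U0 v0 refl)
  then have "Q (SOME X'. Q X')" by (rule someI[of Q])
  moreover have "sdp_update n m g p X = (SOME X'. Q X')" by (simp add: sdp_update_def Q_def)
  ultimately have "Q (sdp_update n m g p X)" by simp
  then obtain U l v where U: "orthogonal_mat n U" and Yl: "?Y = spec n U l"
    and v: "is_projection n (capped_simplex n m) l v" and X': "sdp_update n m g p X = spec n U v"
    unfolding Q_def matmul_spec by (elim exE conjE)
  have vc: "v \<in> capped_simplex n m" using v by (simp add: is_projection_def)
  show "sdp_update n m g p X \<in> fantope n m"
    unfolding X' using U vc by (rule spec_in_fantope)
  assume Z: "Z \<in> fantope n m"
  \<comment> \<open>The diagonal of \<open>Z\<close> in the eigenbasis \<open>U\<close>. Its entries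
    lie in the unit interval because \<open>Z\<close> is between 0 and the identity, and their sum
    is the trace.\<close>
  let ?w = "\<lambda>k. if k < n then quad n Z (col U k) else 0"
  have cn: "ip n (col U k) (col U k) = 1" "col U k \<in> Rn n" if "k < n" for k
    using that U col_orthonormal[OF U that that] by (auto intro: col_Rn orthogonal_matD(1))
  have "0 \<le> ?w i" "?w i \<le> 1" if "i < n" for i
    using Z cn[OF that] that by (auto simp: fantope_def)
  moreover have "(\<Sum>i<n. ?w i) = real n - real m"
    using Z sum_quad_col[OF U, of Z] by (simp add: fantope_def)
  ultimately have "?w \<in> capped_simplex n m"
    by (simp add: capped_simplex_def Rn_def)
  then have "ip n (\<lambda>i. l i - v i) (\<lambda>i. ?w i - v i) \<le> 0"
    using v by (intro is_projection_variational)
  moreover have "frob n (\<lambda>i j. ?Y i j - spec n U v i j) (\<lambda>i j. Z i j - spec n U v i j)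
      = ip n (\<lambda>i. l i - v i) (\<lambda>i. ?w i - v i)"
  proof -
    have "(\<lambda>i j. ?Y i j - spec n U v i j) = (\<lambda>i j. spec n U l i j - spec n U v i j)"
      unfolding Yl[symmetric] ..
    also have "\<dots> = spec n U (\<lambda>k. l k - v k)" by (simp add: spec_diff)
    finally show ?thesis
      by (simp add: frob_spec quad_diff quad_col_spec[OF U] ip_def)
  qed
  ultimately show "frob n (\<lambda>i j. ?Y i j - sdp_update n m g p X i j)
            (\<lambda>i j. Z i j - sdp_update n m g p X i j) \<le> 0"
    by (simp add: X')
qed

text \<open>With step size \<open>0\<close> the update is the projection itself. It is 1-Lipschitz, so the choice in the
  definition of the update is measurable.\<close>

definition sdp_proj :: "nat \<Rightarrow> nat \<Rightarrow> rmat \<Rightarrow> rmat" where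
  "sdp_proj n m Y = sdp_update n m 0 (\<lambda>_. 0) Y"

lemma sdp_update_eq_proj: "sdp_update n m g p X = sdp_proj n m (\<lambda>i j. X i j - g * (p i * p j))"
  by (simp add: sdp_update_def sdp_proj_def)

text \<open>The obtuse-angle inequalities at \<open>V\<close> and at \<open>V'\<close> add up to a
  bound of the squared distance of \<open>V\<close> and \<open>V'\<close> by the inner product of
  \<open>Y - Y'\<close> with \<open>V - V'\<close>.\<close>

lemma sdp_proj_lipschitz:
  assumes Y: "Y \<in> Mn n" "mtrans Y = Y" and Y': "Y' \<in> Mn n" "mtrans Y' = Y'" and m: "m \<le> n" "0 < n"
  defines "V \<equiv> sdp_proj n m Y" and "V' \<equiv> sdp_proj n m Y'"
  shows "frob n (\<lambda>i j. V i j - V' i j) (\<lambda>i j. V i j - V' i j)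
    \<le> frob n (\<lambda>i j. Y i j - Y' i j) (\<lambda>i j. Y i j - Y' i j)"
proof -
  have V: "V \<in> fantope n m" "V' \<in> fantope n m"
    unfolding V_def V'_def sdp_proj_def
    using sdp_update_projection(1)[OF Y Rn_zero m] sdp_update_projection(1)[OF Y' Rn_zero m] by auto
  have 1: "frob n (\<lambda>i j. Y i j - V i j) (\<lambda>i j. V' i j - V i j) \<le> 0"
    using sdp_update_projection(2)[OF Y Rn_zero m V(2), of 0] by (simp add: V_def sdp_proj_def)
  have 2: "frob n (\<lambda>i j. Y' i j - V' i j) (\<lambda>i j. V i j - V' i j) \<le> 0"
    using sdp_update_projection(2)[OF Y' Rn_zero m V(1), of 0] by (simp add: V'_def sdp_proj_def)
  \<comment> \<open>Replaces Cauchy-Schwarz: expanding the square bounds the remaining cross term by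
    the two squared distances.\<close>
  have 3: "0 \<le> frob n (\<lambda>i j. (Y i j - Y' i j) - (V i j - V' i j)) (\<lambda>i j. (Y i j - Y' i j) - (V i j - V' i j))"
    by (rule frob_nonneg)
  show ?thesis
    using 1 2 3 unfolding frob_diff_left frob_diff_right
    using frob_commute[of n Y V] frob_commute[of n Y' V] frob_commute[of n Y V'] frob_commute[of n Y' V']
      frob_commute[of n V V'] frob_commute[of n Y Y']
    by linarith
qed

text \<open>The projection is understood only on symmetric matrices supported on the
  \<open>n\<close> by \<open>n\<close> block. Composition with this linear retraction gives a map
  that is continuous on all of \<open>rmat\<close>, hence Borel measurable.\<close>

definition sym_part :: "nat \<Rightarrow> rmat \<Rightarrow> rmat" where
  "sym_part n Y = (\<lambda>i j. if i < n \<and> j < n then (Y i j + Y j i) / 2 else 0)"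

lemma sym_part: "sym_part n Y \<in> Mn n" "mtrans (sym_part n Y) = sym_part n Y"
  by (auto simp: sym_part_def Mn_def mtrans_def fun_eq_iff)

lemma sym_part_id: "Y \<in> Mn n \<Longrightarrow> mtrans Y = Y \<Longrightarrow> sym_part n Y = Y"
  by (auto simp: sym_part_def Mn_def mtrans_def fun_eq_iff not_less)

lemma entry_sq_le_frob: "i < n \<Longrightarrow> j < n \<Longrightarrow> (A i j)\<^sup>2 \<le> frob n A A"
  unfolding frob_def power2_eq_square
  by (rule order_trans[OF member_le_sum[of j "{..<n}" "\<lambda>j. A i j * A i j"]
      member_le_sum[of i "{..<n}" "\<lambda>i. \<Sum>j<n. A i j * A i j"]])
     (auto intro!: sum_nonneg)

lemma continuous_sdp_proj_sym_part:
  assumes m: "m \<le> n" "0 < n"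
  shows "continuous_on UNIV (\<lambda>Y. sdp_proj n m (sym_part n Y))"
proof (intro continuous_on_coordinatewise_then_product)
  fix i j
  have fan: "sdp_proj n m (sym_part n Y) \<in> fantope n m" for Y
    unfolding sdp_proj_def by (rule sdp_update_projection(1)[OF sym_part Rn_zero m])
  show "continuous_on UNIV (\<lambda>Y. sdp_proj n m (sym_part n Y) i j)"
  proof (cases "i < n \<and> j < n")
    case False
    then have "sdp_proj n m (sym_part n Y) i j = 0" for Y
      using fan[of Y] by (auto simp: fantope_def Mn_def not_less)
    then show ?thesis by simp
  next
    case True
    show ?thesis
    proof (intro continuous_at_imp_continuous_on ballI)
      fix Y0 :: rmat
      let ?g = "\<lambda>Y. sqrt (frob n (\<lambda>i j. sym_part n Y i j - sym_part n Y0 i j) (\<lambda>i j. sym_part n Y i j - sym_part n Y0 i j))"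
      have e: "continuous_on UNIV (\<lambda>Y::rmat. Y i j)" for i j
        by (rule continuous_on_product_then_coordinatewise, rule continuous_on_coord)
      have ent: "continuous_on UNIV (\<lambda>Y. sym_part n Y i j)" for i j
      proof (cases "i < n \<and> j < n")
        case True
        then show ?thesis by (simp add: sym_part_def continuous_on_divide continuous_on_add e)
      next
        case False
        then show ?thesis by (auto simp: sym_part_def)
      qed
      have "continuous_on UNIV ?g"
        unfolding frob_def
        by (intro continuous_on_real_sqrt continuous_on_sum continuous_on_mult continuous_on_diff ent continuous_on_const)
      then have "isCont ?g Y0" by (simp add: continuous_on_eq_continuous_at)
      then have lim: "(?g \<longlongrightarrow> 0) (at Y0)" by (simp add: isCont_def frob_def)
      have bd: "norm (sdp_proj n m (sym_part n Y) i j - sdp_proj n m (sym_part n Y0) i j) \<le> ?g Y" for Y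
      proof -
        let ?D = "\<lambda>i j. sdp_proj n m (sym_part n Y) i j - sdp_proj n m (sym_part n Y0) i j"
        have "(?D i j)\<^sup>2 \<le> frob n ?D ?D" using True entry_sq_le_frob[of i n j ?D] by simp
        also have "\<dots> \<le> frob n (\<lambda>i j. sym_part n Y i j - sym_part n Y0 i j) (\<lambda>i j. sym_part n Y i j - sym_part n Y0 i j)"
          by (rule sdp_proj_lipschitz[OF sym_part sym_part m])
        finally have "sqrt ((?D i j)\<^sup>2) \<le> ?g Y" by (rule real_sqrt_le_mono)
        then show ?thesis by simp
      qed
      have "((\<lambda>Y. sdp_proj n m (sym_part n Y) i j - sdp_proj n m (sym_part n Y0) i j) \<longlongrightarrow> 0) (at Y0)"
        using bd by (intro Lim_null_comparison[OF always_eventually lim] allI)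
      then show "isCont (\<lambda>Y. sdp_proj n m (sym_part n Y) i j) Y0"
        unfolding isCont_def by (rule LIM_zero_cancel)
    qed
  qed
qed

text \<open>The iteration \<open>Z \<mapsto> (X + Z\<^sup>2) / 2\<close> converges to \<open>I - (I - X)^(1/2)\<close>, which makes the square root
  measurable in \<open>X\<close>.\<close>

primrec sqrt_iter :: "nat \<Rightarrow> rmat \<Rightarrow> nat \<Rightarrow> rmat" where
  "sqrt_iter n X 0 = (\<lambda>_ _. 0)"
| "sqrt_iter n X (Suc k) = (\<lambda>i j. (X i j + matmul n (sqrt_iter n X k) (sqrt_iter n X k) i j) / 2)"

primrec sqrt_iter_scalar :: "real \<Rightarrow> nat \<Rightarrow> real" where
  "sqrt_iter_scalar x 0 = 0"
| "sqrt_iter_scalar x (Suc k) = (x + (sqrt_iter_scalar x k)\<^sup>2) / 2"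

lemma sqrt_iter_spec:
  assumes "orthogonal_mat n U"
  shows "sqrt_iter n (spec n U x) k = spec n U (\<lambda>a. sqrt_iter_scalar (x a) k)"
proof (induction k)
  case 0
  then show ?case by (simp add: spec_def)
next
  case (Suc k)
  have "sqrt_iter n (spec n U x) (Suc k) = (\<lambda>i j. (1/2) * (spec n U x i j + spec n U (\<lambda>a. sqrt_iter_scalar (x a) k * sqrt_iter_scalar (x a) k) i j))"
    by (simp add: Suc spec_mult[OF assms])
  also have "\<dots> = spec n U (\<lambda>a. (1/2) * (x a + sqrt_iter_scalar (x a) k * sqrt_iter_scalar (x a) k))"
    by (simp only: spec_scale spec_add)
  finally show ?case by (simp add: power2_eq_square)
qed

text \<open>The iterates increase and stay below the smaller fixed point
  \<open>1 - sqrt (1 - x)\<close>. The limit is a fixed point, and the bound excludes the larger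
  one.\<close>

lemma sqrt_iter_scalar_tendsto:
  assumes x: "0 \<le> x" "x \<le> 1"
  shows "sqrt_iter_scalar x \<longlonglongrightarrow> 1 - sqrt (1 - x)"
proof -
  let ?s = "1 - sqrt (1 - x)"
  have s: "0 \<le> ?s" "?s \<le> 1" using x by auto
  have sq: "(sqrt (1 - x))\<^sup>2 = 1 - x" using x by simp
  then have eq: "?s = (x + ?s\<^sup>2) / 2" by (simp add: power2_diff)
  have b: "0 \<le> sqrt_iter_scalar x k \<and> sqrt_iter_scalar x k \<le> ?s" for k
  proof (induction k)
    case (Suc k)
    then have "(sqrt_iter_scalar x k)\<^sup>2 \<le> ?s\<^sup>2" by (intro power_mono) auto
    then have "sqrt_iter_scalar x (Suc k) \<le> ?s" using eq by simp
    then show ?case using x by simp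
  qed (use s in simp)
  have inc: "sqrt_iter_scalar x k \<le> sqrt_iter_scalar x (Suc k)" for k
  proof (induction k)
    case (Suc k)
    then have "(sqrt_iter_scalar x k)\<^sup>2 \<le> (sqrt_iter_scalar x (Suc k))\<^sup>2" using b by (intro power_mono) auto
    then show ?case by simp
  qed (use x in simp)
  have "incseq (sqrt_iter_scalar x)" using inc by (rule incseq_SucI)
  then have "\<exists>l. sqrt_iter_scalar x \<longlonglongrightarrow> l"
  proof (rule incseq_convergent[where B = ?s])
    show "\<forall>i. sqrt_iter_scalar x i \<le> ?s" using b by simp
  qed (rule exI)
  then obtain l where l: "sqrt_iter_scalar x \<longlonglongrightarrow> l" by (rule exE)
  have "(\<lambda>k. sqrt_iter_scalar x (Suc k)) \<longlonglongrightarrow> (x + l\<^sup>2) / 2"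
    by (simp only: sqrt_iter_scalar.simps) (intro tendsto_intros l, simp)
  then have "l = (x + l\<^sup>2) / 2"
    by (rule LIMSEQ_unique[OF LIMSEQ_Suc[OF l]])
  then have l1: "(1 - l)\<^sup>2 = 1 - x" by (simp add: power2_diff)
  have "l \<le> ?s" using l b by (intro LIMSEQ_le_const2[OF l]) blast
  then have "0 \<le> 1 - l" using real_sqrt_ge_zero[of "1 - x"] x by linarith
  from real_sqrt_unique[OF l1 this] have "l = 1 - sqrt (1 - x)" by linarith
  then show ?thesis using l by simp
qed

lemma sqrt_iter_tendsto:
  assumes U: "orthogonal_mat n U" and x: "\<forall>a<n. 0 \<le> x a \<and> x a \<le> 1"
  shows "(\<lambda>k. sqrt_iter n (spec n U x) k i j) \<longlonglongrightarrow> spec n U (\<lambda>a. 1 - sqrt (1 - x a)) i j"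
  unfolding sqrt_iter_spec[OF U]
  unfolding spec_def
  by (intro tendsto_sum tendsto_mult tendsto_const sqrt_iter_scalar_tendsto) (use x in auto)

text \<open>Uniqueness avoids simultaneous diagonalization. If \<open>A\<close> is another psd root
  with eigenbasis \<open>V\<close>, then \<open>X\<close> is diagonal in \<open>V\<close> as well,
  and both \<open>I - A\<close> and the identity minus the root in \<open>U\<close> are limits of
  the same iteration, which depends on \<open>X\<close> alone.\<close>

lemma psd_sqrt_spec:
  assumes U: "orthogonal_mat n U" and x: "\<forall>a<n. 0 \<le> x a \<and> x a \<le> 1"
  shows "psd_sqrt n (\<lambda>i l. idm n i l - spec n U x i l) = spec n U (\<lambda>a. sqrt (1 - x a))"
proof -
  let ?B = "\<lambda>i l. idm n i l - spec n U x i l"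
  let ?R = "spec n U (\<lambda>a. sqrt (1 - x a))"
  have idU: "idm n = spec n V (\<lambda>_. 1)" if "orthogonal_mat n V" for V
    using spec_one[OF that] by simp
  have "psd n ?R"
    unfolding psd_def using x
    by (auto simp: spec_Mn[OF orthogonal_matD(1)[OF U]] spec_sym quad_spec intro!: sum_nonneg mult_nonneg_nonneg)
  moreover have "matmul n ?R ?R = ?B"
  proof -
    have "matmul n ?R ?R = spec n U (\<lambda>a. 1 - x a)"
      unfolding spec_mult[OF U] by (rule spec_cong) (use x in simp)
    then show ?thesis by (simp add: idU[OF U] spec_diff)
  qed
  moreover have "\<And>A. psd n A \<and> matmul n A A = ?B \<Longrightarrow> A = ?R"
  proof -
    fix A assume A: "psd n A \<and> matmul n A A = ?B"
    from A have "A \<in> Mn n" "mtrans A = A" by (auto simp: psd_def)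
    then obtain V a where V: "orthogonal_mat n V" and Aa: "A = spec n V a" by (rule spectral_theorem)
    have cR: "col V k \<in> Rn n" for k using V by (intro col_Rn orthogonal_matD(1))
    have a0: "0 \<le> a k" if "k < n" for k
      using A cR[of k] quad_col_spec[OF V that, of a] by (auto simp: psd_def Aa)
    have BA: "?B = spec n V (\<lambda>k. a k * a k)" using A spec_mult[OF V, of a a] by (simp add: Aa)
    have "spec n U x i j = spec n V (\<lambda>k. 1 - a k * a k) i j" for i j
      using fun_cong[OF fun_cong[OF BA, of i], of j] by (simp add: spec_diff idU[OF V])
    then have XV: "spec n U x = spec n V (\<lambda>k. 1 - a k * a k)" by (intro ext)
    have a1: "0 \<le> 1 - a k * a k" if "k < n" for k
    proof -
      have "0 \<le> quad n (spec n U x) (col V k)"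
        unfolding quad_spec using x by (intro sum_nonneg mult_nonneg_nonneg) auto
      then show ?thesis unfolding XV quad_col_spec[OF V that] .
    qed
    have "spec n V (\<lambda>k. 1 - sqrt (1 - (1 - a k * a k))) i j = spec n U (\<lambda>a. 1 - sqrt (1 - x a)) i j" for i j
    proof -
      have "(\<lambda>k. sqrt_iter n (spec n V (\<lambda>k. 1 - a k * a k)) k i j) \<longlonglongrightarrow> spec n V (\<lambda>k. 1 - sqrt (1 - (1 - a k * a k))) i j"
        by (rule sqrt_iter_tendsto[OF V]) (use a1 in auto)
      moreover have "(\<lambda>k. sqrt_iter n (spec n V (\<lambda>k. 1 - a k * a k)) k i j) \<longlonglongrightarrow> spec n U (\<lambda>a. 1 - sqrt (1 - x a)) i j"
        unfolding XV[symmetric] by (rule sqrt_iter_tendsto[OF U x])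
      ultimately show ?thesis by (rule LIMSEQ_unique)
    qed
    moreover have "spec n V (\<lambda>k. 1 - sqrt (1 - (1 - a k * a k))) = spec n V (\<lambda>k. 1 - a k)"
      by (rule spec_cong) (use a0 in simp)
    ultimately have "spec n V (\<lambda>k. 1 - a k) i j = spec n U (\<lambda>a. 1 - sqrt (1 - x a)) i j" for i j
      by simp
    then have "idm n i j - A i j = idm n i j - ?R i j" for i j
      by (simp add: spec_diff Aa idU[OF V, symmetric] idU[OF U, symmetric])
    then show "A = ?R" by (intro ext) simp
  qed
  ultimately have "psd n ?R \<and> matmul n ?R ?R = ?B" and "\<And>A. psd n A \<and> matmul n A A = ?B \<Longrightarrow> A = ?R"
    by - (rule conjI)
  then show ?thesis unfolding psd_sqrt_def by (rule the_equality)
qed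

text \<open>The Fantope without its trace condition. This much holds for the SDP output even if
  every oracle answer is the zero vector.\<close>

definition contr :: "nat \<Rightarrow> rmat \<Rightarrow> bool" where
  "contr n X \<longleftrightarrow> X \<in> Mn n \<and> mtrans X = X \<and> (\<forall>x\<in>Rn n. 0 \<le> quad n X x \<and> quad n X x \<le> ip n x x)"

lemma fantope_contr: "X \<in> fantope n m \<Longrightarrow> contr n X"
  by (simp add: fantope_def contr_def)

lemma contr_psd: "contr n X \<Longrightarrow> psd n X"
  by (simp add: psd_def contr_def)

lemma contr_spec:
  assumes "contr n X"
  obtains U x where "orthogonal_mat n U" "X = spec n U x" "\<forall>a<n. 0 \<le> x a \<and> x a \<le> 1"
proof -
  from assms have "X \<in> Mn n" "mtrans X = X" by (auto simp: contr_def)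
  then obtain U x where U: "orthogonal_mat n U" "X = spec n U x" by (rule spectral_theorem)
  have "0 \<le> x a \<and> x a \<le> 1" if "a < n" for a
    using assms col_Rn[OF orthogonal_matD(1)[OF U(1)], of a] quad_col_spec[OF U(1) that, of x]
      col_orthonormal[OF U(1) that that]
    unfolding contr_def U(2) by force
  then have "\<forall>a<n. 0 \<le> x a \<and> x a \<le> 1" by simp
  with U show ?thesis by (rule that)
qed

definition comp_sqrt :: "nat \<Rightarrow> rmat \<Rightarrow> rmat" where
  "comp_sqrt n X = psd_sqrt n (\<lambda>i l. idm n i l - X i l)"

lemma comp_sqrt_spec:
  assumes "orthogonal_mat n U" "\<forall>a<n. 0 \<le> x a \<and> x a \<le> 1"
  shows "comp_sqrt n (spec n U x) = spec n U (\<lambda>a. sqrt (1 - x a))"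
  unfolding comp_sqrt_def by (rule psd_sqrt_spec[OF assms])

lemma comp_sqrt_limit:
  assumes "contr n X"
  shows "comp_sqrt n X i j = idm n i j - lim (\<lambda>k. sqrt_iter n X k i j)"
proof -
  obtain U x where U: "orthogonal_mat n U" "X = spec n U x" and x: "\<forall>a<n. 0 \<le> x a \<and> x a \<le> 1"
    using contr_spec[OF assms] .
  have "lim (\<lambda>k. sqrt_iter n X k i j) = spec n U (\<lambda>a. 1 - sqrt (1 - x a)) i j"
    unfolding U(2) by (rule limI[OF sqrt_iter_tendsto[OF U(1) x]])
  then show ?thesis
    using comp_sqrt_spec[OF U(1) x] by (simp add: U(2) spec_diff spec_one[OF U(1)])
qed

lemma comp_sqrt_Mn: "contr n X \<Longrightarrow> comp_sqrt n X \<in> Mn n"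
proof -
  assume "contr n X"
  then obtain U x where U: "orthogonal_mat n U" "X = spec n U x" and x: "\<forall>a<n. 0 \<le> x a \<and> x a \<le> 1"
    by (rule contr_spec)
  show ?thesis unfolding U(2) comp_sqrt_spec[OF U(1) x] by (rule spec_Mn[OF orthogonal_matD(1)[OF U(1)]])
qed

text \<open>In the eigenbasis the claim is \<open>(1 - s)\<^sup>2 \<le> 1 - s\<^sup>2\<close> for
  \<open>s\<close> in the unit interval. It converts a bound on the quadratic form of
  \<open>X\<close> into a bound on the bias caused by the square root of
  \<open>I - X\<close>.\<close>

lemma comp_sqrt_error:
  assumes "contr n X" "p \<in> Rn n"
  shows "(edist n p (matvec n (comp_sqrt n X) p))\<^sup>2 \<le> quad n X p"
proof -
  obtain U x where U: "orthogonal_mat n U" "X = spec n U x" and x: "\<forall>a<n. 0 \<le> x a \<and> x a \<le> 1"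
    using contr_spec[OF assms(1)] .
  have "matvec n (idm n) p = p"
  proof
    fix i
    show "matvec n (idm n) p i = p i"
      using assms(2) by (cases "i < n")
        (simp_all add: matvec_def idm_entry Rn_def if_distrib[of "\<lambda>t. t * _"] cong: if_cong)
  qed
  then have "(\<lambda>i. p i - matvec n (comp_sqrt n X) p i) = matvec n (spec n U (\<lambda>a. 1 - sqrt (1 - x a))) p"
    unfolding U(2) comp_sqrt_spec[OF U(1) x] spec_diff spec_one[OF U(1)]
    by (auto simp: matvec_def left_diff_distrib sum_subtractf fun_eq_iff)
  then have "(edist n p (matvec n (comp_sqrt n X) p))\<^sup>2
      = (\<Sum>k<n. (1 - sqrt (1 - x k))\<^sup>2 * (ip n (col U k) p)\<^sup>2)"
    by (simp add: edist_def enorm_sq norm_matvec_spec[OF U(1)])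
  also have "\<dots> \<le> (\<Sum>k<n. x k * (ip n (col U k) p)\<^sup>2)"
  proof (intro sum_mono mult_right_mono)
    fix k assume "k \<in> {..<n}"
    then have k: "0 \<le> x k" "x k \<le> 1" using x by auto
    define s where "s = sqrt (1 - x k)"
    have s: "s \<le> 1" "0 \<le> s" "s * s = 1 - x k" using k by (auto simp: s_def)
    have "s * s \<le> s" using mult_left_mono[OF s(1,2)] by simp
    then have "(1 - s)\<^sup>2 \<le> x k" using s(3) by (simp add: power2_eq_square algebra_simps)
    then show "(1 - sqrt (1 - x k))\<^sup>2 \<le> x k" by (simp add: s_def)
  qed simp
  finally show ?thesis by (simp add: U(2) quad_spec)
qed

subsection \<open>Gaussian and sub-Gaussian estimates\<close>

abbreviation gs :: "real measure" where "gs \<equiv> std_normal_distribution"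
abbreviation GN :: "nat \<Rightarrow> rvec measure" where "GN N \<equiv> PiM {..<N} (\<lambda>_. gs)"

lemma prob_space_gs: "prob_space gs"
  using real_dist_normal_dist by (simp add: real_distribution_def)

lemma prob_space_GN: "prob_space (GN N)"
  by (intro prob_space_PiM prob_space_gs)

lemma sets_gs [measurable_cong]: "sets gs = sets borel"
  by simp

text \<open>The exponent is written with \<open>c\<close> because the product with the standard
  density is then a multiple of the Gaussian density of variance \<open>1 / c\<close>.\<close>

lemma gauss_exp_sq:
  assumes "0 < c"
  shows "integrable gs (\<lambda>x. exp ((1 - c) / 2 * x\<^sup>2))" "(LINT x|gs. exp ((1 - c) / 2 * x\<^sup>2)) = 1 / sqrt c"
proof -
  have eq: "std_normal_density x *\<^sub>R exp ((1 - c) / 2 * x\<^sup>2) = (1 / sqrt c) * normal_density 0 (1 / sqrt c) x" for x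
  proof -
    have "exp (- x\<^sup>2 / 2) * exp ((1 - c) / 2 * x\<^sup>2) = exp (- (c * x\<^sup>2) / 2)"
      unfolding exp_add[symmetric] by (rule arg_cong[of _ _ exp]) (simp add: field_simps)
    moreover have "(1 / sqrt c)\<^sup>2 = 1 / c" using assms by (simp add: power_divide)
    moreover have "sqrt (2 * pi * (1 / c)) = sqrt (2 * pi) / sqrt c" by (simp add: real_sqrt_divide)
    ultimately show ?thesis using assms by (simp add: normal_density_def)
  qed
  have i: "integrable lborel (\<lambda>x. (1 / sqrt c) * normal_density 0 (1 / sqrt c) x)"
    using assms by (intro integrable_mult_right integrable_normal_density) simp
  show "integrable gs (\<lambda>x. exp ((1 - c) / 2 * x\<^sup>2))"
    by (subst integrable_density) (simp_all only: eq i, auto)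
  have "(LINT x|gs. exp ((1 - c) / 2 * x\<^sup>2)) = (LINT x|lborel. (1 / sqrt c) * normal_density 0 (1 / sqrt c) x)"
    by (subst integral_density) (simp_all only: eq, auto)
  also have "\<dots> = 1 / sqrt c" using assms by (simp add: integral_normal_density)
  finally show "(LINT x|gs. exp ((1 - c) / 2 * x\<^sup>2)) = 1 / sqrt c" .
qed

lemma gauss_mgf: "(\<integral>\<^sup>+x. ennreal (exp (s * x)) \<partial>gs) = ennreal (exp (s\<^sup>2 / 2))"
proof -
  have eq: "std_normal_density x * exp (s * x) = exp (s\<^sup>2 / 2) * normal_density s 1 x" for x
  proof -
    have "exp (- x\<^sup>2 / 2) * exp (s * x) = exp (s\<^sup>2 / 2) * exp (- (x - s)\<^sup>2 / 2)"
      unfolding exp_add[symmetric] by (rule arg_cong[of _ _ exp]) (simp add: field_simps power2_eq_square)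
    then show ?thesis by (simp add: normal_density_def)
  qed
  have "(\<integral>\<^sup>+x. ennreal (exp (s * x)) \<partial>gs) = (\<integral>\<^sup>+x. ennreal (std_normal_density x * exp (s * x)) \<partial>lborel)"
    by (subst nn_integral_density) (auto simp: ennreal_mult)
  also have "\<dots> = (\<integral>\<^sup>+x. ennreal (exp (s\<^sup>2 / 2) * normal_density s 1 x) \<partial>lborel)"
    by (simp only: eq)
  also have "\<dots> = ennreal (LINT x|lborel. exp (s\<^sup>2 / 2) * normal_density s 1 x)"
    by (rule nn_integral_eq_integral) (auto intro!: integrable_mult_right integrable_normal_density)
  also have "\<dots> = ennreal (exp (s\<^sup>2 / 2))" by (simp add: integral_normal_density)
  finally show ?thesis .
qed

lemma gauss_exp_sq_nn:
  assumes "a < 1 / 2"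
  shows "(\<integral>\<^sup>+x. ennreal (exp (a * x\<^sup>2)) \<partial>gs) = ennreal (1 / sqrt (1 - 2 * a))"
proof -
  have c: "0 < 1 - 2 * a" and e: "(1 - (1 - 2 * a)) / 2 = a" using assms by auto
  show ?thesis
    using gauss_exp_sq[OF c] unfolding e by (simp add: nn_integral_eq_integral)
qed

lemma gauss_char: "(CLINT x|gs. iexp (t * x)) = complex_of_real (exp (- (t\<^sup>2) / 2))"
  using char_std_normal_distribution by (simp add: char_def fun_eq_iff)

lemma integrable_iexp_gs: "complex_integrable gs (\<lambda>x. iexp (t * x))"
proof -
  interpret prob_space gs by (rule prob_space_gs)
  show ?thesis by (rule integrable_const_bound[of _ 1]) auto
qed

lemma GN_char:
  "(CLINT g|GN N. iexp (\<Sum>k<N. v k * g k)) = complex_of_real (exp (- (\<Sum>k<N. (v k)\<^sup>2) / 2))"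
proof -
  interpret product_sigma_finite "\<lambda>_::nat. gs"
    by (intro product_sigma_finite.intro prob_space_imp_sigma_finite prob_space_gs)
  have "iexp (\<Sum>k<N. v k * g k) = (\<Prod>k<N. iexp (v k * g k))" for g
    by (simp add: sum_distrib_left exp_sum)
  then have "(CLINT g|GN N. iexp (\<Sum>k<N. v k * g k)) = (\<Prod>k<N. (CLINT x|gs. iexp (v k * x)))"
    by (simp only:) (rule product_integral_prod, simp, rule integrable_iexp_gs)
  also have "\<dots> = (\<Prod>k<N. complex_of_real (exp (- ((v k)\<^sup>2) / 2)))" by (simp only: gauss_char)
  also have "\<dots> = complex_of_real (exp (\<Sum>k<N. - ((v k)\<^sup>2) / 2))" by (simp add: exp_sum)
  finally show ?thesis by (simp add: sum_negf sum_divide_distrib)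
qed

lemma GN_exp_sq:
  assumes "\<And>a. a < n \<Longrightarrow> 0 < 1 + 2 * r a"
  shows "(LINT h|GN n. exp (- (\<Sum>a<n. r a * (h a)\<^sup>2))) = (\<Prod>a<n. 1 / sqrt (1 + 2 * r a))"
proof -
  interpret product_sigma_finite "\<lambda>_::nat. gs"
    by (intro product_sigma_finite.intro prob_space_imp_sigma_finite prob_space_gs)
  have e: "(1 - (1 + 2 * r a)) / 2 = - r a" for a by simp
  have i: "integrable gs (\<lambda>x. exp (- r a * x\<^sup>2))" "(LINT x|gs. exp (- r a * x\<^sup>2)) = 1 / sqrt (1 + 2 * r a)"
    if "a < n" for a
    using gauss_exp_sq[OF assms[OF that]] unfolding e by auto
  have "exp (- (\<Sum>a<n. r a * (h a)\<^sup>2)) = (\<Prod>a<n. exp (- r a * (h a)\<^sup>2))" for h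
    by (simp add: exp_sum flip: sum_negf)
  then have "(LINT h|GN n. exp (- (\<Sum>a<n. r a * (h a)\<^sup>2))) = (\<Prod>a<n. (LINT x|gs. exp (- r a * x\<^sup>2)))"
    by (simp only:) (rule product_integral_prod, simp, rule i, simp)
  also have "\<dots> = (\<Prod>a<n. 1 / sqrt (1 + 2 * r a))" by (intro prod.cong refl i(2)) simp
  finally show ?thesis .
qed

text \<open>Written as an average of characters, \<open>exp (- t s\<^sup>2)\<close> has the largest Gaussian expectation when it
  is centred at the origin, because the characteristic function is positive.\<close>

lemma gauss_laplace_le:
  fixes c :: "nat \<Rightarrow> nat \<Rightarrow> real"
  assumes cov: "\<And>h. (\<Sum>k<N. (\<Sum>a<n. h a * c a k)\<^sup>2) = (\<Sum>a<n. l a * (h a)\<^sup>2)"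
    and l: "\<And>a. a < n \<Longrightarrow> 0 \<le> l a" and t: "0 \<le> t"
  shows "(LINT g|GN N. exp (- t * (\<Sum>a<n. ((\<Sum>k<N. g k * c a k) - b a)\<^sup>2))) \<le> (\<Prod>a<n. 1 / sqrt (1 + 2 * (t * l a)))"
proof -
  interpret G: prob_space "GN N" by (rule prob_space_GN)
  interpret H: prob_space "GN n" by (rule prob_space_GN)
  interpret P: pair_prob_space "GN N" "GN n" ..
  \<comment> \<open>With this frequency the Gaussian average over \<open>h\<close> of the character
    \<open>E g h\<close> is \<open>exp (- t * |v g|^2)\<close>.\<close>
  define s where "s = sqrt (2 * t)"
  have s2: "s\<^sup>2 = 2 * t" using t by (simp add: s_def)
  define v where "v = (\<lambda>g a. (\<Sum>k<N. g k * c a k) - b a)"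
  define E where "E = (\<lambda>g h. iexp (\<Sum>a<n. s * v g a * h a))"
  have Em: "(\<lambda>(g, h). E g h) \<in> borel_measurable (GN N \<Otimes>\<^sub>M GN n)"
    unfolding E_def v_def by measurable
  have int: "complex_integrable (GN N \<Otimes>\<^sub>M GN n) (\<lambda>(g, h). E g h)"
    by (rule P.integrable_const_bound[of _ 1]) (use Em in \<open>auto simp: E_def\<close>)
  have 1: "(CLINT h|GN n. E g h) = complex_of_real (exp (- t * (\<Sum>a<n. (v g a)\<^sup>2)))" for g
  proof -
    have "(\<Sum>a<n. (s * v g a)\<^sup>2) = 2 * t * (\<Sum>a<n. (v g a)\<^sup>2)"
      by (simp only: power_mult_distrib s2 sum_distrib_left[symmetric])
    then show ?thesis unfolding E_def GN_char by simp
  qed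
  \<comment> \<open>The centre \<open>b\<close> enters \<open>E\<close> only through a phase that
    does not depend on \<open>g\<close>, so the modulus removes it.\<close>
  have 2: "cmod (CLINT g|GN N. E g h) = exp (- (\<Sum>a<n. (t * l a) * (h a)\<^sup>2))" for h
  proof -
    have "(\<Sum>a<n. s * v g a * h a) = (\<Sum>k<N. (s * (\<Sum>a<n. h a * c a k)) * g k) - s * (\<Sum>a<n. h a * b a)" for g
    proof -
      have "(\<Sum>a<n. s * v g a * h a) = (\<Sum>a<n. \<Sum>k<N. s * (h a * c a k) * g k) - s * (\<Sum>a<n. h a * b a)"
        by (simp add: v_def algebra_simps sum_subtractf sum_distrib_left)
      also have "(\<Sum>a<n. \<Sum>k<N. s * (h a * c a k) * g k) = (\<Sum>k<N. \<Sum>a<n. s * (h a * c a k) * g k)"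
        by (rule sum.swap)
      finally show ?thesis by (simp add: sum_distrib_left sum_distrib_right)
    qed
    moreover have "iexp (x - y) = iexp (- y) * iexp x" for x y :: real
      by (simp add: right_diff_distrib flip: exp_add)
    ultimately have "E g h = iexp (- (s * (\<Sum>a<n. h a * b a))) * iexp (\<Sum>k<N. (s * (\<Sum>a<n. h a * c a k)) * g k)" for g
      by (simp only: E_def)
    then have "(CLINT g|GN N. E g h) = iexp (- (s * (\<Sum>a<n. h a * b a))) * complex_of_real (exp (- (\<Sum>k<N. (s * (\<Sum>a<n. h a * c a k))\<^sup>2) / 2))"
      by (simp only: integral_mult_right_zero GN_char)
    also have "(\<Sum>k<N. (s * (\<Sum>a<n. h a * c a k))\<^sup>2) = 2 * t * (\<Sum>a<n. l a * (h a)\<^sup>2)"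
      by (simp only: power_mult_distrib s2 sum_distrib_left[symmetric] cov)
    finally show ?thesis by (simp add: norm_mult sum_distrib_left mult_ac)
  qed
  have "complex_of_real (LINT g|GN N. exp (- t * (\<Sum>a<n. (v g a)\<^sup>2))) = (CLINT g|GN N. (CLINT h|GN n. E g h))"
    by (simp only: 1 integral_complex_of_real)
  also have "\<dots> = (CLINT h|GN n. (CLINT g|GN N. E g h))"
    by (rule P.Fubini_integral[OF int, symmetric])
  finally have "cmod (complex_of_real (LINT g|GN N. exp (- t * (\<Sum>a<n. (v g a)\<^sup>2)))) = cmod (CLINT h|GN n. (CLINT g|GN N. E g h))"
    by simp
  also have "\<dots> \<le> (LINT h|GN n. cmod (CLINT g|GN N. E g h))" by (rule integral_norm_bound)
  also have "\<dots> = (\<Prod>a<n. 1 / sqrt (1 + 2 * (t * l a)))"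
    unfolding 2 by (rule GN_exp_sq) (use t l in \<open>simp add: add_pos_nonneg\<close>)
  finally show ?thesis by (simp add: v_def)
qed

lemma sqrt_factor_le:
  fixes x :: real
  assumes "0 \<le> x" "x \<le> 1"
  shows "1 / sqrt (1 + x) \<le> exp (- x / 4)"
proof -
  have "exp (x / 2) \<le> 1 + x / 2 + (x / 2)\<^sup>2" using assms by (intro exp_bound) auto
  also have "\<dots> \<le> 1 + x" using assms mult_left_mono[of x 1 x] by (simp add: power2_eq_square)
  finally have "sqrt (exp (x / 2)) \<le> sqrt (1 + x)" by simp
  also have "sqrt (exp (x / 2)) = exp (x / 4)"
    by (rule real_sqrt_unique) (simp_all add: power2_eq_square flip: exp_add)
  finally show ?thesis using assms by (simp add: exp_minus divide_simps)
qed

text \<open>Exponential Markov with the Laplace transform at \<open>t = 1 / (2 \<Lambda>)\<close>,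
  where \<open>\<Lambda>\<close> is the largest of the eigenvalues in \<open>B\<close>. Each of the
  \<open>m\<close> directions outside \<open>B\<close> contributes a factor of at most
  \<open>1 / sqrt 2\<close>. The directions in \<open>B\<close> together contribute
  \<open>exp (- t \<tau> / 2)\<close>, where \<open>\<tau>\<close> is the sum of \<open>l\<close>
  over \<open>B\<close>, and this pays for the squared radius \<open>q\<close>.\<close>

lemma gauss_small_ball:
  fixes c :: "nat \<Rightarrow> nat \<Rightarrow> real"
  assumes cov: "\<And>h. (\<Sum>k<N. (\<Sum>a<n. h a * c a k)\<^sup>2) = (\<Sum>a<n. l a * (h a)\<^sup>2)"
    and l: "\<And>a. a < n \<Longrightarrow> 0 \<le> l a" and B: "B \<subseteq> {..<n}" "card B = n - m" "m \<le> n"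
    and lB: "\<And>a b. a \<in> B \<Longrightarrow> b \<in> {..<n} - B \<Longrightarrow> l a \<le> l b"
    and pos: "0 < (\<Sum>a\<in>B. l a)" and q: "q \<le> (\<Sum>a\<in>B. l a) / 2"
  shows "measure (GN N) {g \<in> space (GN N). (\<Sum>a<n. ((\<Sum>k<N. g k * c a k) - b a)\<^sup>2) \<le> q} \<le> (1 / sqrt 2) ^ m"
proof -
  interpret G: prob_space "GN N" by (rule prob_space_GN)
  have fin: "finite B" using B(1) finite_subset by blast
  have neB: "B \<noteq> {}" using pos by auto
  define \<Lambda> where "\<Lambda> = Max (l ` B)"
  have \<Lambda>: "\<And>a. a \<in> B \<Longrightarrow> l a \<le> \<Lambda>" "\<Lambda> \<in> l ` B" using fin neB by (auto simp: \<Lambda>_def)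
  have "0 < \<Lambda>"
  proof (rule ccontr)
    assume "\<not> 0 < \<Lambda>"
    then have "(\<Sum>a\<in>B. l a) \<le> 0" using \<Lambda>(1) by (intro sum_nonpos) (auto simp: not_less intro: order_trans)
    then show False using pos by simp
  qed
  define t where "t = 1 / (2 * \<Lambda>)"
  have t: "0 < t" using \<open>0 < \<Lambda>\<close> by (simp add: t_def)
  let ?S = "\<lambda>g. \<Sum>a<n. ((\<Sum>k<N. g k * c a k) - b a)\<^sup>2"
  have Sm: "?S \<in> borel_measurable (GN N)" by measurable
  have S0: "0 \<le> ?S g" for g by (intro sum_nonneg) simp
  have bnd: "(\<Prod>a<n. 1 / sqrt (1 + 2 * (t * l a))) \<le> (1 / sqrt 2) ^ m * exp (- t * (\<Sum>a\<in>B. l a) / 2)"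
  proof -
    have split: "{..<n} = ({..<n} - B) \<union> B" using B(1) by auto
    have "(\<Prod>a<n. 1 / sqrt (1 + 2 * (t * l a)))
      = (\<Prod>a\<in>{..<n} - B. 1 / sqrt (1 + 2 * (t * l a))) * (\<Prod>a\<in>B. 1 / sqrt (1 + 2 * (t * l a)))"
      by (subst split, rule prod.union_disjoint) (use fin in auto)
    also have "\<dots> \<le> (\<Prod>a\<in>{..<n} - B. 1 / sqrt 2) * (\<Prod>a\<in>B. exp (- (2 * (t * l a)) / 4))"
    proof (intro mult_mono prod_mono conjI)
      fix a assume a: "a \<in> {..<n} - B"
      obtain a0 where "a0 \<in> B" "\<Lambda> = l a0" using \<Lambda>(2) by auto
      then have "\<Lambda> \<le> l a" using lB a by simp
      then have "1 \<le> 2 * (t * l a)" using \<open>0 < \<Lambda>\<close> by (simp add: t_def)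
      then show "1 / sqrt (1 + 2 * (t * l a)) \<le> 1 / sqrt 2" by (intro divide_left_mono) auto
    next
      fix a assume a: "a \<in> B"
      have "2 * (t * l a) \<le> 1" using \<Lambda>(1)[OF a] \<open>0 < \<Lambda>\<close> by (simp add: t_def)
      then show "1 / sqrt (1 + 2 * (t * l a)) \<le> exp (- (2 * (t * l a)) / 4)"
        using l[of a] a B(1) t by (intro sqrt_factor_le) auto
    qed (use l B(1) t in \<open>auto intro!: prod_nonneg\<close>)
    also have "(\<Prod>a\<in>{..<n} - B. 1 / sqrt 2) = (1 / sqrt 2) ^ m"
      using B fin by (simp add: card_Diff_subset)
    also have "(\<Prod>a\<in>B. exp (- (2 * (t * l a)) / 4)) = exp (- t * (\<Sum>a\<in>B. l a) / 2)"
      using fin by (simp add: exp_sum[symmetric] sum_distrib_left sum_divide_distrib sum_negf)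
    finally show ?thesis by simp
  qed
  have lap: "(LINT g|GN N. exp (- t * ?S g)) \<le> (1 / sqrt 2) ^ m * exp (- t * (\<Sum>a\<in>B. l a) / 2)"
    by (rule order_trans[OF gauss_laplace_le[OF cov l] bnd]) (use t in auto)
  have "measure (GN N) {g \<in> space (GN N). exp (- t * q) \<le> exp (- t * ?S g)} \<le> (LINT g|GN N. exp (- t * ?S g)) / exp (- t * q)"
  proof (rule integral_Markov_inequality_measure[where A = "{}"])
    show "integrable (GN N) (\<lambda>g. exp (- t * ?S g))"
      by (rule G.integrable_const_bound[of _ 1]) (use Sm S0 t in auto)
  qed auto
  also have "\<dots> \<le> (1 / sqrt 2) ^ m * exp (- t * (\<Sum>a\<in>B. l a) / 2) / exp (- t * q)"
    using lap by (intro divide_right_mono) auto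
  also have "\<dots> = (1 / sqrt 2) ^ m * exp (t * (q - (\<Sum>a\<in>B. l a) / 2))"
  proof -
    have "exp (- t * (\<Sum>a\<in>B. l a) / 2) / exp (- t * q) = exp (t * (q - (\<Sum>a\<in>B. l a) / 2))"
      unfolding exp_diff[symmetric] by (rule arg_cong[of _ _ exp]) (simp add: algebra_simps)
    then show ?thesis by (metis times_divide_eq_right)
  qed
  also have "\<dots> \<le> (1 / sqrt 2) ^ m * 1"
    using t q by (intro mult_left_mono) (auto simp: mult_le_0_iff)
  finally show ?thesis using t by simp
qed

section \<open>Quadratic forms of sub-Gaussian noise\<close>

lemma inv_sqrt_le_exp:
  fixes \<theta> :: real
  assumes "0 \<le> \<theta>" "\<theta> \<le> 1"
  shows "1 / sqrt (1 - \<theta> / 2) \<le> exp (\<theta> / 2)"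
proof -
  have "1 / (1 - \<theta> / 2) \<le> 1 + \<theta>" using assms by (simp add: field_simps mult_left_le)
  also have "\<dots> \<le> exp \<theta>" by (rule exp_ge_add_one_self)
  finally have "sqrt (1 / (1 - \<theta> / 2)) \<le> sqrt (exp \<theta>)" by simp
  also have "sqrt (exp \<theta>) = exp (\<theta> / 2)"
    by (rule real_sqrt_unique) (simp_all add: power2_eq_square flip: exp_add)
  finally show ?thesis by (simp add: real_sqrt_divide)
qed

text \<open>The exponential of a square is a Gaussian average of exponentials of linear forms.\<close>

lemma subgaussian_quadratic_mgf:
  assumes \<nu>: "prob_space \<nu>" "sets \<nu> = sets borel" and sg: "subgaussian_bound \<nu> (\<sigma>\<^sup>2)" and \<sigma>: "0 < \<sigma>"
    and U: "orthogonal_mat n U" and \<theta>: "\<And>a. a < n \<Longrightarrow> 0 \<le> \<theta> a \<and> \<theta> a \<le> 1"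
  shows "(\<integral>\<^sup>+\<xi>. ennreal (exp ((\<Sum>a<n. \<theta> a * (ip n (col U a) \<xi>)\<^sup>2) / (4 * \<sigma>\<^sup>2))) \<partial>PiM {..<n} (\<lambda>_. \<nu>))
    \<le> ennreal (exp ((\<Sum>a<n. \<theta> a) / 2))"
proof -
  let ?P = "PiM {..<n} (\<lambda>_. \<nu>)"
  interpret N: product_sigma_finite "\<lambda>_::nat. \<nu>"
    by (intro product_sigma_finite.intro prob_space_imp_sigma_finite \<nu>)
  interpret G: product_sigma_finite "\<lambda>_::nat. gs"
    by (intro product_sigma_finite.intro prob_space_imp_sigma_finite prob_space_gs)
  interpret P: prob_space ?P by (intro prob_space_PiM \<nu>)
  interpret H: prob_space "GN n" by (rule prob_space_GN)
  interpret PP: pair_sigma_finite ?P "GN n" ..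
  note [measurable_cong] = \<nu>(2)
  \<comment> \<open>Chosen so that the Gaussian average of \<open>exp (s a * y * x)\<close> over
    \<open>x\<close> is
    \<open>exp (\<theta> a * y\<^sup>2 / (4 * \<sigma>\<^sup>2))\<close>.\<close>
  define s where "s = (\<lambda>a. sqrt (\<theta> a / (2 * \<sigma>\<^sup>2)))"
  have s2: "(s a)\<^sup>2 = \<theta> a / (2 * \<sigma>\<^sup>2)" if "a < n" for a using \<theta>[OF that] \<sigma> by (simp add: s_def)
  have 1: "ennreal (exp ((\<Sum>a<n. \<theta> a * (ip n (col U a) \<xi>)\<^sup>2) / (4 * \<sigma>\<^sup>2)))
     = (\<integral>\<^sup>+h. ennreal (exp (\<Sum>a<n. s a * ip n (col U a) \<xi> * h a)) \<partial>GN n)" for \<xi>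
  proof -
    have "(\<integral>\<^sup>+h. ennreal (exp (\<Sum>a<n. s a * ip n (col U a) \<xi> * h a)) \<partial>GN n)
      = (\<integral>\<^sup>+h. (\<Prod>a<n. ennreal (exp (s a * ip n (col U a) \<xi> * h a))) \<partial>GN n)"
      by (simp add: exp_sum prod_ennreal)
    also have "\<dots> = (\<Prod>a<n. (\<integral>\<^sup>+x. ennreal (exp (s a * ip n (col U a) \<xi> * x)) \<partial>gs))"
      by (rule G.product_nn_integral_prod) auto
    also have "\<dots> = (\<Prod>a<n. ennreal (exp ((s a * ip n (col U a) \<xi>)\<^sup>2 / 2)))"
      by (simp only: gauss_mgf)
    also have "\<dots> = ennreal (exp (\<Sum>a<n. (s a * ip n (col U a) \<xi>)\<^sup>2 / 2))"
      by (simp add: exp_sum prod_ennreal)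
    also have "(\<Sum>a<n. (s a * ip n (col U a) \<xi>)\<^sup>2 / 2) = (\<Sum>a<n. \<theta> a * (ip n (col U a) \<xi>)\<^sup>2) / (4 * \<sigma>\<^sup>2)"
      unfolding sum_divide_distrib by (intro sum.cong refl) (simp add: power_mult_distrib s2)
    finally show ?thesis ..
  qed
  \<comment> \<open>For fixed \<open>h\<close> the exponent is linear in the noise, with coefficient
    vector \<open>v\<close>. Independence factorizes the integral, and orthonormality of the columns
    of \<open>U\<close> gives the norm of \<open>v\<close>.\<close>
  have 2: "(\<integral>\<^sup>+\<xi>. ennreal (exp (\<Sum>a<n. s a * ip n (col U a) \<xi> * h a)) \<partial>?P) \<le> ennreal (exp (\<Sum>a<n. \<theta> a / 4 * (h a)\<^sup>2))" for h
  proof -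
    define v where "v = (\<lambda>i. \<Sum>a<n. (s a * h a) * U i a)"
    have "(\<Sum>a<n. s a * ip n (col U a) \<xi> * h a) = (\<Sum>i<n. v i * \<xi> i)" for \<xi>
    proof -
      have "(\<Sum>a<n. s a * ip n (col U a) \<xi> * h a) = (\<Sum>a<n. \<Sum>i<n. (s a * h a) * U i a * \<xi> i)"
        by (simp add: ip_def sum_distrib_left sum_distrib_right mult_ac)
      also have "\<dots> = (\<Sum>i<n. \<Sum>a<n. (s a * h a) * U i a * \<xi> i)" by (rule sum.swap)
      finally show ?thesis by (simp add: v_def sum_distrib_right)
    qed
    then have "(\<integral>\<^sup>+\<xi>. ennreal (exp (\<Sum>a<n. s a * ip n (col U a) \<xi> * h a)) \<partial>?P)
      = (\<integral>\<^sup>+\<xi>. (\<Prod>i<n. ennreal (exp (v i * \<xi> i))) \<partial>?P)"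
      by (simp add: exp_sum prod_ennreal)
    also have "\<dots> = (\<Prod>i<n. (\<integral>\<^sup>+x. ennreal (exp (v i * x)) \<partial>\<nu>))"
      by (rule N.product_nn_integral_prod) auto
    also have "\<dots> = (\<Prod>i<n. ennreal (LINT x|\<nu>. exp (v i * x)))"
      using sg by (intro prod.cong refl nn_integral_eq_integral) (auto simp: subgaussian_bound_def)
    also have "\<dots> = ennreal (\<Prod>i<n. LINT x|\<nu>. exp (v i * x))"
      by (rule prod_ennreal) simp
    also have "\<dots> \<le> ennreal (\<Prod>i<n. exp ((v i)\<^sup>2 * \<sigma>\<^sup>2 / 2))"
      using sg by (intro ennreal_leI prod_mono) (auto simp: subgaussian_bound_def)
    also have "\<dots> = ennreal (exp (\<Sum>i<n. (v i)\<^sup>2 * \<sigma>\<^sup>2 / 2))"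
      by (simp add: exp_sum)
    also have "(\<Sum>i<n. (v i)\<^sup>2 * \<sigma>\<^sup>2 / 2) = \<sigma>\<^sup>2 / 2 * ip n v v"
      by (simp add: ip_def sum_distrib_left power2_eq_square mult_ac)
    also have "ip n v v = (\<Sum>a<n. (s a * h a)\<^sup>2)"
      unfolding v_def by (rule ip_combination[OF U])
    also have "\<sigma>\<^sup>2 / 2 * (\<Sum>a<n. (s a * h a)\<^sup>2) = (\<Sum>a<n. \<theta> a / 4 * (h a)\<^sup>2)"
      unfolding sum_distrib_left using \<sigma> by (intro sum.cong refl) (simp add: power_mult_distrib s2 field_simps)
    finally show ?thesis .
  qed
  have "(\<integral>\<^sup>+\<xi>. ennreal (exp ((\<Sum>a<n. \<theta> a * (ip n (col U a) \<xi>)\<^sup>2) / (4 * \<sigma>\<^sup>2))) \<partial>?P)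
    = (\<integral>\<^sup>+\<xi>. (\<integral>\<^sup>+h. ennreal (exp (\<Sum>a<n. s a * ip n (col U a) \<xi> * h a)) \<partial>GN n) \<partial>?P)"
    by (simp only: 1)
  also have "\<dots> = (\<integral>\<^sup>+h. (\<integral>\<^sup>+\<xi>. ennreal (exp (\<Sum>a<n. s a * ip n (col U a) \<xi> * h a)) \<partial>?P) \<partial>GN n)"
    by (rule PP.Fubini'[symmetric]) (unfold ip_def, measurable)
  also have "\<dots> \<le> (\<integral>\<^sup>+h. ennreal (exp (\<Sum>a<n. \<theta> a / 4 * (h a)\<^sup>2)) \<partial>GN n)"
    by (intro nn_integral_mono 2)
  also have "\<dots> = (\<integral>\<^sup>+h. (\<Prod>a<n. ennreal (exp (\<theta> a / 4 * (h a)\<^sup>2))) \<partial>GN n)"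
    by (simp add: exp_sum prod_ennreal)
  also have "\<dots> = (\<Prod>a<n. (\<integral>\<^sup>+x. ennreal (exp (\<theta> a / 4 * x\<^sup>2)) \<partial>gs))"
    by (rule G.product_nn_integral_prod) auto
  also have "\<dots> = (\<Prod>a<n. ennreal (1 / sqrt (1 - 2 * (\<theta> a / 4))))"
    by (intro prod.cong refl gauss_exp_sq_nn) (use \<theta> in force)
  also have "\<dots> = ennreal (\<Prod>a<n. 1 / sqrt (1 - 2 * (\<theta> a / 4)))"
    by (rule prod_ennreal) (use \<theta> in force)
  also have "\<dots> \<le> ennreal (\<Prod>a<n. exp (\<theta> a / 2))"
  proof (intro ennreal_leI prod_mono conjI)
    fix a assume "a \<in> {..<n}"
    then have a: "0 \<le> \<theta> a" "\<theta> a \<le> 1" using \<theta> by auto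
    show "1 / sqrt (1 - 2 * (\<theta> a / 4)) \<le> exp (\<theta> a / 2)" using inv_sqrt_le_exp[OF a] by simp
    show "0 \<le> 1 / sqrt (1 - 2 * (\<theta> a / 4))" using a by simp
  qed
  also have "\<dots> = ennreal (exp ((\<Sum>a<n. \<theta> a) / 2))"
    by (simp add: exp_sum[symmetric] sum_divide_distrib)
  finally show ?thesis .
qed

subsection \<open>Regret of the SDP procedure\<close>

lemma ip_e_sum: "ip n (\<lambda>j. if j = i then c else 0) (\<lambda>j. if j = i then c else 0) = (if i < n then c\<^sup>2 else 0)"
  by (simp add: ip_def power2_eq_square if_distrib[of "\<lambda>t. t * _"] if_distrib[of "\<lambda>t. _ * t"] cong: if_cong)

lemma quad_e: "i < n \<Longrightarrow> quad n X (\<lambda>j. if j = i then c else 0) = c\<^sup>2 * X i i"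
  by (simp add: quad_def power2_eq_square if_distrib[of "\<lambda>t. t * _"] if_distrib[of "\<lambda>t. _ * t"] cong: if_cong)

lemma quad_scale_mat: "quad n (\<lambda>i j. c * A i j) x = c * quad n A x"
  by (simp add: quad_eq_frob frob_scale_left)

lemma quad_sum_mat: "quad n (\<lambda>i j. \<Sum>k\<in>I. g k * A k i j) x = (\<Sum>k\<in>I. g k * quad n (A k) x)"
proof -
  have "quad n (\<lambda>i j. \<Sum>k\<in>I. g k * A k i j) x = (\<Sum>i<n. \<Sum>j<n. \<Sum>k\<in>I. g k * (x i * A k i j * x j))"
    by (simp add: quad_def sum_distrib_left sum_distrib_right mult_ac)
  also have "\<dots> = (\<Sum>k\<in>I. \<Sum>i<n. \<Sum>j<n. g k * (x i * A k i j * x j))"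
    by (rule sum_rotate3[symmetric])
  finally show ?thesis by (simp add: quad_def sum_distrib_left)
qed

lemma quad_sum_mat_div:
  "quad n (\<lambda>i j. (\<Sum>k\<in>I. g k * A k i j) / G) x = (\<Sum>k\<in>I. g k * quad n (A k) x) / G"
  using quad_scale_mat[of n "1 / G" "\<lambda>i j. \<Sum>k\<in>I. g k * A k i j" x] by (simp add: quad_sum_mat)

lemma quad_idm: "quad n (idm n) x = ip n x x"
  by (simp add: quad_def ip_def idm_entry if_distrib[of "\<lambda>t. _ * t"] if_distrib[of "\<lambda>t. t * _"] cong: if_cong)

lemma frob_idm: "frob n (idm n) Z = tr n Z"
  by (simp add: frob_def tr_def idm_entry if_distrib[of "\<lambda>t. t * _"] cong: if_cong)

section \<open>Feasibility of the iterates and of their weighted mean\<close>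

lemma fantope_mix:
  assumes X: "\<And>k. k \<in> I \<Longrightarrow> X k \<in> fantope n m" and g: "\<And>k. k \<in> I \<Longrightarrow> 0 \<le> g k"
    and G: "0 < (\<Sum>k\<in>I. g k)"
  shows "(\<lambda>i j. (\<Sum>k\<in>I. g k * X k i j) / (\<Sum>k\<in>I. g k)) \<in> fantope n m"
proof -
  let ?G = "\<Sum>k\<in>I. g k"
  let ?X = "\<lambda>i j. (\<Sum>k\<in>I. g k * X k i j) / ?G"
  have sym: "X k i j = X k j i" if "k \<in> I" for k i j
    using X[OF that] by (metis (mono_tags, lifting) fantope_def mem_Collect_eq mtrans_def)
  have "?X \<in> Mn n" using X by (auto simp: fantope_def Mn_def intro!: sum.neutral)
  moreover have "mtrans ?X = ?X"
  proof (intro ext)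
    fix i j
    have "(\<Sum>k\<in>I. g k * X k j i) = (\<Sum>k\<in>I. g k * X k i j)"
    proof (rule sum.cong[OF refl])
      fix k assume "k \<in> I"
      from sym[OF this, of j i] show "g k * X k j i = g k * X k i j" by (rule arg_cong)
    qed
    then show "mtrans ?X i j = ?X i j" by (simp add: mtrans_def)
  qed
  moreover have "0 \<le> quad n ?X x \<and> quad n ?X x \<le> ip n x x" if "x \<in> Rn n" for x
  proof -
    have q: "0 \<le> quad n (X k) x \<and> quad n (X k) x \<le> ip n x x" if "k \<in> I" for k
      using X[OF that] \<open>x \<in> Rn n\<close> by (simp add: fantope_def)
    have "(\<Sum>k\<in>I. g k * quad n (X k) x) \<le> (\<Sum>k\<in>I. g k * ip n x x)"
      by (intro sum_mono mult_left_mono) (use q g in auto)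
    then have "(\<Sum>k\<in>I. g k * quad n (X k) x) \<le> ?G * ip n x x" by (simp add: sum_distrib_right)
    moreover have "0 \<le> (\<Sum>k\<in>I. g k * quad n (X k) x)"
      by (intro sum_nonneg mult_nonneg_nonneg) (use q g in auto)
    ultimately show ?thesis
      unfolding quad_sum_mat_div using G by (simp add: divide_le_eq mult.commute)
  qed
  moreover have "tr n ?X = real n - real m"
  proof -
    have "tr n ?X = (\<Sum>k\<in>I. g k * tr n (X k)) / ?G"
      by (simp add: tr_def sum_divide_distrib[symmetric] sum_distrib_left) (subst sum.swap, simp)
    also have "(\<Sum>k\<in>I. g k * tr n (X k)) = ?G * (real n - real m)"
      unfolding sum_distrib_right using X by (intro sum.cong refl) (simp add: fantope_def)
    finally show ?thesis using G by simp
  qed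
  ultimately show ?thesis by (simp add: fantope_def)
qed

lemma sdp_start_fantope:
  assumes "m \<le> n" "0 < n"
  shows "sdp_start n m \<in> fantope n m"
proof -
  have c: "0 \<le> (real n - real m) / real n" "(real n - real m) / real n \<le> 1"
    using assms by (auto simp: divide_le_eq)
  have q: "quad n (sdp_start n m) x = (real n - real m) / real n * ip n x x" for x
    unfolding sdp_start_def quad_scale_mat quad_idm ..
  have "\<forall>x\<in>Rn n. 0 \<le> quad n (sdp_start n m) x \<and> quad n (sdp_start n m) x \<le> ip n x x"
    unfolding q by (intro ballI conjI mult_nonneg_nonneg mult_left_le_one_le c ip_nonneg)
  moreover have "tr n (sdp_start n m) = real n - real m"
    using assms by (simp add: tr_def sdp_start_def idm_entry)
  moreover have "sdp_start n m \<in> Mn n" "mtrans (sdp_start n m) = sdp_start n m"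
    by (auto simp: sdp_start_def Mn_def mtrans_def idm_entry fun_eq_iff)
  ultimately show ?thesis by (simp only: fantope_def mem_Collect_eq)
qed

lemma sdp_iterate_fantope:
  assumes "m \<le> n" "0 < n" and Q: "\<And>k Z. k < N \<Longrightarrow> psd n Z \<Longrightarrow> Q k Z \<in> Rn n"
  shows "k \<le> N \<Longrightarrow> sdp_iterate n m C \<kappa> Q k \<in> fantope n m"
proof (induction k)
  case 0
  then show ?case by (simp add: sdp_start_fantope assms)
next
  case (Suc k)
  then have X: "sdp_iterate n m C \<kappa> Q k \<in> fantope n m" by simp
  have "Q k (sdp_iterate n m C \<kappa> Q k) \<in> Rn n"
    by (rule Q[OF _ contr_psd[OF fantope_contr[OF X]]]) (use Suc.prems in simp)
  moreover have "sdp_iterate n m C \<kappa> Q k \<in> Mn n" "mtrans (sdp_iterate n m C \<kappa> Q k) = sdp_iterate n m C \<kappa> Q k"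
    using X by (auto simp: fantope_def)
  ultimately show ?case
    unfolding sdp_iterate.simps Let_def by (intro sdp_update_projection(1) assms(1,2))
qed

lemma sdp_step_nonneg: "1 \<le> \<kappa> \<Longrightarrow> 0 \<le> sdp_step n C \<kappa> p"
  by (simp add: sdp_step_def)

lemma SDP_contr:
  assumes m: "m \<le> n" "0 < n" and k1: "1 \<le> \<kappa>"
    and Q: "\<And>k Z. k < sdp_iters n m C \<kappa> \<Longrightarrow> psd n Z \<Longrightarrow> Q k Z \<in> Rn n"
  shows "contr n (SDP n m C \<kappa> Q)"
proof (cases "m = n")
  case True
  then show ?thesis using sdp_start_fantope[OF m] by (simp add: SDP_def fantope_contr)
next
  case False
  define X where "X = sdp_iterate n m C \<kappa> Q"
  define g where "g = (\<lambda>k. sdp_step n C \<kappa> (Q k (X k)))"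
  let ?N = "sdp_iters n m C \<kappa>"
  have S: "SDP n m C \<kappa> Q = (\<lambda>i j. (\<Sum>k<?N. g k * X k i j) / (\<Sum>k<?N. g k))"
    using False by (simp add: SDP_def Let_def X_def g_def)
  have g: "0 \<le> g k" for k by (simp add: g_def sdp_step_nonneg k1)
  show ?thesis
  \<comment> \<open>A zero total weight means that all steps are 0. Division by zero then makes the
    output the zero matrix, which satisfies \<open>contr\<close> although its trace is
    wrong.\<close>
  proof (cases "(\<Sum>k<?N. g k) = 0")
    case True
    then show ?thesis unfolding S by (simp add: contr_def Mn_def mtrans_def quad_def)
  next
    case False
    then have "0 < (\<Sum>k<?N. g k)" using sum_nonneg[of "{..<?N}" g] g by (simp add: less_le)
    then show ?thesis
      unfolding S using g
      by (intro fantope_contr[of _ _ m] fantope_mix)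
        (auto simp: X_def intro!: sdp_iterate_fantope[OF m Q])
  qed
qed

section \<open>Regret of projected gradient descent\<close>

lemma frob_rank_one: "frob n (\<lambda>i j. g * (p i * p j)) A = g * quad n A p"
  unfolding frob_scale_left quad_eq_frob by (simp add: frob_commute)

lemma frob_rank_one_self: "frob n (\<lambda>i j. g * (p i * p j)) (\<lambda>i j. g * (p i * p j)) = (g * ip n p p)\<^sup>2"
proof -
  have "quad n (\<lambda>i j. p i * p j) p = (ip n p p)\<^sup>2"
    by (simp add: quad_def power2_eq_square ip_ip_expand mult_ac)
  then show ?thesis
    unfolding frob_rank_one quad_scale_mat by (simp add: power_mult_distrib power2_eq_square)
qed

text \<open>The three-point inequality for a gradient step against \<open>p p^T\<close>: the squared
  distance to any feasible \<open>Z\<close> decreases by twice the step times the excess of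
  \<open>X\<close> over \<open>Z\<close>, up to the squared step length. It combines the
  obtuse-angle property with one nonnegative square.\<close>

lemma projection_step:
  assumes X: "X \<in> fantope n m" and Z: "Z \<in> fantope n m" and p: "p \<in> Rn n" and m: "m \<le> n" "0 < n"
  shows "frob n (\<lambda>i j. sdp_update n m g p X i j - Z i j) (\<lambda>i j. sdp_update n m g p X i j - Z i j)
    \<le> frob n (\<lambda>i j. X i j - Z i j) (\<lambda>i j. X i j - Z i j)
      - 2 * g * (quad n X p - quad n Z p) + (g * ip n p p)\<^sup>2"
proof -
  let ?G = "\<lambda>i j. g * (p i * p j)"
  define V where "V = sdp_update n m g p X"
  have X': "X \<in> Mn n" "mtrans X = X" using X by (auto simp: fantope_def)
  have 1: "frob n (\<lambda>i j. (X i j - ?G i j) - V i j) (\<lambda>i j. Z i j - V i j) \<le> 0"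
    unfolding V_def by (rule sdp_update_projection(2)[OF X' p m Z])
  have 2: "0 \<le> frob n (\<lambda>i j. (X i j - ?G i j) - V i j) (\<lambda>i j. (X i j - ?G i j) - V i j)"
    by (rule frob_nonneg)
  have c: "frob n X ?G = frob n ?G X" "frob n Z ?G = frob n ?G Z" "frob n V ?G = frob n ?G V"
    "frob n X Z = frob n Z X" "frob n V Z = frob n Z V" "frob n X V = frob n V X"
    by (simp_all add: frob_commute)
  have q: "frob n ?G X = g * quad n X p" "frob n ?G Z = g * quad n Z p" "frob n ?G ?G = (g * ip n p p)\<^sup>2"
    by (simp_all only: frob_rank_one frob_rank_one_self) (simp add: frob_rank_one[symmetric] frob_rank_one_self)
  define G where "G = ?G"
  show ?thesis
    using 1 2 c q unfolding G_def[symmetric] V_def[symmetric] frob_diff_left frob_diff_right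
    by (simp add: algebra_simps)
qed

lemma fantope_norm:
  assumes "Z \<in> fantope n m"
  shows "frob n Z Z \<le> real n - real m"
proof -
  obtain U x where U: "orthogonal_mat n U" "Z = spec n U x" and x: "\<forall>a<n. 0 \<le> x a \<and> x a \<le> 1"
    using contr_spec[OF fantope_contr[OF assms]] .
  have "frob n Z Z = (\<Sum>k<n. x k * x k)"
    by (simp add: U(2) frob_spec quad_col_spec[OF U(1)])
  also have "\<dots> \<le> (\<Sum>k<n. x k)" by (intro sum_mono mult_left_le) (use x in auto)
  also have "\<dots> = real n - real m" using assms tr_spec[OF U(1), of x] by (simp add: fantope_def U(2))
  finally show ?thesis .
qed

text \<open>All members of the set have the same inner product with a multiple of the identity, so
  Pythagoras reduces the claim to \<open>fantope_norm\<close>.\<close>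

lemma start_distance:
  assumes Z: "Z \<in> fantope n m" and m: "m \<le> n" "0 < n"
  shows "frob n (\<lambda>i j. sdp_start n m i j - Z i j) (\<lambda>i j. sdp_start n m i j - Z i j) \<le> real n - real m"
proof -
  let ?c = "(real n - real m) / real n"
  have 1: "frob n (sdp_start n m) W = ?c * tr n W" for W
    unfolding sdp_start_def frob_scale_left frob_idm ..
  have 2: "tr n (sdp_start n m) = real n - real m" "tr n Z = real n - real m"
    using Z sdp_start_fantope[OF m] by (auto simp: fantope_def)
  have 3: "0 \<le> ?c * (real n - real m)" using m by simp
  have 4: "frob n (sdp_start n m) Z = ?c * (real n - real m)"
    "frob n Z (sdp_start n m) = ?c * (real n - real m)"
    "frob n (sdp_start n m) (sdp_start n m) = ?c * (real n - real m)"
    unfolding frob_commute[of n Z] by (simp_all only: 1 2)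
  show ?thesis
    unfolding frob_diff_left frob_diff_right 4 using fantope_norm[OF Z] 3 by linarith
qed

text \<open>\<open>projection_step\<close> telescopes. The normalization of the step by the squared
  norm of the answer makes every step cost at most \<open>(1 / (\<kappa> C^2))^2\<close>, whatever
  the oracle returns.\<close>

lemma sdp_regret:
  assumes m: "m \<le> n" "0 < n" and k1: "1 \<le> \<kappa>" and C: "0 < C"
    and Q: "\<And>k Z. k < N \<Longrightarrow> psd n Z \<Longrightarrow> Q k Z \<in> Rn n" and Z: "Z \<in> fantope n m"
  defines "X \<equiv> sdp_iterate n m C \<kappa> Q"
  defines "p \<equiv> (\<lambda>k. Q k (X k))"
  defines "g \<equiv> (\<lambda>k. sdp_step n C \<kappa> (p k))"
  shows "2 * (\<Sum>k<N. g k * quad n (X k) (p k))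
    \<le> 2 * (\<Sum>k<N. g k * quad n Z (p k)) + (real n - real m) + real N * (1 / (\<kappa> * C\<^sup>2))\<^sup>2"
proof -
  let ?D = "\<lambda>k. frob n (\<lambda>i j. X k i j - Z i j) (\<lambda>i j. X k i j - Z i j)"
  let ?\<gamma> = "1 / (\<kappa> * C\<^sup>2)"
  have "2 * (\<Sum>k<j. g k * quad n (X k) (p k)) + ?D j
    \<le> 2 * (\<Sum>k<j. g k * quad n Z (p k)) + (real n - real m) + real j * ?\<gamma>\<^sup>2" if "j \<le> N" for j
    using that
  proof (induction j)
    case 0
    then show ?case using start_distance[OF Z m] by (simp add: X_def)
  next
    case (Suc j)
    have Xj: "X j \<in> fantope n m" unfolding X_def using Suc.prems by (intro sdp_iterate_fantope[OF m Q]) auto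
    have pj: "p j \<in> Rn n"
      unfolding p_def by (rule Q[OF _ contr_psd[OF fantope_contr[OF Xj]]]) (use Suc.prems in simp)
    have XS: "X (Suc j) = sdp_update n m (g j) (p j) (X j)" by (simp add: X_def g_def p_def Let_def)
    \<comment> \<open>An equality unless the answer is the zero vector, whose step size is
      0.\<close>
    have "(g j * ip n (p j) (p j))\<^sup>2 \<le> ?\<gamma>\<^sup>2"
      by (cases "ip n (p j) (p j) = 0") (simp_all add: g_def sdp_step_def enorm_sq)
    then have "?D (Suc j) \<le> ?D j - 2 * g j * (quad n (X j) (p j) - quad n Z (p j)) + ?\<gamma>\<^sup>2"
      using projection_step[OF Xj Z pj m, of "g j"] unfolding XS by linarith
    moreover have "2 * (\<Sum>k<j. g k * quad n (X k) (p k)) + ?D j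
      \<le> 2 * (\<Sum>k<j. g k * quad n Z (p k)) + (real n - real m) + real j * ?\<gamma>\<^sup>2"
      using Suc by simp
    moreover have "real (Suc j) * ?\<gamma>\<^sup>2 = real j * ?\<gamma>\<^sup>2 + ?\<gamma>\<^sup>2" by (simp add: distrib_right)
    ultimately show ?case by (simp add: algebra_simps)
  qed
  from this[of N] show ?thesis using frob_nonneg[of n "\<lambda>i j. X N i j - Z i j"] by simp
qed

section \<open>Quality of the averaged iterate\<close>

lemma smallest_subset:
  fixes l :: "nat \<Rightarrow> real"
  shows "j \<le> n \<Longrightarrow> \<exists>B\<subseteq>{..<n}. card B = j \<and> (\<forall>a\<in>B. \<forall>b\<in>{..<n} - B. l a \<le> l b)"
proof (induction j)
  case 0
  show ?case by (rule exI[of _ "{}"]) simp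
next
  case (Suc j)
  then obtain B where B: "B \<subseteq> {..<n}" "card B = j" "\<forall>a\<in>B. \<forall>b\<in>{..<n} - B. l a \<le> l b" by auto
  have fin: "finite B" using B(1) finite_subset by blast
  have "{..<n} - B \<noteq> {}" using B(1,2) Suc.prems by (metis Diff_eq_empty_iff card_lessThan equalityI not_less_eq_eq order_refl)
  then obtain a where a: "a \<in> {..<n} - B" "\<forall>b\<in>{..<n} - B. l a \<le> l b"
    using ex_min_if_finite[of "l ` ({..<n} - B)"] arg_min_if_finite(1)[of "{..<n} - B" l]
      arg_min_least[of "{..<n} - B" _ l] by (metis finite_Diff finite_lessThan)
  have "card (insert a B) = Suc j" using a fin B by simp
  then show ?case using B a by (intro exI[of _ "insert a B"]) auto
qed

lemma half_bound:
  fixes x y u v :: real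
  assumes "2 * x \<le> 2 * y + u + v"
  shows "x \<le> y + (u + v) / 2"
  using assms by (simp add: field_simps)

text \<open>The comparison point is the projector on the eigenvectors in \<open>B\<close>; no minimax theorem is needed.\<close>

theorem sdp_guarantee:
  fixes K' :: "rvec set"
  assumes m: "m < n" and k1: "1 \<le> \<kappa>" and C: "0 < C"
    and Q: "\<And>k Z. k < sdp_iters n m C \<kappa> \<Longrightarrow> psd n Z \<Longrightarrow> Q k Z \<in> K'"
    and K: "K' \<subseteq> Rn n" "\<And>x. x \<in> K' \<Longrightarrow> enorm n x \<le> d"
    and e: "0 < e" "ecball n (\<lambda>_. 0) e \<subseteq> K'"
    and good: "\<And>k. k < sdp_iters n m C \<kappa> \<Longrightarrow>
      quad n (sdp_iterate n m C \<kappa> Q k) (Q k (sdp_iterate n m C \<kappa> Q k))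
        \<ge> (1 / \<kappa>) * (SUP p\<in>K'. quad n (sdp_iterate n m C \<kappa> Q k) p)"
  obtains w :: "nat \<Rightarrow> real" and p :: "nat \<Rightarrow> rvec" and U l B and N :: nat where
    "\<And>k. k < N \<Longrightarrow> 0 \<le> w k \<and> p k \<in> K'" "(\<Sum>k<N. w k) = 1" "orthogonal_mat n U"
    "\<And>x. (\<Sum>k<N. w k * (ip n (p k) x)\<^sup>2) = (\<Sum>a<n. l a * (ip n (col U a) x)\<^sup>2)"
    "\<And>a. a < n \<Longrightarrow> 0 \<le> l a" "B \<subseteq> {..<n}" "card B = n - m"
    "\<And>a b. a \<in> B \<Longrightarrow> b \<in> {..<n} - B \<Longrightarrow> l a \<le> l b"
    "\<And>x. x \<in> K' \<Longrightarrow> quad n (SDP n m C \<kappa> Q) x \<le> \<kappa> * (\<Sum>a\<in>B. l a) + d\<^sup>2 / C\<^sup>2"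
    "SDP n m C \<kappa> Q \<in> fantope n m"
proof -
  define N where "N = sdp_iters n m C \<kappa>"
  define X where "X = sdp_iterate n m C \<kappa> Q"
  define p where "p = (\<lambda>k. Q k (X k))"
  define g where "g = (\<lambda>k. sdp_step n C \<kappa> (p k))"
  define G where "G = (\<Sum>k<N. g k)"
  define w where "w = (\<lambda>k. g k / G)"
  define \<gamma> where "\<gamma> = 1 / (\<kappa> * C\<^sup>2)"
  have m': "m \<le> n" "0 < n" using m by auto
  have \<gamma>: "0 < \<gamma>" using k1 C by (simp add: \<gamma>_def)
  have QR: "\<And>k Z. k < N \<Longrightarrow> psd n Z \<Longrightarrow> Q k Z \<in> Rn n" using Q K by (auto simp: N_def)
  have Xf: "X k \<in> fantope n m" if "k < N" for k
    unfolding X_def using that by (intro sdp_iterate_fantope[OF m' QR]) auto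
  have pK: "p k \<in> K'" if "k < N" for k
    unfolding p_def by (rule Q[OF _ contr_psd[OF fantope_contr[OF Xf[OF that]]]]) (use that in \<open>simp add: N_def\<close>)
  have N1: "0 < N" by (simp add: N_def sdp_iters_def)
  have d0: "0 \<le> d" by (rule order_trans[OF enorm_nonneg K(2)[OF pK[OF N1]]])
  \<comment> \<open>A successful call is optimal up to the factor \<open>\<kappa>\<close>, so every
    point of the body can be compared with the answer \<open>p k\<close>.\<close>
  have sup: "quad n (X k) x \<le> \<kappa> * quad n (X k) (p k)" if "k < N" "x \<in> K'" for k x
  proof -
    have bdd: "bdd_above (quad n (X k) ` K')"
    proof (rule bdd_aboveI2[where M = "d\<^sup>2"])
      fix y assume y: "y \<in> K'"
      have "quad n (X k) y \<le> ip n y y" using Xf[OF that(1)] y K by (auto simp: fantope_def)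
      also have "\<dots> \<le> d\<^sup>2" using power_mono[OF K(2)[OF y] enorm_nonneg, of 2] by (simp only: enorm_sq)
      finally show "quad n (X k) y \<le> d\<^sup>2" .
    qed
    have "quad n (X k) x \<le> (SUP p\<in>K'. quad n (X k) p)" by (rule cSUP_upper[OF that(2) bdd])
    moreover have "(1 / \<kappa>) * (SUP p\<in>K'. quad n (X k) p) \<le> quad n (X k) (p k)"
      using good that by (simp add: X_def p_def N_def)
    then have "(SUP p\<in>K'. quad n (X k) p) \<le> \<kappa> * quad n (X k) (p k)"
      using k1 by (simp add: divide_le_eq mult.commute)
    ultimately show ?thesis by linarith
  qed
  \<comment> \<open>A successful answer is nonzero: the trace \<open>n - m\<close> of the iterate is
    positive, so some diagonal entry is, and a small multiple of that basis vector lies in the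
    body.\<close>
  have ppos: "0 < ip n (p k) (p k)" if "k < N" for k
  proof -
    have "0 < tr n (X k)" using Xf[OF that] m by (simp add: fantope_def)
    have "\<exists>i<n. 0 < X k i i"
    proof (rule ccontr)
      assume "\<not> ?thesis"
      then have "tr n (X k) \<le> 0" unfolding tr_def by (intro sum_nonpos) (meson lessThan_iff not_le)
      then show False using \<open>0 < tr n (X k)\<close> by simp
    qed
    then obtain i where i: "i < n" "0 < X k i i" by (elim exE conjE)
    let ?e = "\<lambda>j. if j = i then e else 0"
    have "?e \<in> ecball n (\<lambda>_. 0) e"
      using i e(1) by (simp add: ecball_def Rn_def enorm_eq_sqrt ip_e_sum)
    then have "?e \<in> K'" using e by auto
    from sup[OF that this] have "e\<^sup>2 * X k i i \<le> \<kappa> * quad n (X k) (p k)" by (simp only: quad_e[OF i(1)])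
    moreover have "0 < e\<^sup>2 * X k i i" using i e by simp
    ultimately have "quad n (X k) (p k) \<noteq> 0" by auto
    then have "ip n (p k) (p k) \<noteq> 0"
      by (rule contrapos_nn) (simp add: ip_eq_0_iff quad_def)
    then show ?thesis by (rule ip_pos)
  qed
  \<comment> \<open>Answers have norm at most \<open>d\<close>, which bounds every step size, and
    hence the total weight \<open>G\<close>, from below.\<close>
  have g: "\<gamma> / d\<^sup>2 \<le> g k" "0 < g k" "0 < d" if "k < N" for k
  proof -
    have le: "ip n (p k) (p k) \<le> d\<^sup>2"
      using power_mono[OF K(2)[OF pK[OF that]] enorm_nonneg, of 2] by (simp only: enorm_sq)
    have gk: "g k = \<gamma> / ip n (p k) (p k)" by (simp add: g_def sdp_step_def enorm_sq \<gamma>_def)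
    have "d \<noteq> 0" using le ppos[OF that] by auto
    then show "0 < d" using d0 by simp
    show "0 < g k" unfolding gk using \<gamma> ppos[OF that] by simp
    show "\<gamma> / d\<^sup>2 \<le> g k"
      unfolding gk using le \<gamma> ppos[OF that] by (intro divide_left_mono mult_pos_pos) auto
  qed
  have dpos: "0 < d" using g N1 by blast
  have Gge: "real N * (\<gamma> / d\<^sup>2) \<le> G"
    using sum_mono[of "{..<N}" "\<lambda>_. \<gamma> / d\<^sup>2" g] g by (simp add: G_def)
  have "0 < real N * (\<gamma> / d\<^sup>2)" using N1 \<gamma> dpos by simp
  then have Gpos: "0 < G" using Gge by linarith
  have SDP: "SDP n m C \<kappa> Q = (\<lambda>i j. (\<Sum>k<N. g k * X k i j) / G)"
    using m by (simp add: SDP_def Let_def X_def g_def p_def N_def G_def)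
  have Sf: "SDP n m C \<kappa> Q \<in> fantope n m"
    unfolding SDP G_def by (rule fantope_mix) (use Xf g Gpos in \<open>auto simp: G_def less_imp_le\<close>)
  define \<Sigma> where "\<Sigma> = (\<lambda>i j. \<Sum>k<N. w k * (p k i * p k j))"
  have pR: "p k \<in> Rn n" if "k < N" for k using pK[OF that] K by auto
  have \<Sigma>M: "\<Sigma> \<in> Mn n" using pR by (auto simp: Mn_def Rn_def \<Sigma>_def intro!: sum.neutral)
  have \<Sigma>s: "mtrans \<Sigma> = \<Sigma>" by (intro ext) (simp add: mtrans_def \<Sigma>_def mult.commute)
  obtain U l where U: "orthogonal_mat n U" "\<Sigma> = spec n U l"
    using spectral_theorem[OF \<Sigma>M \<Sigma>s] .
  have \<Sigma>q: "quad n \<Sigma> x = (\<Sum>k<N. w k * (ip n (p k) x)\<^sup>2)" for x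
  proof -
    have "quad n (\<lambda>i j. p k i * p k j) x = (ip n (p k) x)\<^sup>2" for k
      by (simp add: quad_def power2_eq_square ip_ip_expand mult_ac)
    then show ?thesis unfolding \<Sigma>_def by (simp add: quad_sum_mat)
  qed
  have w0: "0 \<le> w k" if "k < N" for k using g(2)[OF that] Gpos by (simp add: w_def)
  have w1: "(\<Sum>k<N. w k) = 1" using Gpos by (simp add: w_def G_def flip: sum_divide_distrib)
  have l0: "0 \<le> l a" if "a < n" for a
  proof -
    have "0 \<le> quad n \<Sigma> (col U a)" unfolding \<Sigma>q using w0 by (intro sum_nonneg) simp
    then show ?thesis unfolding U(2) quad_col_spec[OF U(1) that] .
  qed
  obtain B where B: "B \<subseteq> {..<n}" "card B = n - m" "\<forall>a\<in>B. \<forall>b\<in>{..<n} - B. l a \<le> l b"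
    using smallest_subset[of "n - m" n l] by auto
  \<comment> \<open>With these eigenvalues \<open>spec n U ?v\<close> is the projector onto the
    eigenvectors in \<open>B\<close>; its weighted payoff is exactly the tail of the
    spectrum.\<close>
  let ?v = "\<lambda>a. if a \<in> B then 1 else 0 :: real"
  have Bsum: "(\<Sum>a<n. ?v a * f a) = (\<Sum>a\<in>B. f a)" for f :: "nat \<Rightarrow> real"
  proof -
    have "(\<Sum>a<n. ?v a * f a) = (\<Sum>a<n. if a \<in> B then f a else 0)"
      by (intro sum.cong) auto
    then show ?thesis using B(1) by (simp add: sum.inter_restrict[symmetric] Int_absorb1)
  qed
  have "?v \<in> capped_simplex n m"
    using B Bsum[of "\<lambda>_. 1"] m by (auto simp: capped_simplex_def Rn_def of_nat_diff)
  then have Zf: "spec n U ?v \<in> fantope n m" by (rule spec_in_fantope[OF U(1)])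
  have Zw: "(\<Sum>k<N. w k * quad n (spec n U ?v) (p k)) = (\<Sum>a\<in>B. l a)"
  proof -
    have "(\<Sum>k<N. w k * quad n (spec n U ?v) (p k)) = (\<Sum>k<N. \<Sum>a<n. w k * (?v a * (ip n (col U a) (p k))\<^sup>2))"
      by (simp add: quad_spec sum_distrib_left)
    also have "\<dots> = (\<Sum>a<n. \<Sum>k<N. w k * (?v a * (ip n (col U a) (p k))\<^sup>2))" by (rule sum.swap)
    also have "\<dots> = (\<Sum>a<n. ?v a * (\<Sum>k<N. w k * (ip n (p k) (col U a))\<^sup>2))"
      by (simp add: sum_distrib_left ip_commute mult_ac)
    also have "\<dots> = (\<Sum>a<n. ?v a * l a)"
      by (intro sum.cong refl) (simp add: \<Sigma>q[symmetric] U(2) quad_col_spec[OF U(1)])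
    finally show ?thesis by (simp only: Bsum)
  qed
  have Nge: "4 * (real n - real m) * C ^ 4 * \<kappa>\<^sup>2 \<le> real N"
    unfolding N_def sdp_iters_def by linarith
  have bound: "quad n (SDP n m C \<kappa> Q) x \<le> \<kappa> * (\<Sum>a\<in>B. l a) + d\<^sup>2 / C\<^sup>2" if x: "x \<in> K'" for x
  proof -
    let ?A = "\<Sum>k<N. g k * quad n (X k) (p k)" and ?Z = "\<Sum>k<N. g k * quad n (spec n U ?v) (p k)"
    have "quad n (SDP n m C \<kappa> Q) x = (\<Sum>k<N. g k * quad n (X k) x) / G"
      unfolding SDP quad_sum_mat_div ..
    also have "\<dots> \<le> (\<Sum>k<N. g k * (\<kappa> * quad n (X k) (p k))) / G"
      using sup x g Gpos by (intro divide_right_mono sum_mono mult_left_mono) (auto simp: less_imp_le)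
    also have "\<dots> = \<kappa> * (?A / G)"
      by (simp add: sum_distrib_left sum_divide_distrib mult_ac)
    also have "\<dots> \<le> \<kappa> * ((?Z + ((real n - real m) + real N * \<gamma>\<^sup>2) / 2) / G)"
    proof (intro mult_left_mono divide_right_mono)
      have "2 * ?A \<le> 2 * ?Z + (real n - real m) + real N * \<gamma>\<^sup>2"
        using sdp_regret[OF m' k1 C QR Zf] by (simp add: X_def g_def p_def \<gamma>_def)
      then show "?A \<le> ?Z + ((real n - real m) + real N * \<gamma>\<^sup>2) / 2"
        by (intro half_bound)
    qed (use k1 Gpos in auto)
    also have "\<dots> = \<kappa> * (?Z / G) + \<kappa> * (((real n - real m) + real N * \<gamma>\<^sup>2) / 2 / G)"
      by (simp add: add_divide_distrib distrib_left)
    also have "?Z / G = (\<Sum>a\<in>B. l a)"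
      unfolding Zw[symmetric] by (simp add: w_def sum_divide_distrib)
    \<comment> \<open>The regret, divided by \<open>G \<ge> N \<gamma> / d^2\<close>. The iteration
      count makes the part from the initial distance \<open>d^2 / (8 C^2)\<close>, and the choice of
      \<open>\<gamma>\<close> makes the part from the step lengths
      \<open>d^2 / (2 C^2)\<close>.\<close>
    also have "\<kappa> * (((real n - real m) + real N * \<gamma>\<^sup>2) / 2 / G) \<le> d\<^sup>2 / C\<^sup>2"
    proof -
      have "((real n - real m) + real N * \<gamma>\<^sup>2) / 2 / G \<le> ((real n - real m) + real N * \<gamma>\<^sup>2) / 2 / (real N * (\<gamma> / d\<^sup>2))"
        using Gge Gpos N1 \<gamma> dpos m by (intro divide_left_mono mult_pos_pos) auto
      then have "\<kappa> * (((real n - real m) + real N * \<gamma>\<^sup>2) / 2 / G)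
        \<le> \<kappa> * (((real n - real m) + real N * \<gamma>\<^sup>2) / 2 / (real N * (\<gamma> / d\<^sup>2)))"
        using k1 by (intro mult_left_mono) auto
      also have "\<dots> = d\<^sup>2 * (\<kappa> * (real n - real m) / (2 * real N * \<gamma>) + \<kappa> * \<gamma> / 2)"
        using N1 \<gamma> dpos by (simp add: field_simps power2_eq_square)
      also have "\<dots> \<le> d\<^sup>2 * (1 / (8 * C\<^sup>2) + 1 / (2 * C\<^sup>2))"
      proof (intro mult_left_mono add_mono)
        have "\<kappa> * (real n - real m) / (2 * real N * \<gamma>) = (4 * (real n - real m) * C ^ 4 * \<kappa>\<^sup>2) / (8 * C\<^sup>2 * real N)"
          using k1 C N1 by (simp add: \<gamma>_def field_simps power2_eq_square power4_eq_xxxx)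
        also have "\<dots> \<le> real N / (8 * C\<^sup>2 * real N)"
          using Nge by (intro divide_right_mono) auto
        also have "\<dots> = 1 / (8 * C\<^sup>2)" using N1 by simp
        finally show "\<kappa> * (real n - real m) / (2 * real N * \<gamma>) \<le> 1 / (8 * C\<^sup>2)" .
        show "\<kappa> * \<gamma> / 2 \<le> 1 / (2 * C\<^sup>2)" using k1 by (simp add: \<gamma>_def)
      qed simp
      also have "\<dots> \<le> d\<^sup>2 * (1 / C\<^sup>2)"
        using C by (intro mult_left_mono) (auto simp: field_simps)
      finally show ?thesis by simp
    qed
    finally show ?thesis by simp
  qed
  have \<Sigma>eq: "(\<Sum>k<N. w k * (ip n (p k) x)\<^sup>2) = (\<Sum>a<n. l a * (ip n (col U a) x)\<^sup>2)" for x
    using \<Sigma>q[of x] by (simp add: U(2) quad_spec)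
  show ?thesis
  proof (rule that[of N w p U l B])
    show "\<And>k. k < N \<Longrightarrow> 0 \<le> w k \<and> p k \<in> K'" using w0 pK by simp
    show "\<And>a b. a \<in> B \<Longrightarrow> b \<in> {..<n} - B \<Longrightarrow> l a \<le> l b" using B(3) by simp
  qed (fact w1 U(1) \<Sigma>eq l0 B(1,2) bound Sf)+
qed

subsection \<open>Gauge and type 2 constant\<close>

lemma sets_Collect_mem:
  assumes "f \<in> measurable M N" "A \<in> sets N"
  shows "{x \<in> space M. f x \<in> A} \<in> sets M"
proof -
  have "{x \<in> space M. f x \<in> A} = f -` A \<inter> space M" by auto
  then show ?thesis using measurable_sets[OF assms] by simp
qed

section \<open>The gauge of a symmetric convex body\<close>

locale symmetric_body =
  fixes n :: nat and K :: "rvec set" and r R :: real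
  assumes n1: "1 \<le> n" and cb: "convex_body n K" and sym: "origin_symmetric K"
    and r0: "0 < r" and R0: "0 < R" and inner: "ecball n (\<lambda>_. 0) r \<subseteq> K" and outer: "K \<subseteq> ecball n (\<lambda>_. 0) R"
begin

lemma K_Rn: "x \<in> K \<Longrightarrow> x \<in> Rn n"
  using cb by (auto simp: convex_body_def)

lemma K_le: "x \<in> K \<Longrightarrow> enorm n x \<le> R"
  using outer by (auto simp: ecball_def)

lemma K_compact: "compact K"
  using cb by (simp add: convex_body_def)

lemma K_convex: "x \<in> K \<Longrightarrow> y \<in> K \<Longrightarrow> 0 \<le> t \<Longrightarrow> t \<le> 1 \<Longrightarrow> (\<lambda>i. (1 - t) * x i + t * y i) \<in> K"
  using cb unfolding convex_body_def by (meson atLeastAtMost_iff)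

lemma K_minus: "x \<in> K \<Longrightarrow> (\<lambda>i. - x i) \<in> K"
  using sym by (simp add: origin_symmetric_def)

lemma ball_mem: "x \<in> Rn n \<Longrightarrow> enorm n x \<le> r \<Longrightarrow> x \<in> K"
  using inner by (auto simp: ecball_def)

lemma zero_mem: "(\<lambda>_. 0) \<in> K"
  using ball_mem[of "\<lambda>_. 0"] r0 by (simp add: Rn_zero)

lemma K_shrink: "x \<in> K \<Longrightarrow> 0 \<le> t \<Longrightarrow> t \<le> 1 \<Longrightarrow> (\<lambda>i. t * x i) \<in> K"
  using K_convex[OF zero_mem, of x t] by simp

lemma K_half_diff: "x \<in> K \<Longrightarrow> y \<in> K \<Longrightarrow> (\<lambda>i. (x i - y i) / 2) \<in> K"
  using K_convex[OF _ K_minus, of x y "1/2"] by (simp add: field_simps)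

abbreviation gauge :: "rvec \<Rightarrow> real" where "gauge \<equiv> minkowski_gauge K"

lemma gauge_nonempty:
  assumes "x \<in> Rn n" and that: "0 < \<delta>"
  shows "\<exists>t. 0 < t \<and> (\<exists>y\<in>K. x = (\<lambda>i. t * y i)) \<and> t \<le> enorm n x / r + \<delta>"
proof -
  define t where "t = enorm n x / r + \<delta>"
  have t: "0 < t" using that r0 by (simp add: t_def add_nonneg_pos)
  have "enorm n x \<le> r * t" using r0 that by (simp add: t_def distrib_left)
  then have "enorm n (\<lambda>i. (1 / t) * x i) \<le> r" using t by (simp only: enorm_scale) (simp add: divide_le_eq)
  then have "(\<lambda>i. (1 / t) * x i) \<in> K" by (rule ball_mem[OF Rn_scale[OF assms(1)]])
  moreover have "x = (\<lambda>i. t * ((1 / t) * x i))" using t by simp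
  ultimately show ?thesis using t unfolding t_def[symmetric]
    by (intro exI[of _ t] conjI bexI[of _ "\<lambda>i. (1 / t) * x i"] order_refl)
qed

lemma gauge_set: "x \<in> Rn n \<Longrightarrow> {t. 0 < t \<and> (\<exists>y\<in>K. x = (\<lambda>i. t * y i))} \<noteq> {}"
  "bdd_below {t. 0 < t \<and> (\<exists>y\<in>K. x = (\<lambda>i. t * y i))}"
  using gauge_nonempty[of x 1] by (auto intro!: bdd_belowI[of _ 0])

lemma gauge_nonneg: "x \<in> Rn n \<Longrightarrow> 0 \<le> gauge x"
  unfolding minkowski_gauge_def
  by (rule cInf_greatest[OF gauge_set(1)]) auto

lemma gauge_le: "0 < t \<Longrightarrow> y \<in> K \<Longrightarrow> gauge (\<lambda>i. t * y i) \<le> t"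
  unfolding minkowski_gauge_def by (rule cInf_lower) (auto intro!: bdd_belowI[of _ 0])

lemma gauge_le_1: "y \<in> K \<Longrightarrow> gauge y \<le> 1"
  using gauge_le[of 1 y] by simp

text \<open>Rational \<open>q\<close> suffice because membership is monotone in \<open>q\<close>.
  Sublevel sets thus become countable unions, which is what measurability of the gauge
  needs.\<close>

lemma gauge_less_iff:
  assumes "x \<in> Rn n"
  shows "gauge x < t \<longleftrightarrow> (\<exists>q\<in>\<rat>. 0 < q \<and> q < t \<and> (\<lambda>i. (1 / q) * x i) \<in> K)"
proof
  assume "gauge x < t"
  then have "\<exists>s\<in>{t. 0 < t \<and> (\<exists>y\<in>K. x = (\<lambda>i. t * y i))}. s < t"
    unfolding minkowski_gauge_def cInf_less_iff[OF gauge_set(1)[OF assms] gauge_set(2)] .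
  then obtain s y where s: "0 < s" "s < t" and y: "y \<in> K" "x = (\<lambda>i. s * y i)"
    by (elim bexE CollectE conjE)
  obtain q where q: "q \<in> \<rat>" "s < q" "q < t" using Rats_dense_in_real[OF s(2)] by blast
  have "(\<lambda>i. (s / q) * y i) \<in> K" using s q by (intro K_shrink y) auto
  then have "(\<lambda>i. (1 / q) * x i) \<in> K" by (simp add: y(2))
  then show "\<exists>q\<in>\<rat>. 0 < q \<and> q < t \<and> (\<lambda>i. (1 / q) * x i) \<in> K" using q s by (intro bexI[of _ q]) auto
next
  assume "\<exists>q\<in>\<rat>. 0 < q \<and> q < t \<and> (\<lambda>i. (1 / q) * x i) \<in> K"
  then obtain q where q: "0 < q" "q < t" "(\<lambda>i. (1 / q) * x i) \<in> K" by blast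
  have "gauge (\<lambda>i. q * ((1 / q) * x i)) \<le> q" by (rule gauge_le[OF q(1,3)])
  moreover have "(\<lambda>i. q * ((1 / q) * x i)) = x" using q(1) by simp
  ultimately show "gauge x < t" using q by simp
qed

lemma gauge_lessD:
  assumes "x \<in> Rn n" "gauge x < t"
  shows "0 < t" "(\<lambda>i. (1 / t) * x i) \<in> K"
proof -
  obtain q where q: "0 < q" "q < t" "(\<lambda>i. (1 / q) * x i) \<in> K"
    using assms gauge_less_iff by blast
  then show "0 < t" by simp
  have "(\<lambda>i. (q / t) * ((1 / q) * x i)) \<in> K" by (rule K_shrink[OF q(3)]) (use q in auto)
  then show "(\<lambda>i. (1 / t) * x i) \<in> K" using q by simp
qed

lemma gauge_le_norm: "x \<in> Rn n \<Longrightarrow> gauge x \<le> enorm n x / r"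
proof (rule field_le_epsilon)
  fix \<delta> :: real assume x: "x \<in> Rn n" and "0 < \<delta>"
  from gauge_nonempty[OF this] obtain t y where "0 < t" "y \<in> K" "x = (\<lambda>i. t * y i)" "t \<le> enorm n x / r + \<delta>"
    by (elim exE conjE bexE)
  then show "gauge x \<le> enorm n x / r + \<delta>" using gauge_le[of t y] by simp
qed

lemma norm_le_gauge:
  assumes "x \<in> Rn n"
  shows "enorm n x \<le> R * gauge x"
proof -
  have "enorm n x / R \<le> gauge x"
  proof (rule ccontr)
    assume "\<not> ?thesis"
    then have "gauge x < enorm n x / R" by simp
    from gauge_lessD[OF assms this] have t: "0 < enorm n x / R" and "(\<lambda>i. (1 / (enorm n x / R)) * x i) \<in> K" .
    then obtain q where q: "0 < q" "q < enorm n x / R" "(\<lambda>i. (1 / q) * x i) \<in> K"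
      using gauge_less_iff[OF assms] \<open>gauge x < enorm n x / R\<close> by blast
    have "(1 / q) * enorm n x \<le> R" using K_le[OF q(3)] q(1) by (simp only: enorm_scale) simp
    then show False using q R0 by (simp add: field_simps)
  qed
  then show ?thesis using R0 by (simp add: divide_le_eq mult.commute)
qed

lemma gauge_scale_le:
  assumes x: "x \<in> Rn n"
  shows "gauge (\<lambda>i. a * x i) \<le> \<bar>a\<bar> * gauge x"
proof (cases "a = 0")
  case True
  then show ?thesis using gauge_le_norm[OF Rn_zero] by simp
next
  case False
  show ?thesis
  proof (rule field_le_epsilon)
    fix \<delta> :: real assume \<delta>: "0 < \<delta>"
    define t where "t = gauge x + \<delta> / \<bar>a\<bar>"
    have "gauge x < t" using \<delta> False by (simp add: t_def)
    note t = gauge_lessD[OF x this]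
    let ?y = "\<lambda>i. (1 / t) * x i"
    have "(\<lambda>i. sgn a * ?y i) \<in> K"
      using t(2) K_minus[OF t(2)] False by (cases "0 < a") (auto simp: sgn_if)
    then have "gauge (\<lambda>i. (\<bar>a\<bar> * t) * (sgn a * ?y i)) \<le> \<bar>a\<bar> * t"
      using t(1) False by (intro gauge_le) auto
    moreover have "(\<lambda>i. (\<bar>a\<bar> * t) * (sgn a * ?y i)) = (\<lambda>i. a * x i)"
    proof
      fix i
      have "(\<bar>a\<bar> * t) * (sgn a * ((1 / t) * x i)) = (sgn a * \<bar>a\<bar>) * x i" using t(1) by simp
      then show "(\<bar>a\<bar> * t) * (sgn a * ((1 / t) * x i)) = a * x i" by (simp only: sgn_mult_abs)
    qed
    ultimately have "gauge (\<lambda>i. a * x i) \<le> \<bar>a\<bar> * t" by simp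
    also have "\<dots> = \<bar>a\<bar> * gauge x + \<delta>" using False by (simp add: t_def distrib_left)
    finally show "gauge (\<lambda>i. a * x i) \<le> \<bar>a\<bar> * gauge x + \<delta>" .
  qed
qed

lemma K_closed: "closed K"
  using K_compact by (rule compact_imp_closed)

lemma measurable_gauge:
  assumes f: "f \<in> borel_measurable M" and fR: "\<And>x. x \<in> space M \<Longrightarrow> f x \<in> Rn n"
  shows "(\<lambda>x. gauge (f x)) \<in> borel_measurable M"
proof (subst borel_measurable_iff_less, intro allI)
  fix t
  have coord: "(\<lambda>x. f x i) \<in> borel_measurable M" for i
    using f by (rule measurable_product_then_coordinatewise)
  have "(\<lambda>x. (\<lambda>i. (1 / q) * f x i)) \<in> borel_measurable M" for q
    by (rule measurable_coordinatewise_then_product) (use coord in measurable)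
  moreover have "K \<in> sets borel" using K_closed by (rule borel_closed)
  ultimately have m: "{x \<in> space M. (\<lambda>i. (1 / q) * f x i) \<in> K} \<in> sets M" for q
    by (rule sets_Collect_mem)
  have "{x \<in> space M. gauge (f x) < t} = (\<Union>q\<in>{q\<in>\<rat>. 0 < q \<and> q < t}. {x \<in> space M. (\<lambda>i. (1 / q) * f x i) \<in> K})"
    using fR gauge_less_iff by auto
  also have "\<dots> \<in> sets M"
    by (rule sets.countable_UN'[OF countable_subset[OF _ countable_rat]]) (use m in auto)
  finally show "{x \<in> space M. gauge (f x) < t} \<in> sets M" .
qed

end

section \<open>Rademacher averages and the type 2 constant\<close>

lemma finite_set_rademacher_Pi: "finite (set_pmf (Pi_pmf {..<N::nat} 0 (\<lambda>_. rademacher)))"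
  by (simp add: set_Pi_pmf rademacher_def) (rule finite_PiE_dflt, auto)

lemma rademacher_sq:
  assumes "\<epsilon> \<in> set_pmf (Pi_pmf {..<N::nat} 0 (\<lambda>_. rademacher))" "k < N"
  shows "(\<epsilon> k)\<^sup>2 = 1"
  using assms by (auto simp: set_Pi_pmf rademacher_def PiE_dflt_def)

lemma parallelogram:
  "(enorm n (\<lambda>l. x l + y l))\<^sup>2 + (enorm n (\<lambda>l. x l - y l))\<^sup>2 = 2 * ((enorm n x)\<^sup>2 + (enorm n y)\<^sup>2)"
  by (simp add: enorm_sq ip_linear)

lemma rademacher_nn: "(\<integral>\<^sup>+y. f y \<partial>measure_pmf rademacher) = (f (-1) + f 1) / 2"
  by (simp add: rademacher_def nn_integral_pmf_of_set)

text \<open>Euclidean space has type 2 with constant 1, even with equality: the parallelogram law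
  removes one sign at a time.\<close>

lemma rademacher_norm_nn:
  fixes x :: "nat \<Rightarrow> rvec" and N :: nat
  shows "(\<integral>\<^sup>+\<epsilon>. ennreal ((enorm n (\<lambda>l. \<Sum>i<N. \<epsilon> i * x i l))\<^sup>2) \<partial>measure_pmf (Pi_pmf {..<N} 0 (\<lambda>_. rademacher)))
    = ennreal (\<Sum>i<N. (enorm n (x i))\<^sup>2)"
proof (induction N)
  case 0
  then show ?case by simp
next
  case (Suc N)
  let ?S = "\<lambda>\<epsilon> l. \<Sum>i<N. \<epsilon> i * x i l"
  let ?P = "Pi_pmf {..<N} 0 (\<lambda>_. rademacher)"
  have 1: "{..<Suc N} = insert N {..<N}" by auto
  have 2: "(\<lambda>l. \<Sum>i\<in>insert N {..<N}. (\<epsilon>(N := y)) i * x i l) = (\<lambda>l. ?S \<epsilon> l + y * x N l)" for \<epsilon> y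
    by (simp add: fun_eq_iff add.commute)
  have "(\<integral>\<^sup>+\<epsilon>. ennreal ((enorm n (\<lambda>l. \<Sum>i<Suc N. \<epsilon> i * x i l))\<^sup>2) \<partial>measure_pmf (Pi_pmf {..<Suc N} 0 (\<lambda>_. rademacher)))
     = (\<integral>\<^sup>+y. \<integral>\<^sup>+\<epsilon>. ennreal ((enorm n (\<lambda>l. ?S \<epsilon> l + y * x N l))\<^sup>2) \<partial>measure_pmf ?P \<partial>measure_pmf rademacher)"
    unfolding 1 by (subst Pi_pmf_insert) (simp_all add: nn_integral_pair_pmf' case_prod_unfold 2 del: sum.insert fun_upd_apply)
  also have "\<dots> = (\<integral>\<^sup>+\<epsilon>. \<integral>\<^sup>+y. ennreal ((enorm n (\<lambda>l. ?S \<epsilon> l + y * x N l))\<^sup>2) \<partial>measure_pmf rademacher \<partial>measure_pmf ?P)"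
    unfolding rademacher_nn by (simp add: nn_integral_add nn_integral_divide)
  also have "\<dots> = (\<integral>\<^sup>+\<epsilon>. ennreal ((enorm n (?S \<epsilon>))\<^sup>2) + ennreal ((enorm n (x N))\<^sup>2) \<partial>measure_pmf ?P)"
  proof (rule nn_integral_cong)
    fix \<epsilon>
    have "(\<integral>\<^sup>+y. ennreal ((enorm n (\<lambda>l. ?S \<epsilon> l + y * x N l))\<^sup>2) \<partial>measure_pmf rademacher)
      = ennreal (((enorm n (\<lambda>l. ?S \<epsilon> l - x N l))\<^sup>2 + (enorm n (\<lambda>l. ?S \<epsilon> l + x N l))\<^sup>2) / 2)"
      unfolding rademacher_nn by (simp add: ennreal_plus[symmetric] divide_ennreal[symmetric] del: ennreal_plus)
    also have "((enorm n (\<lambda>l. ?S \<epsilon> l - x N l))\<^sup>2 + (enorm n (\<lambda>l. ?S \<epsilon> l + x N l))\<^sup>2) / 2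
      = (enorm n (?S \<epsilon>))\<^sup>2 + (enorm n (x N))\<^sup>2"
      using parallelogram[of n "?S \<epsilon>" "x N"] by simp
    finally show "(\<integral>\<^sup>+y. ennreal ((enorm n (\<lambda>l. ?S \<epsilon> l + y * x N l))\<^sup>2) \<partial>measure_pmf rademacher)
      = ennreal ((enorm n (?S \<epsilon>))\<^sup>2) + ennreal ((enorm n (x N))\<^sup>2)" by simp
  qed
  also have "\<dots> = ennreal (\<Sum>i<N. (enorm n (x i))\<^sup>2) + ennreal ((enorm n (x N))\<^sup>2)"
    by (simp add: nn_integral_add Suc)
  also have "\<dots> = ennreal (\<Sum>i<Suc N. (enorm n (x i))\<^sup>2)"
    by (simp add: sum_nonneg)
  finally show ?case .
qed

context symmetric_body
begin

lemma type2_nn: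
  fixes N :: nat
  assumes T: "type2_bound n K T" and x: "\<And>i. i < N \<Longrightarrow> x i \<in> Rn n"
  shows "(\<integral>\<^sup>+\<epsilon>. ennreal ((gauge (\<lambda>l. \<Sum>i<N. \<epsilon> i * x i l))\<^sup>2) \<partial>measure_pmf (Pi_pmf {..<N} 0 (\<lambda>_. rademacher)))
    \<le> ennreal (T\<^sup>2 * (\<Sum>i<N. (gauge (x i))\<^sup>2))"
proof -
  have "(\<integral>\<^sup>+\<epsilon>. ennreal ((gauge (\<lambda>l. \<Sum>i<N. \<epsilon> i * x i l))\<^sup>2) \<partial>measure_pmf (Pi_pmf {..<N} 0 (\<lambda>_. rademacher)))
    = ennreal (measure_pmf.expectation (Pi_pmf {..<N} 0 (\<lambda>_. rademacher)) (\<lambda>\<epsilon>. (gauge (\<lambda>l. \<Sum>i<N. \<epsilon> i * x i l))\<^sup>2))"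
    by (rule nn_integral_eq_integral) (auto intro!: integrable_measure_pmf_finite finite_set_rademacher_Pi)
  also have "\<dots> \<le> ennreal (T\<^sup>2 * (\<Sum>i<N. (gauge (x i))\<^sup>2))"
    using T x unfolding type2_bound_def by (intro ennreal_leI) blast
  finally show ?thesis .
qed

text \<open>Comparison of the gauge with the Euclidean norm,
  \<open>enorm / R \<le> gauge \<le> enorm / r\<close>. It makes the infimum in \<open>T2\<close>
  one over a nonempty set.\<close>

lemma type2_exists: "type2_bound n K (max 1 (R / r))"
  unfolding type2_bound_def
proof (intro allI impI)
  fix N :: nat and x :: "nat \<Rightarrow> rvec" assume x: "\<forall>i<N. x i \<in> Rn n"
  let ?P = "Pi_pmf {..<N} 0 (\<lambda>_. rademacher)"
  let ?S = "\<lambda>\<epsilon> l. \<Sum>i<N. \<epsilon> i * x i l"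
  have SR: "?S \<epsilon> \<in> Rn n" for \<epsilon> using x by (intro Rn_sum Rn_scale) auto
  have int: "integrable (measure_pmf ?P) f" for f :: "_ \<Rightarrow> real"
    by (rule integrable_measure_pmf_finite[OF finite_set_rademacher_Pi])
  have "measure_pmf.expectation ?P (\<lambda>\<epsilon>. (gauge (?S \<epsilon>))\<^sup>2) \<le> measure_pmf.expectation ?P (\<lambda>\<epsilon>. (1 / r\<^sup>2) * (enorm n (?S \<epsilon>))\<^sup>2)"
  proof (rule integral_mono[OF int int])
    fix \<epsilon>
    have "(gauge (?S \<epsilon>))\<^sup>2 \<le> (enorm n (?S \<epsilon>) / r)\<^sup>2"
      by (intro power_mono gauge_le_norm gauge_nonneg SR)
    then show "(gauge (?S \<epsilon>))\<^sup>2 \<le> (1 / r\<^sup>2) * (enorm n (?S \<epsilon>))\<^sup>2" by (simp add: power_divide)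
  qed
  also have "\<dots> = (1 / r\<^sup>2) * measure_pmf.expectation ?P (\<lambda>\<epsilon>. (enorm n (?S \<epsilon>))\<^sup>2)" by simp
  also have "measure_pmf.expectation ?P (\<lambda>\<epsilon>. (enorm n (?S \<epsilon>))\<^sup>2) = (\<Sum>i<N. (enorm n (x i))\<^sup>2)"
  proof -
    have "ennreal (measure_pmf.expectation ?P (\<lambda>\<epsilon>. (enorm n (?S \<epsilon>))\<^sup>2)) = ennreal (\<Sum>i<N. (enorm n (x i))\<^sup>2)"
      unfolding rademacher_norm_nn[symmetric] by (rule nn_integral_eq_integral[symmetric, OF int]) simp
    then show ?thesis by (subst (asm) ennreal_inj) (auto intro!: sum_nonneg integral_nonneg_AE)
  qed
  also have "(1 / r\<^sup>2) * (\<Sum>i<N. (enorm n (x i))\<^sup>2) \<le> (1 / r\<^sup>2) * (\<Sum>i<N. R\<^sup>2 * (gauge (x i))\<^sup>2)"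
  proof (intro mult_left_mono sum_mono)
    fix i assume "i \<in> {..<N}"
    then have "(enorm n (x i))\<^sup>2 \<le> (R * gauge (x i))\<^sup>2" using x by (intro power_mono norm_le_gauge) auto
    then show "(enorm n (x i))\<^sup>2 \<le> R\<^sup>2 * (gauge (x i))\<^sup>2" by (simp add: power_mult_distrib)
  qed simp
  also have "\<dots> = (R / r)\<^sup>2 * (\<Sum>i<N. (gauge (x i))\<^sup>2)" by (simp add: sum_distrib_left power_divide)
  also have "\<dots> \<le> (max 1 (R / r))\<^sup>2 * (\<Sum>i<N. (gauge (x i))\<^sup>2)"
    using r0 R0 by (intro mult_right_mono power_mono sum_nonneg) auto
  finally show "measure_pmf.expectation ?P (\<lambda>\<epsilon>. (gauge (?S \<epsilon>))\<^sup>2) \<le> (max 1 (R / r))\<^sup>2 * (\<Sum>i<N. (gauge (x i))\<^sup>2)" .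
qed

lemma T2_ge_1: "1 \<le> T2 n K"
  unfolding T2_def by (rule cInf_greatest) (use type2_exists in \<open>auto intro!: exI[of _ "max 1 (R / r)"]\<close>)

text \<open>Twice the infimum is admissible without a proof that the infimum is attained; the factor
  2 is absorbed by the constants.\<close>

lemma type2_twice: "type2_bound n K (2 * T2 n K)"
proof -
  have "T2 n K < 2 * T2 n K" using T2_ge_1 by simp
  then obtain T where T: "1 \<le> T" "type2_bound n K T" "T < 2 * T2 n K"
    unfolding T2_def by (subst (asm) cInf_less_iff)
      (use type2_exists in \<open>auto intro!: exI[of _ "max 1 (R / r)"] bdd_belowI[of _ 1]\<close>)
  show ?thesis
    unfolding type2_bound_def
  proof (intro allI impI)
    fix N :: nat and x :: "nat \<Rightarrow> rvec" assume x: "\<forall>i<N. x i \<in> Rn n"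
    have "measure_pmf.expectation (Pi_pmf {..<N} 0 (\<lambda>_. rademacher)) (\<lambda>\<epsilon>. (gauge (\<lambda>l. \<Sum>i<N. \<epsilon> i * x i l))\<^sup>2)
       \<le> T\<^sup>2 * (\<Sum>i<N. (gauge (x i))\<^sup>2)"
      using T(2) x unfolding type2_bound_def by blast
    also have "\<dots> \<le> (2 * T2 n K)\<^sup>2 * (\<Sum>i<N. (gauge (x i))\<^sup>2)"
      using T by (intro mult_right_mono power_mono sum_nonneg) auto
    finally show "measure_pmf.expectation (Pi_pmf {..<N} 0 (\<lambda>_. rademacher)) (\<lambda>\<epsilon>. (gauge (\<lambda>l. \<Sum>i<N. \<epsilon> i * x i l))\<^sup>2)
       \<le> (2 * T2 n K)\<^sup>2 * (\<Sum>i<N. (gauge (x i))\<^sup>2)" .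
  qed
qed

end

lemma GN_second_moment:
  assumes "k < N"
  shows "(\<integral>\<^sup>+g. ennreal ((g k)\<^sup>2) \<partial>GN N) = 1"
proof -
  have "(\<integral>\<^sup>+g. ennreal ((g k)\<^sup>2) \<partial>GN N) = (\<integral>\<^sup>+x. ennreal (x\<^sup>2) \<partial>distr (GN N) gs (\<lambda>g. g k))"
    using assms by (subst nn_integral_distr) auto
  also have "distr (GN N) gs (\<lambda>g. g k) = gs"
    by (rule distr_PiM_component) (use assms prob_space_gs in auto)
  also have "(\<integral>\<^sup>+x. ennreal (x\<^sup>2) \<partial>gs) = (\<integral>\<^sup>+x. ennreal (std_normal_density x * x\<^sup>2) \<partial>lborel)"
    by (subst nn_integral_density) (auto simp: ennreal_mult)
  also have "\<dots> = ennreal (LINT x|lborel. std_normal_density x * x ^ (2 * 1))"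
    using integrable_std_normal_moment[of 2] by (subst nn_integral_eq_integral) auto
  also have "\<dots> = 1" unfolding integral_std_normal_moment_even by simp
  finally show ?thesis .
qed

context symmetric_body
begin

text \<open>The type 2 inequality holds on average over signs; one sign vector that attains the average suffices,
  since the small ball estimate holds for all of them.\<close>

lemma gaussian_type2:
  fixes N :: nat and w :: "nat \<Rightarrow> real" and p :: "nat \<Rightarrow> rvec"
  assumes T: "type2_bound n K T" "1 \<le> T" and D: "0 < D"
    and w: "\<forall>k<N. 0 \<le> w k" "(\<Sum>k<N. w k) = 1"
    and p: "\<forall>k<N. p k \<in> K" "\<forall>k<N. enorm n (p k) \<le> D"
  obtains \<epsilon> :: "nat \<Rightarrow> real" where "\<forall>k<N. (\<epsilon> k)\<^sup>2 = 1"
    "1 / 2 \<le> measure (GN N) {g \<in> space (GN N).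
        (\<lambda>l. (1 / (2 * T)) * (\<Sum>k<N. g k * (\<epsilon> k * (sqrt (w k) * p k l)))) \<in> K \<and>
        enorm n (\<lambda>l. \<Sum>k<N. g k * (\<epsilon> k * (sqrt (w k) * p k l))) \<le> 2 * D}"
proof -
  interpret G: prob_space "GN N" by (rule prob_space_GN)
  note w = w(1)[rule_format] w(2) and p = p(1)[rule_format] p(2)[rule_format]
  let ?P = "Pi_pmf {..<N} 0 (\<lambda>_. rademacher)"
  let ?z = "\<lambda>\<epsilon> g l. \<Sum>k<N. g k * (\<epsilon> k * (sqrt (w k) * p k l))"
  \<comment> \<open>Two second moments, each normalized to have mean at most 1. Markov at level 4
    for their sum gives gauge at most \<open>2 T\<close> and norm at most \<open>2 D\<close>
    simultaneously, with probability at least 1/2.\<close>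
  let ?\<Psi> = "\<lambda>\<epsilon> g. ennreal ((gauge (?z \<epsilon> g))\<^sup>2) / ennreal (T\<^sup>2) + ennreal ((enorm n (?z \<epsilon> g))\<^sup>2) / ennreal (D\<^sup>2)"
  have pR: "p k \<in> Rn n" if "k < N" for k using p(1)[OF that] by (rule K_Rn)
  have zR: "?z \<epsilon> g \<in> Rn n" for \<epsilon> g using pR by (intro Rn_sum Rn_scale) auto
  have zm: "?z \<epsilon> \<in> borel_measurable (GN N)" for \<epsilon>
    by (rule measurable_coordinatewise_then_product) measurable
  have gm: "(\<lambda>g. gauge (?z \<epsilon> g)) \<in> borel_measurable (GN N)" for \<epsilon>
    by (rule measurable_gauge[OF zm zR])
  have em: "(\<lambda>g. enorm n (?z \<epsilon> g)) \<in> borel_measurable (GN N)" for \<epsilon>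
    unfolding enorm_eq_sqrt ip_def by measurable
  have \<Psi>m: "?\<Psi> \<epsilon> \<in> borel_measurable (GN N)" for \<epsilon>
    using gm[of \<epsilon>] em[of \<epsilon>] by measurable
  have avg: "(\<integral>\<^sup>+\<epsilon>. ?\<Psi> \<epsilon> g \<partial>measure_pmf ?P) \<le> ennreal (2 * (\<Sum>k<N. w k * (g k)\<^sup>2))" for g
  proof -
    define y where "y = (\<lambda>k l. (g k * sqrt (w k)) * p k l)"
    have yR: "y k \<in> Rn n" if "k < N" for k unfolding y_def using pR[OF that] by (rule Rn_scale)
    have zy: "?z \<epsilon> g = (\<lambda>l. \<Sum>k<N. \<epsilon> k * y k l)" for \<epsilon> by (simp add: y_def mult_ac)
    have gy: "(gauge (y k))\<^sup>2 \<le> w k * (g k)\<^sup>2" if "k < N" for k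
    proof -
      have "gauge (y k) \<le> \<bar>g k * sqrt (w k)\<bar> * gauge (p k)" unfolding y_def by (rule gauge_scale_le[OF pR[OF that]])
      also have "\<dots> \<le> \<bar>g k * sqrt (w k)\<bar> * 1" by (intro mult_left_mono gauge_le_1 p that) simp
      finally have "(gauge (y k))\<^sup>2 \<le> \<bar>g k * sqrt (w k)\<bar>\<^sup>2" by (intro power_mono gauge_nonneg yR that) simp
      then show ?thesis using w(1)[OF that] by (simp add: power_mult_distrib mult.commute)
    qed
    have ny: "(enorm n (y k))\<^sup>2 \<le> D\<^sup>2 * (w k * (g k)\<^sup>2)" if "k < N" for k
    proof -
      have "enorm n (y k) \<le> \<bar>g k * sqrt (w k)\<bar> * D"
        unfolding y_def enorm_scale by (intro mult_left_mono p that) simp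
      then have "(enorm n (y k))\<^sup>2 \<le> (\<bar>g k * sqrt (w k)\<bar> * D)\<^sup>2" by (intro power_mono) simp_all
      then show ?thesis using w(1)[OF that] by (simp add: power_mult_distrib mult_ac)
    qed
    have "(\<integral>\<^sup>+\<epsilon>. ?\<Psi> \<epsilon> g \<partial>measure_pmf ?P)
      = (\<integral>\<^sup>+\<epsilon>. ennreal ((gauge (\<lambda>l. \<Sum>k<N. \<epsilon> k * y k l))\<^sup>2) \<partial>measure_pmf ?P) / ennreal (T\<^sup>2)
       + (\<integral>\<^sup>+\<epsilon>. ennreal ((enorm n (\<lambda>l. \<Sum>k<N. \<epsilon> k * y k l))\<^sup>2) \<partial>measure_pmf ?P) / ennreal (D\<^sup>2)"
      by (simp only: zy) (simp add: nn_integral_add nn_integral_divide)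
    also have "\<dots> \<le> ennreal (T\<^sup>2 * (\<Sum>k<N. (gauge (y k))\<^sup>2)) / ennreal (T\<^sup>2) + ennreal (\<Sum>k<N. (enorm n (y k))\<^sup>2) / ennreal (D\<^sup>2)"
      unfolding rademacher_norm_nn
      by (intro add_mono divide_right_mono_ennreal type2_nn[OF T(1)] yR) auto
    also have "\<dots> = ennreal ((\<Sum>k<N. (gauge (y k))\<^sup>2) + (\<Sum>k<N. (enorm n (y k))\<^sup>2) / D\<^sup>2)"
      using T(2) D by (simp add: divide_ennreal sum_nonneg flip: ennreal_plus)
    also have "\<dots> \<le> ennreal ((\<Sum>k<N. w k * (g k)\<^sup>2) + (\<Sum>k<N. D\<^sup>2 * (w k * (g k)\<^sup>2)) / D\<^sup>2)"
      by (intro ennreal_leI add_mono divide_right_mono sum_mono gy ny) auto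
    also have "\<dots> = ennreal (2 * (\<Sum>k<N. w k * (g k)\<^sup>2))"
      using D by (simp flip: sum_distrib_left)
    finally show ?thesis .
  qed
  have swap: "(\<integral>\<^sup>+\<epsilon>. (\<integral>\<^sup>+g. ?\<Psi> \<epsilon> g \<partial>GN N) \<partial>measure_pmf ?P) = (\<integral>\<^sup>+g. (\<integral>\<^sup>+\<epsilon>. ?\<Psi> \<epsilon> g \<partial>measure_pmf ?P) \<partial>GN N)"
    unfolding nn_integral_measure_pmf_finite[OF finite_set_rademacher_Pi zero_le]
    by (subst nn_integral_sum) (use \<Psi>m in \<open>auto simp: nn_integral_multc\<close>)
  have two: "(\<integral>\<^sup>+\<epsilon>. (\<integral>\<^sup>+g. ?\<Psi> \<epsilon> g \<partial>GN N) \<partial>measure_pmf ?P) \<le> 2"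
  proof -
    have "(\<integral>\<^sup>+\<epsilon>. (\<integral>\<^sup>+g. ?\<Psi> \<epsilon> g \<partial>GN N) \<partial>measure_pmf ?P) \<le> (\<integral>\<^sup>+g. ennreal (2 * (\<Sum>k<N. w k * (g k)\<^sup>2)) \<partial>GN N)"
      unfolding swap by (intro nn_integral_mono avg)
    also have "\<dots> = (\<integral>\<^sup>+g. (\<Sum>k<N. ennreal (2 * w k) * ennreal ((g k)\<^sup>2)) \<partial>GN N)"
    proof (rule nn_integral_cong)
      fix g :: rvec
      have "(\<Sum>k<N. ennreal (2 * w k) * ennreal ((g k)\<^sup>2)) = (\<Sum>k<N. ennreal (2 * w k * (g k)\<^sup>2))"
        by (intro sum.cong refl) (simp add: ennreal_mult w)
      also have "\<dots> = ennreal (\<Sum>k<N. 2 * w k * (g k)\<^sup>2)" by (rule sum_ennreal) (simp add: w)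
      finally show "ennreal (2 * (\<Sum>k<N. w k * (g k)\<^sup>2)) = (\<Sum>k<N. ennreal (2 * w k) * ennreal ((g k)\<^sup>2))"
        by (simp add: sum_distrib_left mult.assoc)
    qed
    also have "\<dots> = (\<Sum>k<N. \<integral>\<^sup>+g. ennreal (2 * w k) * ennreal ((g k)\<^sup>2) \<partial>GN N)"
      by (rule nn_integral_sum) measurable
    also have "\<dots> = (\<Sum>k<N. ennreal (2 * w k))"
      by (intro sum.cong refl, subst nn_integral_cmult) (measurable, simp add: GN_second_moment)
    also have "\<dots> = ennreal (\<Sum>k<N. 2 * w k)" by (rule sum_ennreal) (simp add: w)
    also have "(\<Sum>k<N. 2 * w k) = 2" using w(2) by (simp flip: sum_distrib_left)
    finally show ?thesis by simp
  qed
  \<comment> \<open>There are finitely many sign vectors, so one of them does not exceed the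
    average.\<close>
  have "\<exists>\<epsilon>\<in>set_pmf ?P. (\<integral>\<^sup>+g. ?\<Psi> \<epsilon> g \<partial>GN N) \<le> 2"
  proof (rule ccontr)
    assume no: "\<not> ?thesis"
    let ?V = "(\<lambda>\<epsilon>. \<integral>\<^sup>+g. ?\<Psi> \<epsilon> g \<partial>GN N) ` set_pmf ?P"
    have fin: "finite ?V" "?V \<noteq> {}" using finite_set_rademacher_Pi set_pmf_not_empty by auto
    have "2 < Min ?V" using fin no by (auto simp: not_le)
    also have "Min ?V = (\<integral>\<^sup>+\<epsilon>. Min ?V \<partial>measure_pmf ?P)" by simp
    also have "\<dots> \<le> (\<integral>\<^sup>+\<epsilon>. (\<integral>\<^sup>+g. ?\<Psi> \<epsilon> g \<partial>GN N) \<partial>measure_pmf ?P)"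
      using fin by (intro nn_integral_mono_AE AE_pmfI Min_le) auto
    finally show False using two by simp
  qed
  then obtain \<epsilon> where \<epsilon>: "\<epsilon> \<in> set_pmf ?P" "(\<integral>\<^sup>+g. ?\<Psi> \<epsilon> g \<partial>GN N) \<le> 2" by blast
  let ?bad = "{g \<in> space (GN N). 1 \<le> ennreal (1 / 4) * ?\<Psi> \<epsilon> g}"
  let ?good = "{g \<in> space (GN N). (\<lambda>l. (1 / (2 * T)) * ?z \<epsilon> g l) \<in> K \<and> enorm n (?z \<epsilon> g) \<le> 2 * D}"
  have bm: "?bad \<in> sets (GN N)" using \<Psi>m[of \<epsilon>] by measurable
  have "emeasure (GN N) ?bad \<le> ennreal (1 / 4) * (\<integral>\<^sup>+g. ?\<Psi> \<epsilon> g * indicator (space (GN N)) g \<partial>GN N)"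
    by (rule nn_integral_Markov_inequality) (use \<Psi>m[of \<epsilon>] in measurable)
  also have "(\<integral>\<^sup>+g. ?\<Psi> \<epsilon> g * indicator (space (GN N)) g \<partial>GN N) = (\<integral>\<^sup>+g. ?\<Psi> \<epsilon> g \<partial>GN N)"
    by (rule nn_integral_cong) simp
  also have "ennreal (1 / 4) * (\<integral>\<^sup>+g. ?\<Psi> \<epsilon> g \<partial>GN N) \<le> ennreal (1 / 4) * 2" by (intro mult_left_mono \<epsilon>) simp
  also have "\<dots> = ennreal (1 / 2)" by (simp flip: ennreal_numeral ennreal_mult)
  finally have le: "emeasure (GN N) ?bad \<le> ennreal (1 / 2)" .
  have "measure (GN N) ?bad \<le> 1 / 2"
    unfolding measure_def by (rule enn2real_leI[OF _ le]) simp
  moreover have gm': "?good \<in> sets (GN N)"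
  proof -
    have "(\<lambda>g. (\<lambda>l. (1 / (2 * T)) * ?z \<epsilon> g l)) \<in> borel_measurable (GN N)"
      by (rule measurable_coordinatewise_then_product) measurable
    moreover have "K \<in> sets borel" using K_closed by (rule borel_closed)
    ultimately have "{g \<in> space (GN N). (\<lambda>l. (1 / (2 * T)) * ?z \<epsilon> g l) \<in> K} \<in> sets (GN N)"
      by (rule sets_Collect_mem)
    moreover have "{g \<in> space (GN N). enorm n (?z \<epsilon> g) \<le> 2 * D} \<in> sets (GN N)" using em[of \<epsilon>] by measurable
    moreover have "?good = {g \<in> space (GN N). (\<lambda>l. (1 / (2 * T)) * ?z \<epsilon> g l) \<in> K} \<inter> {g \<in> space (GN N). enorm n (?z \<epsilon> g) \<le> 2 * D}"
      by (intro set_eqI iffI IntI CollectI conjI; elim IntE CollectE conjE; assumption)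
    ultimately show ?thesis by (simp only: sets.Int)
  qed
  moreover have "space (GN N) - ?bad \<subseteq> ?good"
  proof
    fix g assume g: "g \<in> space (GN N) - ?bad"
    have "ennreal (1 / 4) * ?\<Psi> \<epsilon> g = ennreal ((gauge (?z \<epsilon> g))\<^sup>2 / (4 * T\<^sup>2) + (enorm n (?z \<epsilon> g))\<^sup>2 / (4 * D\<^sup>2))"
      using T(2) D by (simp add: divide_ennreal distrib_left flip: ennreal_mult ennreal_plus)
    note eq = this
    have "ennreal (1 / 4) * ?\<Psi> \<epsilon> g < 1"
      using g by (auto simp only: Diff_iff mem_Collect_eq not_le)
    then have lt: "(gauge (?z \<epsilon> g))\<^sup>2 / (4 * T\<^sup>2) + (enorm n (?z \<epsilon> g))\<^sup>2 / (4 * D\<^sup>2) < 1"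
      unfolding eq ennreal_1[symmetric] by (subst (asm) ennreal_less_iff) simp_all
    have nn: "0 \<le> (gauge (?z \<epsilon> g))\<^sup>2 / (4 * T\<^sup>2)" "0 \<le> (enorm n (?z \<epsilon> g))\<^sup>2 / (4 * D\<^sup>2)" by auto
    have "(gauge (?z \<epsilon> g))\<^sup>2 / (4 * T\<^sup>2) < 1" "(enorm n (?z \<epsilon> g))\<^sup>2 / (4 * D\<^sup>2) < 1" using lt nn by linarith+
    then have "(gauge (?z \<epsilon> g))\<^sup>2 < (2 * T)\<^sup>2" "(enorm n (?z \<epsilon> g))\<^sup>2 < (2 * D)\<^sup>2"
      using T(2) D by (auto simp: power_mult_distrib)
    then have "gauge (?z \<epsilon> g) < 2 * T" "enorm n (?z \<epsilon> g) < 2 * D"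
      using T(2) D by (auto intro: power2_less_imp_less)
    then have "(\<lambda>l. (1 / (2 * T)) * ?z \<epsilon> g l) \<in> K" "enorm n (?z \<epsilon> g) \<le> 2 * D"
      by - (rule gauge_lessD(2)[OF zR], simp_all)
    then show "g \<in> ?good" using g by (intro CollectI conjI) (auto simp only: Diff_iff)
  qed
  then have "measure (GN N) (space (GN N) - ?bad) \<le> measure (GN N) ?good"
    by (rule G.finite_measure_mono[OF _ gm'])
  ultimately have "1 / 2 \<le> measure (GN N) ?good"
    using G.prob_compl[OF bm] by linarith
  moreover have "\<forall>k<N. (\<epsilon> k)\<^sup>2 = 1" using rademacher_sq[OF \<epsilon>(1)] by simp
  ultimately show ?thesis by (intro that)
qed

text \<open>The Gaussian vector of \<open>gaussian_type2\<close>, scaled by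
  \<open>1 / (2 T)\<close>, lands in the covered part of \<open>K\<close> with probability at least
  1/2. By \<open>gauss_small_ball\<close> a single covering ball receives at most
  \<open>(1 / sqrt 2)^m\<close> of the mass, so the union bound forces many balls.\<close>

lemma covering_lower:
  fixes N m :: nat and w :: "nat \<Rightarrow> real" and p :: "nat \<Rightarrow> rvec"
  assumes T: "type2_bound n K T" "1 \<le> T" and D: "0 < D"
    and w: "\<And>k. k < N \<Longrightarrow> 0 \<le> w k" "(\<Sum>k<N. w k) = 1"
    and p: "\<And>k. k < N \<Longrightarrow> p k \<in> K" "\<And>k. k < N \<Longrightarrow> enorm n (p k) \<le> D"
    and U: "orthogonal_mat n U"
    and cov: "\<And>x. (\<Sum>k<N. w k * (ip n (p k) x)\<^sup>2) = (\<Sum>a<n. l a * (ip n (col U a) x)\<^sup>2)"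
    and l: "\<And>a. a < n \<Longrightarrow> 0 \<le> l a" and B: "B \<subseteq> {..<n}" "card B = n - m" "m \<le> n"
    and lB: "\<And>a b. a \<in> B \<Longrightarrow> b \<in> {..<n} - B \<Longrightarrow> l a \<le> l b"
    and pos: "0 < (\<Sum>a\<in>B. l a)" and s: "0 \<le> s" "(2 * T * s)\<^sup>2 \<le> (\<Sum>a\<in>B. l a) / 2"
    and A: "finite A" "A \<subseteq> Rn n"
    and cover: "\<And>z. z \<in> K \<Longrightarrow> enorm n z \<le> D / T \<Longrightarrow> \<exists>a\<in>A. edist n z a \<le> s"
  shows "1 / 2 \<le> real (card A) * (1 / sqrt 2) ^ m"
proof -
  interpret G: prob_space "GN N" by (rule prob_space_GN)
  let ?Z = "\<lambda>\<epsilon> g l. \<Sum>k<N. g k * (\<epsilon> k * (sqrt (w k) * p k l))"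
  have w': "\<forall>k<N. 0 \<le> w k" and p': "\<forall>k<N. p k \<in> K" "\<forall>k<N. enorm n (p k) \<le> D"
    using w(1) p by simp_all
  obtain \<epsilon> :: "nat \<Rightarrow> real" where \<epsilon>: "\<forall>k<N. (\<epsilon> k)\<^sup>2 = 1"
    and half: "1 / 2 \<le> measure (GN N) {g \<in> space (GN N). (\<lambda>l. (1 / (2 * T)) * ?Z \<epsilon> g l) \<in> K \<and> enorm n (?Z \<epsilon> g) \<le> 2 * D}"
    using gaussian_type2[OF T D w' w(2) p'] .
  let ?z = "?Z \<epsilon>"
  define c where "c = (\<lambda>a k. \<epsilon> k * (sqrt (w k) * ip n (col U a) (p k)))"
  have zR: "?z g \<in> Rn n" for g using p(1) K_Rn by (intro Rn_sum Rn_scale) auto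
  \<comment> \<open>The signs disappear from the covariance because their squares are 1; its
    eigenbasis and eigenvalues are those of the weighted sum.\<close>
  have cov': "(\<Sum>k<N. (\<Sum>a<n. h a * c a k)\<^sup>2) = (\<Sum>a<n. l a * (h a)\<^sup>2)" for h
  proof -
    define x where "x = (\<lambda>i. \<Sum>a<n. h a * U i a)"
    have ix: "ip n x q = (\<Sum>a<n. h a * ip n (col U a) q)" for q
      unfolding x_def by (simp only: ip_sum_left ip_scale_left)
    have cx: "ip n (col U a) x = h a" if "a < n" for a
    proof -
      have "ip n x (col U a) = (\<Sum>b<n. h b * (if b = a then 1 else 0))"
        unfolding ix by (intro sum.cong refl) (simp add: col_orthonormal[OF U] that)
      also have "\<dots> = h a" using that by (simp add: if_distrib[of "\<lambda>t. _ * t"] cong: if_cong)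
      finally show ?thesis by (simp only: ip_commute[of n "col U a"])
    qed
    have "(\<Sum>k<N. (\<Sum>a<n. h a * c a k)\<^sup>2) = (\<Sum>k<N. w k * (ip n (p k) x)\<^sup>2)"
    proof (intro sum.cong refl)
      fix k assume "k \<in> {..<N}"
      then have k: "k < N" by simp
      have "(\<Sum>a<n. h a * c a k) = \<epsilon> k * (sqrt (w k) * ip n x (p k))"
        unfolding ix by (simp add: c_def sum_distrib_left mult_ac)
      then show "(\<Sum>a<n. h a * c a k)\<^sup>2 = w k * (ip n (p k) x)\<^sup>2"
        using \<epsilon>[rule_format, OF k] w(1)[OF k] by (simp add: power_mult_distrib ip_commute)
    qed
    also have "\<dots> = (\<Sum>a<n. l a * (h a)\<^sup>2)"
      unfolding cov by (intro sum.cong refl) (simp add: cx)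
    finally show ?thesis .
  qed
  have dist: "(edist n (?z g) y)\<^sup>2 = (\<Sum>a<n. ((\<Sum>k<N. g k * c a k) - ip n (col U a) y)\<^sup>2)" if "y \<in> Rn n" for g y
  proof -
    have "(edist n (?z g) y)\<^sup>2 = (\<Sum>a<n. (ip n (col U a) (\<lambda>i. ?z g i - y i))\<^sup>2)"
      unfolding edist_def enorm_sq by (rule parseval[OF U Rn_diff[OF zR that], symmetric])
    also have "\<dots> = (\<Sum>a<n. ((\<Sum>k<N. g k * c a k) - ip n (col U a) y)\<^sup>2)"
      by (simp only: ip_diff_right ip_sum_right ip_scale_right c_def)
    finally show ?thesis .
  qed
  \<comment> \<open>The covering balls with the scaling by \<open>1 / (2 T)\<close> undone, in the
    coordinates of \<open>U\<close>. Their squared radius is raised to half the tail, the largest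
    that the small ball estimate admits.\<close>
  define S where "S = (\<lambda>y. {g \<in> space (GN N). (\<Sum>a<n. ((\<Sum>k<N. g k * c a k) - ip n (col U a) (\<lambda>i. 2 * T * y i))\<^sup>2) \<le> (\<Sum>a\<in>B. l a) / 2})"
  have Sm: "S y \<in> sets (GN N)" for y unfolding S_def by measurable
  have Sle: "measure (GN N) (S y) \<le> (1 / sqrt 2) ^ m" for y
    unfolding S_def by (rule gauss_small_ball[OF cov' l B lB pos]) simp_all
  have sub: "{g \<in> space (GN N). (\<lambda>l. (1 / (2 * T)) * ?z g l) \<in> K \<and> enorm n (?z g) \<le> 2 * D} \<subseteq> (\<Union>y\<in>A. S y)"
  proof
    fix g assume "g \<in> {g \<in> space (GN N). (\<lambda>l. (1 / (2 * T)) * ?z g l) \<in> K \<and> enorm n (?z g) \<le> 2 * D}"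
    then have gg: "g \<in> space (GN N) \<and> (\<lambda>l. (1 / (2 * T)) * ?z g l) \<in> K \<and> enorm n (?z g) \<le> 2 * D"
      by (rule CollectD)
    note g = gg[THEN conjunct1] gg[THEN conjunct2, THEN conjunct1] gg[THEN conjunct2, THEN conjunct2]
    have "enorm n (\<lambda>l. (1 / (2 * T)) * ?z g l) \<le> D / T"
      unfolding enorm_scale using g(3) T(2) by (simp add: field_simps)
    from cover[OF g(2) this] obtain y where y: "y \<in> A" "edist n (\<lambda>l. (1 / (2 * T)) * ?z g l) y \<le> s" by (rule bexE)
    have "edist n (?z g) (\<lambda>i. 2 * T * y i) = \<bar>2 * T\<bar> * edist n (\<lambda>l. (1 / (2 * T)) * ?z g l) y"
      unfolding edist_scale[symmetric] using T(2) by simp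
    also have "\<dots> \<le> 2 * T * s" using T(2) y(2) by (simp add: mult_left_mono)
    finally have "(edist n (?z g) (\<lambda>i. 2 * T * y i))\<^sup>2 \<le> (2 * T * s)\<^sup>2" by (rule power_mono) simp
    also note s(2)
    finally have "g \<in> S y"
      unfolding S_def using g(1) y(1) A(2) by (subst (asm) dist) (auto intro: Rn_scale)
    then show "g \<in> (\<Union>y\<in>A. S y)" using y(1) by (rule UN_I[rotated])
  qed
  have "1 / 2 \<le> measure (GN N) (\<Union>y\<in>A. S y)"
    by (rule order_trans[OF half G.finite_measure_mono[OF sub]]) (use A(1) Sm in auto)
  also have "\<dots> \<le> (\<Sum>y\<in>A. measure (GN N) (S y))"
    by (rule G.finite_measure_subadditive_finite[OF A(1)]) (use Sm in auto)
  also have "\<dots> \<le> (\<Sum>y\<in>A. (1 / sqrt 2) ^ m)" by (intro sum_mono Sle)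
  finally show ?thesis by simp
qed

end

subsection \<open>Local packings and the critical radius\<close>

definition is_packing :: "nat \<Rightarrow> real \<Rightarrow> rvec set \<Rightarrow> rvec set \<Rightarrow> bool" where
  "is_packing n \<eta> S A \<longleftrightarrow> finite A \<and> A \<subseteq> S \<and> (\<forall>x\<in>A. \<forall>y\<in>A. x \<noteq> y \<longrightarrow> edist n x y > \<eta>)"

lemma packing_number_eq: "packing_number n \<eta> S = Sup (card ` {A. is_packing n \<eta> S A})"
  unfolding packing_number_def is_packing_def by (rule arg_cong[of _ _ Sup]) auto

lemma nat_Sup_attained:
  fixes X :: "nat set"
  assumes "X \<noteq> {}" "\<And>x. x \<in> X \<Longrightarrow> x \<le> b"
  shows "Sup X \<in> X" "\<And>x. x \<in> X \<Longrightarrow> x \<le> Sup X"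
proof -
  have fin: "finite X" using assms(2) by (meson finite_nat_set_iff_bounded_le)
  then have "Sup X = Max X" using assms(1) by (rule cSup_eq_Max)
  then show "Sup X \<in> X" "\<And>x. x \<in> X \<Longrightarrow> x \<le> Sup X" using fin assms(1) by auto
qed

context symmetric_body
begin

text \<open>Compactness: each of finitely many balls of radius \<open>\<eta> / 2\<close> that cover
  \<open>K\<close> contains at most one point of a packing.\<close>

lemma packing_bounded:
  assumes "0 < \<eta>"
  shows "\<exists>b. \<forall>A. is_packing n \<eta> K A \<longrightarrow> card A \<le> b"
proof -
  have op: "open {z. edist n x z < \<eta> / 2}" for x
    by (intro open_Collect_less continuous_on_edist continuous_on_const continuous_on_id)
  have cov: "K \<subseteq> (\<Union>x\<in>K. {z. edist n x z < \<eta> / 2})"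
  proof
    fix x assume "x \<in> K"
    moreover have "x \<in> {z. edist n x z < \<eta> / 2}" using assms by simp
    ultimately show "x \<in> (\<Union>x\<in>K. {z. edist n x z < \<eta> / 2})"
      by (rule UN_I[where B = "\<lambda>x. {z. edist n x z < \<eta> / 2}"])
  qed
  have "\<exists>F. F \<subseteq> K \<and> finite F \<and> K \<subseteq> (\<Union>x\<in>F. {z. edist n x z < \<eta> / 2})"
    by (rule compactE_image[where S = K and C = K and f = "\<lambda>x. {z. edist n x z < \<eta> / 2}", OF K_compact op cov])
      (intro exI conjI; assumption)
  then obtain F where F: "F \<subseteq> K" "finite F" "K \<subseteq> (\<Union>x\<in>F. {z. edist n x z < \<eta> / 2})"
    by (elim exE conjE)
  have "card A \<le> card F" if A: "is_packing n \<eta> K A" for A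
  proof -
    have "\<forall>z\<in>A. \<exists>x. x \<in> F \<and> edist n x z < \<eta> / 2" using A F(3) by (auto simp: is_packing_def)
    then obtain g where g: "\<forall>z\<in>A. g z \<in> F \<and> edist n (g z) z < \<eta> / 2" unfolding bchoice_iff by (rule exE)
    have "inj_on g A"
    proof (rule inj_onI, rule ccontr)
      fix x y assume xy: "x \<in> A" "y \<in> A" "g x = g y" "x \<noteq> y"
      have "edist n x y \<le> edist n x (g x) + edist n (g x) y" by (rule edist_triangle)
      also have "\<dots> < \<eta>" using g[rule_format, OF xy(1)] g[rule_format, OF xy(2)] xy(3)
        by (simp add: edist_commute[of n x])
      finally show False using A xy by (force simp: is_packing_def)
    qed
    moreover have "g ` A \<subseteq> F" using g by auto
    ultimately show ?thesis using F(2) by (rule card_inj_on_le)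
  qed
  then show ?thesis by (intro exI[of _ "card F"] allI impI)
qed

lemma packing_number_attained:
  assumes "0 < \<eta>" "S \<subseteq> K"
  shows "\<exists>A. is_packing n \<eta> S A \<and> card A = packing_number n \<eta> S"
    and "is_packing n \<eta> S A \<Longrightarrow> card A \<le> packing_number n \<eta> S"
proof -
  from packing_bounded[OF assms(1)] obtain b where b: "\<forall>A. is_packing n \<eta> K A \<longrightarrow> card A \<le> b" by (rule exE)
  have ne: "card ` {A. is_packing n \<eta> S A} \<noteq> {}" by (auto simp: is_packing_def)
  have bd: "\<And>x. x \<in> card ` {A. is_packing n \<eta> S A} \<Longrightarrow> x \<le> b"
    using b assms(2) by (auto simp: is_packing_def)
  show "\<exists>A. is_packing n \<eta> S A \<and> card A = packing_number n \<eta> S"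
    using nat_Sup_attained(1)[OF ne bd] unfolding packing_number_eq by auto
  show "is_packing n \<eta> S A \<Longrightarrow> card A \<le> packing_number n \<eta> S"
    unfolding packing_number_eq by (rule nat_Sup_attained(2)[OF ne bd]) auto
qed

lemma maximal_packing_covers:
  assumes \<eta>: "0 < \<eta>" "S \<subseteq> K" and A: "is_packing n \<eta> S A" "card A = packing_number n \<eta> S" and z: "z \<in> S"
  shows "\<exists>a\<in>A. edist n z a \<le> \<eta>"
proof (rule ccontr)
  assume "\<not> ?thesis"
  then have far: "\<forall>a\<in>A. edist n z a > \<eta>" by (simp add: not_le)
  then have "z \<notin> A" using \<eta> by force
  have "is_packing n \<eta> S (insert z A)"
    using A(1) z far unfolding is_packing_def by (auto simp: edist_commute[of n _ z])
  from packing_number_attained(2)[OF \<eta> this] show False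
    using A \<open>z \<notin> A\<close> by (simp add: is_packing_def)
qed

lemma local_packing_attained:
  assumes "0 < \<eta>" "0 < c"
  shows "\<exists>\<nu>\<in>K. \<exists>A. is_packing n (\<eta> / c) (ecball n \<nu> \<eta> \<inter> K) A \<and> card A = local_packing c n K \<eta>"
    and "\<nu> \<in> K \<Longrightarrow> packing_number n (\<eta> / c) (ecball n \<nu> \<eta> \<inter> K) \<le> local_packing c n K \<eta>"
    and "\<nu> \<in> K \<Longrightarrow> is_packing n (\<eta> / c) (ecball n \<nu> \<eta> \<inter> K) A \<Longrightarrow> card A \<le> local_packing c n K \<eta>"
proof -
  have \<eta>c: "0 < \<eta> / c" using assms by simp
  have sub: "ecball n \<nu> \<eta> \<inter> K \<subseteq> K" for \<nu> by simp
  from packing_bounded[OF \<eta>c] obtain b where b: "\<forall>A. is_packing n (\<eta> / c) K A \<longrightarrow> card A \<le> b" by (rule exE)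
  let ?X = "(\<lambda>\<nu>. packing_number n (\<eta> / c) (ecball n \<nu> \<eta> \<inter> K)) ` K"
  have ne: "?X \<noteq> {}" using zero_mem by (metis empty_iff image_is_empty)
  have bd: "\<And>x. x \<in> ?X \<Longrightarrow> x \<le> b"
  proof -
    fix x assume "x \<in> ?X"
    then obtain \<nu> where "x = packing_number n (\<eta> / c) (ecball n \<nu> \<eta> \<inter> K)" by (rule imageE)
    moreover obtain A where "is_packing n (\<eta> / c) (ecball n \<nu> \<eta> \<inter> K) A" "card A = packing_number n (\<eta> / c) (ecball n \<nu> \<eta> \<inter> K)"
      using packing_number_attained(1)[OF \<eta>c sub[of \<nu>]] by (elim exE conjE)
    ultimately show "x \<le> b" using b[rule_format, of A] by (auto simp: is_packing_def)
  qed
  have "local_packing c n K \<eta> \<in> ?X" using nat_Sup_attained(1)[OF ne bd] by (simp add: local_packing_def)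
  then obtain \<nu>0 where \<nu>: "local_packing c n K \<eta> = packing_number n (\<eta> / c) (ecball n \<nu>0 \<eta> \<inter> K)" "\<nu>0 \<in> K" by (rule imageE)
  show "\<exists>\<nu>\<in>K. \<exists>A. is_packing n (\<eta> / c) (ecball n \<nu> \<eta> \<inter> K) A \<and> card A = local_packing c n K \<eta>"
    unfolding \<nu>(1) by (rule bexI[OF packing_number_attained(1)[OF \<eta>c sub] \<nu>(2)])
  show 2: "\<nu> \<in> K \<Longrightarrow> packing_number n (\<eta> / c) (ecball n \<nu> \<eta> \<inter> K) \<le> local_packing c n K \<eta>" for \<nu>
    unfolding local_packing_def by (rule nat_Sup_attained(2)[OF ne bd]) simp_all
  show "\<nu> \<in> K \<Longrightarrow> is_packing n (\<eta> / c) (ecball n \<nu> \<eta> \<inter> K) A \<Longrightarrow> card A \<le> local_packing c n K \<eta>"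
    by (rule order_trans[OF packing_number_attained(2)[OF \<eta>c sub] 2])
qed

lemma local_packing_ge_1:
  assumes "0 < \<eta>" "0 < c"
  shows "1 \<le> local_packing c n K \<eta>"
  using local_packing_attained(3)[OF assms zero_mem, of "{\<lambda>_. 0}"] assms zero_mem
  by (simp add: is_packing_def ecball_def Rn_zero)

text \<open>The homothety with centre \<open>\<nu>\<close> and ratio \<open>\<eta> / \<eta>'\<close>
  carries an optimal packing at the large radius to one at the small radius. Convexity keeps the
  image in \<open>K\<close>.\<close>

lemma local_packing_antimono:
  assumes \<eta>: "0 < \<eta>" "\<eta> \<le> \<eta>'" and c: "0 < c"
  shows "local_packing c n K \<eta>' \<le> local_packing c n K \<eta>"
proof -
  have \<eta>': "0 < \<eta>'" using \<eta> by simp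
  obtain \<nu> A where \<nu>: "\<nu> \<in> K" and A: "is_packing n (\<eta>' / c) (ecball n \<nu> \<eta>' \<inter> K) A" "card A = local_packing c n K \<eta>'"
    using local_packing_attained(1)[OF \<eta>' c] by (elim bexE exE conjE)
  define t where "t = \<eta> / \<eta>'"
  have t: "0 < t" "t \<le> 1" using \<eta> \<eta>' by (auto simp: t_def)
  define f where "f = (\<lambda>x i. (1 - t) * \<nu> i + t * x i)"
  have df: "edist n (f x) (f y) = t * edist n x y" for x y
  proof -
    have "(\<lambda>i. f x i - f y i) = (\<lambda>i. t * (x i - y i))" by (simp add: f_def algebra_simps)
    then show ?thesis using t by (simp add: edist_def enorm_scale)
  qed
  have f\<nu>: "f \<nu> = \<nu>" by (simp add: f_def algebra_simps)
  have inj: "inj_on f A"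
  proof (rule inj_onI)
    fix x y assume "f x = f y"
    then have "f x i = f y i" for i by simp
    then show "x = y" using t by (simp add: f_def fun_eq_iff)
  qed
  have "is_packing n (\<eta> / c) (ecball n \<nu> \<eta> \<inter> K) (f ` A)"
    unfolding is_packing_def
  proof (intro conjI ballI impI subsetI)
    show "finite (f ` A)" using A by (simp add: is_packing_def)
  next
    fix z assume "z \<in> f ` A"
    then obtain x where x: "x \<in> A" "z = f x" by blast
    then have xK: "x \<in> K" "edist n \<nu> x \<le> \<eta>'" using A by (auto simp: is_packing_def ecball_def)
    have "z \<in> K" unfolding x(2) f_def using t by (intro K_convex \<nu> xK) auto
    moreover have "edist n \<nu> z \<le> \<eta>"
    proof -
      have "edist n \<nu> z = t * edist n \<nu> x" using df[of \<nu> x] by (simp only: f\<nu> x(2))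
      also have "\<dots> \<le> t * \<eta>'" by (rule mult_left_mono[OF xK(2)]) (use t in simp)
      also have "\<dots> = \<eta>" using \<eta>' by (simp add: t_def)
      finally show ?thesis .
    qed
    ultimately show "z \<in> ecball n \<nu> \<eta> \<inter> K" using K_Rn by (simp add: ecball_def)
  next
    fix a b assume "a \<in> f ` A" "b \<in> f ` A" "a \<noteq> b"
    then obtain x y where xy: "x \<in> A" "y \<in> A" "a = f x" "b = f y" "x \<noteq> y" by blast
    then have "\<eta>' / c < edist n x y" using A by (simp add: is_packing_def)
    then have "t * (\<eta>' / c) < edist n a b"
      unfolding xy df by (rule mult_strict_left_mono[OF _ t(1)])
    then show "\<eta> / c < edist n a b" using \<eta>' by (simp add: t_def)
  qed
  from local_packing_attained(3)[OF \<eta>(1) c \<nu> this] show ?thesis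
    using A(2) card_image[OF inj] by simp
qed

text \<open>Every ball of the current radius is refined by a maximal packing at that radius divided
  by \<open>c\<close>. As long as the radius before refinement is at least \<open>\<eta>1\<close>,
  antimonotonicity bounds the number of pieces by the local packing number at
  \<open>\<eta>1\<close>.\<close>

lemma covering_chain:
  assumes c: "1 < c" and \<eta>1: "0 < \<eta>1" and \<eta>0: "0 < \<eta>0"
  shows "(\<forall>i<j. \<eta>1 \<le> \<eta>0 / c ^ i) \<Longrightarrow> \<exists>A. finite A \<and> A \<subseteq> K \<and> card A \<le> local_packing c n K \<eta>1 ^ j \<and>
    (\<forall>z\<in>K. enorm n z \<le> \<eta>0 \<longrightarrow> (\<exists>a\<in>A. edist n z a \<le> \<eta>0 / c ^ j))"
proof (induction j)
  case 0
  show ?case by (rule exI[of _ "{\<lambda>_. 0}"]) (simp add: zero_mem)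
next
  case (Suc j)
  let ?M = "local_packing c n K \<eta>1"
  define \<rho> where "\<rho> = \<eta>0 / c ^ j"
  have \<rho>: "0 < \<rho>" "\<eta>1 \<le> \<rho>" using Suc.prems c \<eta>0 by (auto simp: \<rho>_def)
  have c0: "0 < c" and \<rho>c: "0 < \<rho> / c" using c \<rho> by auto
  have sub: "ecball n \<nu> \<rho> \<inter> K \<subseteq> K" for \<nu> by simp
  from Suc obtain A where A: "finite A" "A \<subseteq> K" "card A \<le> ?M ^ j"
    "\<forall>z\<in>K. enorm n z \<le> \<eta>0 \<longrightarrow> (\<exists>a\<in>A. edist n z a \<le> \<rho>)"
    unfolding \<rho>_def by (metis less_SucI)
  have "\<forall>a\<in>A. \<exists>B. is_packing n (\<rho> / c) (ecball n a \<rho> \<inter> K) B \<and> card B = packing_number n (\<rho> / c) (ecball n a \<rho> \<inter> K)"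
    using packing_number_attained(1)[OF \<rho>c sub] by blast
  then obtain B where B: "\<forall>a\<in>A. is_packing n (\<rho> / c) (ecball n a \<rho> \<inter> K) (B a) \<and> card (B a) = packing_number n (\<rho> / c) (ecball n a \<rho> \<inter> K)"
    unfolding bchoice_iff by (rule exE)
  have Bc: "card (B a) \<le> ?M" if "a \<in> A" for a
  proof -
    have "card (B a) \<le> local_packing c n K \<rho>"
      using B that A(2) local_packing_attained(2)[OF \<rho>(1) c0] by auto
    also have "\<dots> \<le> ?M" by (rule local_packing_antimono[OF \<eta>1 \<rho>(2) c0])
    finally show ?thesis .
  qed
  have "card (\<Union>a\<in>A. B a) \<le> (\<Sum>a\<in>A. card (B a))" by (rule card_UN_le[OF A(1)])
  also have "\<dots> \<le> (\<Sum>a\<in>A. ?M)" by (intro sum_mono Bc)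
  also have "\<dots> \<le> ?M ^ Suc j" using A(3) by simp
  finally have card: "card (\<Union>a\<in>A. B a) \<le> ?M ^ Suc j" .
  have fin: "finite (\<Union>a\<in>A. B a)" using A(1) B by (auto simp: is_packing_def)
  have subK: "(\<Union>a\<in>A. B a) \<subseteq> K" using B by (auto simp: is_packing_def)
  have cov: "\<exists>b\<in>(\<Union>a\<in>A. B a). edist n z b \<le> \<eta>0 / c ^ Suc j" if z: "z \<in> K" "enorm n z \<le> \<eta>0" for z
  proof -
    obtain a where a: "a \<in> A" "edist n z a \<le> \<rho>" using A(4) z by blast
    have "z \<in> ecball n a \<rho> \<inter> K" using z a K_Rn by (simp add: ecball_def edist_commute[of n a])
    from maximal_packing_covers[OF \<rho>c sub B[rule_format, OF a(1), THEN conjunct1] B[rule_format, OF a(1), THEN conjunct2] this]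
    obtain b where b: "b \<in> B a" "edist n z b \<le> \<rho> / c" by (rule bexE)
    have "b \<in> (\<Union>a\<in>A. B a)" by (rule UN_I[of a A b B, OF a(1) b(1)])
    moreover have "edist n z b \<le> \<eta>0 / c ^ Suc j" using b(2) by (simp add: \<rho>_def mult.commute)
    ultimately show ?thesis by (intro bexI[of _ b])
  qed
  show ?case by (rule exI[of _ "\<Union>a\<in>A. B a"]) (intro conjI fin card subK ballI impI cov)
qed

section \<open>The critical radius: boundedness and elementary lower bounds\<close>

abbreviation eta_set :: "real \<Rightarrow> real \<Rightarrow> real set" where
  "eta_set c \<sigma> \<equiv> {\<eta>. 0 \<le> \<eta> \<and> \<eta>\<^sup>2 / \<sigma>\<^sup>2 \<le> ln (real (local_packing c n K \<eta>))}"

text \<open>Beyond \<open>2 * c * R\<close> the required separation exceeds the diameter of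
  \<open>K\<close>, so packings are single points and the logarithm is 0.\<close>

lemma eta_set_bdd:
  assumes c: "0 < c" and \<sigma>: "0 < \<sigma>"
  shows "bdd_above (eta_set c \<sigma>)"
proof (rule bdd_aboveI[where M = "2 * c * R"])
  fix \<eta> assume \<eta>: "\<eta> \<in> eta_set c \<sigma>"
  show "\<eta> \<le> 2 * c * R"
  proof (rule ccontr)
    assume "\<not> ?thesis"
    then have big: "2 * c * R < \<eta>" by simp
    then have \<eta>0: "0 < \<eta>" using c R0 by (meson less_trans mult_pos_pos zero_less_numeral)
    obtain \<nu> A where A: "is_packing n (\<eta> / c) (ecball n \<nu> \<eta> \<inter> K) A" "card A = local_packing c n K \<eta>"
      using local_packing_attained(1)[OF \<eta>0 c] by (elim bexE exE conjE)
    have "x = y" if "x \<in> A" "y \<in> A" for x y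
    proof (rule ccontr)
      assume "x \<noteq> y"
      then have "\<eta> / c < edist n x y" using A that by (simp add: is_packing_def)
      moreover have "edist n x y \<le> enorm n x + enorm n y"
        using edist_triangle[of n x y "\<lambda>_. 0"] by simp
      moreover have "enorm n x \<le> R" "enorm n y \<le> R" using A that by (auto simp: is_packing_def intro: K_le)
      moreover have "2 * R < \<eta> / c" using big c by (simp add: less_divide_eq mult.commute mult.left_commute)
      ultimately show False by linarith
    qed
    then have "\<forall>a\<in>A. \<forall>b\<in>A. a = b" by (intro ballI)
    moreover have "finite A" using A by (simp add: is_packing_def)
    ultimately have "card A \<le> 1" by (simp add: card_le_Suc0_iff_eq)
    then have "ln (real (local_packing c n K \<eta>)) \<le> 0"
      using local_packing_ge_1[OF \<eta>0 c] A(2) by simp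
    moreover have "0 < \<eta>\<^sup>2 / \<sigma>\<^sup>2" using \<eta>0 \<sigma> by simp
    ultimately show False using \<eta> by simp
  qed
qed

lemma eta_star_upper:
  assumes "0 < c" "0 < \<sigma>" "0 \<le> \<eta>" "\<eta>\<^sup>2 / \<sigma>\<^sup>2 \<le> ln (real (local_packing c n K \<eta>))"
  shows "\<eta> \<le> eta_star c n \<sigma> K"
  unfolding eta_star_def by (rule cSup_upper[OF _ eta_set_bdd[OF assms(1,2)]]) (use assms in simp)

lemma above_eta_star:
  assumes "0 < c" "0 < \<sigma>" "0 \<le> \<eta>" "eta_star c n \<sigma> K < \<eta>"
  shows "ln (real (local_packing c n K \<eta>)) < \<eta>\<^sup>2 / \<sigma>\<^sup>2"
  using eta_star_upper[OF assms(1-3)] assms(4) by (meson not_le)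

lemma two_points:
  assumes x: "x \<in> K" "enorm n x = \<eta>" and \<eta>: "0 < \<eta>" and c: "1 < c"
  shows "2 \<le> local_packing c n K \<eta>"
proof -
  let ?y = "\<lambda>i. - x i"
  have d: "edist n x ?y = 2 * \<eta>"
  proof -
    have "(\<lambda>i. x i - - x i) = (\<lambda>i. 2 * x i)" by simp
    then show ?thesis using x(2) by (simp add: edist_def enorm_scale)
  qed
  then have ne: "x \<noteq> ?y" using \<eta> edist_self[of n x] by (metis less_irrefl mult_eq_0_iff zero_neq_numeral)
  have lt: "\<eta> / c < 2 * \<eta>" using \<eta> c by (simp add: divide_less_eq)
  have "is_packing n (\<eta> / c) (ecball n (\<lambda>_. 0) \<eta> \<inter> K) {x, ?y}"
    using x K_minus[OF x(1)] K_Rn[OF x(1)] lt d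
    by (auto simp: is_packing_def ecball_def enorm_minus Rn_minus edist_commute[of n ?y x])
  from local_packing_attained(3)[OF \<eta> _ zero_mem this] show ?thesis using ne c by simp
qed

text \<open>On the segment from \<open>-x\<close> to \<open>x\<close>, an antipodal pair of norm
  \<open>min (\<sigma> / 2) |x|\<close> is a packing of two points, and
  \<open>1 / 4 \<le> ln 2\<close>. Hence large noise forces \<open>K\<close> into the ball of radius
  \<open>eta_star\<close>.\<close>

lemma eta_star_ge_point:
  assumes x: "x \<in> K" and \<sigma>: "0 < \<sigma>" and c: "1 < c"
  shows "min (\<sigma> / 2) (enorm n x) \<le> eta_star c n \<sigma> K"
proof (rule eta_star_upper)
  let ?\<eta> = "min (\<sigma> / 2) (enorm n x)"
  show "0 \<le> ?\<eta>" using \<sigma> by simp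
  show "?\<eta>\<^sup>2 / \<sigma>\<^sup>2 \<le> ln (real (local_packing c n K ?\<eta>))"
  proof (cases "?\<eta> = 0")
    case True
    \<comment> \<open>At radius 0 nothing about the packing number is used; the value
      \<open>ln 0 = 0\<close> covers even the number 0.\<close>
    have "0 \<le> ln (real k)" for k :: nat by (cases k) auto
    then show ?thesis unfolding True by simp
  next
    case False
    then have \<eta>: "0 < ?\<eta>" using \<sigma> enorm_nonneg[of n x] by linarith
    then have ex: "0 < enorm n x" by simp
    define y where "y = (\<lambda>i. (?\<eta> / enorm n x) * x i)"
    have "y \<in> K" unfolding y_def using \<eta> ex by (intro K_shrink x) auto
    moreover have "enorm n y = ?\<eta>" unfolding y_def enorm_scale using \<eta> ex by simp
    ultimately have "2 \<le> local_packing c n K ?\<eta>" using \<eta> c by (rule two_points)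
    then have "ln 2 \<le> ln (real (local_packing c n K ?\<eta>))" by (subst ln_le_cancel_iff) auto
    moreover have "?\<eta>\<^sup>2 \<le> (\<sigma> / 2)\<^sup>2" using \<eta> by (intro power_mono) auto
    then have "?\<eta>\<^sup>2 / \<sigma>\<^sup>2 \<le> 1 / 4" using \<sigma> by (simp add: power_divide divide_le_eq)
    ultimately show ?thesis using ln2_ge_two_thirds by linarith
  qed
qed (use \<sigma> c in auto)

lemma unit_vector:
  assumes "0 \<le> t"
  obtains x where "x \<in> Rn n" "enorm n x = t"
proof -
  let ?x = "\<lambda>j::nat. if j = 0 then t else 0"
  have "?x \<in> Rn n" using n1 by (auto simp: Rn_def)
  moreover have "enorm n ?x = t" using n1 assms by (simp add: enorm_eq_sqrt ip_e_sum)
  ultimately show ?thesis by (rule that)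
qed

lemma eta_star_pos: "0 < \<sigma> \<Longrightarrow> 1 < c \<Longrightarrow> 0 < eta_star c n \<sigma> K"
proof -
  assume a: "0 < \<sigma>" "1 < c"
  obtain x where x: "x \<in> Rn n" "enorm n x = r" using unit_vector[of r] r0 by auto
  then have "x \<in> K" by (intro ball_mem) auto
  from eta_star_ge_point[OF this a] show ?thesis using a r0 x by linarith
qed

section \<open>Lower bound for the critical radius from the inscribed ball\<close>

lemma GN_norm_tail: "measure (GN n) {g \<in> space (GN n). 4 * real n \<le> (\<Sum>i<n. (g i)\<^sup>2)} \<le> 1 / 4"
proof -
  interpret G: prob_space "GN n" by (rule prob_space_GN)
  let ?f = "\<lambda>g::rvec. ennreal (\<Sum>i<n. (g i)\<^sup>2)"
  have int: "(\<integral>\<^sup>+g. ?f g \<partial>GN n) = ennreal (real n)"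
  proof -
    have "(\<integral>\<^sup>+g. ?f g \<partial>GN n) = (\<integral>\<^sup>+g. (\<Sum>i<n. ennreal ((g i)\<^sup>2)) \<partial>GN n)" by (simp add: sum_ennreal)
    also have "\<dots> = (\<Sum>i<n. \<integral>\<^sup>+g. ennreal ((g i)\<^sup>2) \<partial>GN n)" by (rule nn_integral_sum) measurable
    also have "\<dots> = (\<Sum>i<n. 1)" by (intro sum.cong refl GN_second_moment) simp
    finally show ?thesis by (simp add: ennreal_of_nat_eq_real_of_nat)
  qed
  have n0: "0 < real n" using n1 by simp
  have "emeasure (GN n) {g \<in> space (GN n). 1 \<le> ennreal (1 / (4 * real n)) * ?f g} \<le> ennreal (1 / (4 * real n)) * (\<integral>\<^sup>+g. ?f g * indicator (space (GN n)) g \<partial>GN n)"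
    by (rule nn_integral_Markov_inequality) measurable
  also have "(\<integral>\<^sup>+g. ?f g * indicator (space (GN n)) g \<partial>GN n) = (\<integral>\<^sup>+g. ?f g \<partial>GN n)"
    by (rule nn_integral_cong) simp
  also have "ennreal (1 / (4 * real n)) * (\<integral>\<^sup>+g. ?f g \<partial>GN n) = ennreal (1 / 4)"
    unfolding int using n0 by (simp flip: ennreal_mult)
  finally have le: "emeasure (GN n) {g \<in> space (GN n). 1 \<le> ennreal (1 / (4 * real n)) * ?f g} \<le> ennreal (1 / 4)" .
  have eq: "{g \<in> space (GN n). 4 * real n \<le> (\<Sum>i<n. (g i)\<^sup>2)} = {g \<in> space (GN n). 1 \<le> ennreal (1 / (4 * real n)) * ?f g}"
    using n0 by (intro Collect_cong conj_cong refl) (simp add: ennreal_mult[symmetric] sum_nonneg le_divide_eq)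
  show ?thesis unfolding eq measure_def by (rule enn2real_leI[OF _ le]) simp
qed

text \<open>A Gaussian substitute for a volume comparison: after scaling, most of the standard
  Gaussian mass lies in the large ball, and each small ball carries an exponentially small part of
  it.\<close>

lemma ball_covering_lower:
  assumes \<eta>: "0 < \<eta>" and A: "finite A"
    and cover: "\<And>z. z \<in> Rn n \<Longrightarrow> enorm n z \<le> \<eta> \<Longrightarrow> \<exists>a\<in>A. edist n z a \<le> \<eta> / 4"
  shows "3 / 4 \<le> real (card A) * (1 / sqrt 2) ^ (n div 2)"
proof -
  interpret G: prob_space "GN n" by (rule prob_space_GN)
  \<comment> \<open>This scale sends radius \<open>\<eta>\<close> to \<open>2 sqrt n\<close>, which
    holds mass at least 3/4, and radius \<open>\<eta> / 4\<close> to \<open>sqrt n / 2\<close>,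
    which \<open>gauss_small_ball\<close> can handle with about half of the coordinates in
    \<open>B\<close>.\<close>
  define s where "s = 2 * sqrt (real n) / \<eta>"
  have n0: "0 < real n" using n1 by simp
  have s: "0 < s" using \<eta> n0 by (simp add: s_def)
  have s2: "s\<^sup>2 * \<eta>\<^sup>2 = 4 * real n" using \<eta> n0 by (simp add: s_def power_divide power_mult_distrib)
  define c where "c = (\<lambda>a k::nat. if a = k then 1 else 0 :: real)"
  have ck: "(\<Sum>k<n. g k * c a k) = g a" if "a < n" for g a
    using that by (simp add: c_def if_distrib[of "\<lambda>t. _ * t"] cong: if_cong)
  have cov: "(\<Sum>k<n. (\<Sum>a<n. h a * c a k)\<^sup>2) = (\<Sum>a<n. 1 * (h a)\<^sup>2)" for h
    by (simp add: c_def if_distrib[of "\<lambda>t. _ * t"] cong: if_cong)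
  define S where "S = (\<lambda>y. {g \<in> space (GN n). (\<Sum>a<n. ((\<Sum>k<n. g k * c a k) - s * y a)\<^sup>2) \<le> real n / 4})"
  have Sm: "S y \<in> sets (GN n)" for y unfolding S_def by measurable
  have Sle: "measure (GN n) (S y) \<le> (1 / sqrt 2) ^ (n div 2)" for y
    unfolding S_def
  proof (rule gauss_small_ball[OF cov, where B = "{..<n - n div 2}"])
    have "real n \<le> 2 * real (n - n div 2)" by linarith
    then show "real n / 4 \<le> (\<Sum>a\<in>{..<n - n div 2}. 1) / 2" by simp
    show "0 < (\<Sum>a\<in>{..<n - n div 2}. (1::real))" using n1 by simp
  qed auto
  let ?T = "{g \<in> space (GN n). 4 * real n \<le> (\<Sum>i<n. (g i)\<^sup>2)}"
  have Tm: "?T \<in> sets (GN n)" by measurable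
  have sub: "space (GN n) - ?T \<subseteq> (\<Union>y\<in>A. S y)"
  proof
    fix g assume "g \<in> space (GN n) - ?T"
    then have g: "g \<in> space (GN n)" "(\<Sum>i<n. (g i)\<^sup>2) \<le> 4 * real n" by auto
    define z where "z = (\<lambda>i. if i < n then g i / s else 0)"
    have zR: "z \<in> Rn n" by (simp add: z_def Rn_def)
    have "(enorm n z)\<^sup>2 = (\<Sum>i<n. (g i)\<^sup>2) / s\<^sup>2"
      unfolding enorm_sq ip_def z_def by (simp add: sum_divide_distrib power2_eq_square)
    also have "\<dots> \<le> (s\<^sup>2 * \<eta>\<^sup>2) / s\<^sup>2" using g(2) unfolding s2 by (rule divide_right_mono) simp
    also have "\<dots> = \<eta>\<^sup>2" using s by simp
    finally have "(enorm n z)\<^sup>2 \<le> \<eta>\<^sup>2" .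
    then have "enorm n z \<le> \<eta>" by (rule power2_le_imp_le) (use \<eta> in simp)
    from cover[OF zR this] obtain y where y: "y \<in> A" "edist n z y \<le> \<eta> / 4" by (rule bexE)
    have "(\<Sum>a<n. ((\<Sum>k<n. g k * c a k) - s * y a)\<^sup>2) = s\<^sup>2 * (edist n z y)\<^sup>2"
      unfolding edist_def enorm_sq ip_def sum_distrib_left
    proof (intro sum.cong refl)
      fix a assume "a \<in> {..<n}"
      then have a: "a < n" by simp
      have "g a - s * y a = s * (z a - y a)" using s a by (simp add: z_def right_diff_distrib)
      then show "((\<Sum>k<n. g k * c a k) - s * y a)\<^sup>2 = s\<^sup>2 * ((z a - y a) * (z a - y a))"
        by (simp only: ck[OF a] power_mult_distrib power2_eq_square[of "z a - y a"])
    qed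
    also have "\<dots> \<le> s\<^sup>2 * (\<eta> / 4)\<^sup>2" using y(2) by (intro mult_left_mono power_mono) auto
    also have "\<dots> = real n / 4" using s2 by (simp add: power_divide)
    finally have "g \<in> S y" using g(1) by (simp add: S_def)
    then show "g \<in> (\<Union>y\<in>A. S y)" using y(1) by (rule UN_I[rotated])
  qed
  have "3 / 4 \<le> measure (GN n) (space (GN n) - ?T)"
    using G.prob_compl[OF Tm] GN_norm_tail by linarith
  also have "\<dots> \<le> measure (GN n) (\<Union>y\<in>A. S y)"
    by (rule G.finite_measure_mono[OF sub]) (use A Sm in auto)
  also have "\<dots> \<le> (\<Sum>y\<in>A. measure (GN n) (S y))"
    by (rule G.finite_measure_subadditive_finite[OF A]) (use Sm in auto)
  also have "\<dots> \<le> (\<Sum>y\<in>A. (1 / sqrt 2) ^ (n div 2))" by (intro sum_mono Sle)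
  finally show ?thesis by simp
qed

lemma ln_inv_sqrt2_power: "ln ((1 / sqrt 2) ^ m) = - (real m * ln 2 / 2)"
  by (simp add: ln_realpow ln_div ln_sqrt)

lemma volume_arith:
  fixes x P l L :: real
  assumes "(x - 1) / 6 \<le> P" "l + P \<le> L" "- (1 / 3) \<le> l" "14 \<le> x"
  shows "x / 20 \<le> L"
  using assms by (simp add: field_simps)

text \<open>The entropy of a ball in \<open>K\<close> is at least \<open>n / 20\<close>, while the
  left side of the defining inequality is at most \<open>n / 25\<close>. This settles the immediate
  return of \<open>Y\<close> and the scale \<open>2 * r\<close> at which the loop may end.\<close>

lemma eta_star_ge_volume:
  assumes \<sigma>: "0 < \<sigma>"
  shows "min (\<sigma> * sqrt (real n)) r / 5 \<le> eta_star 4 n \<sigma> K"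
proof (rule eta_star_upper)
  let ?\<eta> = "min (\<sigma> * sqrt (real n)) r / 5"
  have n0: "0 < real n" using n1 by simp
  have \<eta>: "0 < ?\<eta>" using \<sigma> n0 r0 by simp
  then show "0 \<le> ?\<eta>" by simp
  have \<eta>r: "?\<eta> \<le> r" using r0 by linarith
  let ?M = "local_packing 4 n K ?\<eta>"
  obtain x where x: "x \<in> Rn n" "enorm n x = ?\<eta>" using unit_vector[of ?\<eta>] \<eta> by auto
  then have M2: "2 \<le> ?M" using \<eta>r by (intro two_points[OF _ x(2) \<eta>] ball_mem) auto
  have c: "0 < ?\<eta> / 4" using \<eta> by simp
  have sub: "ecball n (\<lambda>_. 0) ?\<eta> \<inter> K \<subseteq> K" by simp
  obtain A where A: "is_packing n (?\<eta> / 4) (ecball n (\<lambda>_. 0) ?\<eta> \<inter> K) A" "card A = packing_number n (?\<eta> / 4) (ecball n (\<lambda>_. 0) ?\<eta> \<inter> K)"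
    using packing_number_attained(1)[OF c sub] by (elim exE conjE)
  have AM: "card A \<le> ?M" by (rule local_packing_attained(3)[OF \<eta> _ zero_mem A(1)]) simp
  have "3 / 4 \<le> real (card A) * (1 / sqrt 2) ^ (n div 2)"
  proof (rule ball_covering_lower[OF \<eta>])
    show "finite A" using A by (simp add: is_packing_def)
    fix z assume z: "z \<in> Rn n" "enorm n z \<le> ?\<eta>"
    then have "z \<in> K" using \<eta>r by (intro ball_mem) auto
    then have "z \<in> ecball n (\<lambda>_. 0) ?\<eta> \<inter> K" using z by (simp add: ecball_def)
    then show "\<exists>a\<in>A. edist n z a \<le> ?\<eta> / 4" by (rule maximal_packing_covers[OF c sub A])
  qed
  also have "\<dots> \<le> real ?M * (1 / sqrt 2) ^ (n div 2)" using AM by (intro mult_right_mono) auto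
  finally have "ln (3 / 4) \<le> ln (real ?M * (1 / sqrt 2) ^ (n div 2))" using M2 by (subst ln_le_cancel_iff) auto
  also have "\<dots> = ln (real ?M) - real (n div 2) * ln 2 / 2"
    using M2 by (subst ln_mult) (auto simp: ln_inv_sqrt2_power)
  finally have 1: "ln (3 / 4) + real (n div 2) * ln 2 / 2 \<le> ln (real ?M)" by linarith
  have "ln (4 / 3 :: real) \<le> 4 / 3 - 1" by (rule ln_le_minus_one) simp
  moreover have "ln (3 / 4 :: real) = - ln (4 / 3)" by (simp add: ln_div)
  ultimately have l34: "- (1 / 3) \<le> ln (3 / 4 :: real)" by simp
  have l2: "2 / 3 \<le> ln (real ?M)"
  proof -
    have "ln 2 \<le> ln (real ?M)" using M2 by (subst ln_le_cancel_iff) auto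
    then show ?thesis using ln2_ge_two_thirds by linarith
  qed
  have "real n / 20 \<le> ln (real ?M)"
  \<comment> \<open>In low dimension an antipodal pair is enough, since
    \<open>ln 2 \<ge> 2 / 3 \<ge> 13 / 20\<close>; the Gaussian bound loses too much there.\<close>
  proof (cases "n \<le> 13")
    case True
    then show ?thesis using l2 by linarith
  next
    case False
    have n14: "14 \<le> real n" using False by simp
    have "n \<le> 2 * (n div 2) + 1" by arith
    then have "real n \<le> real (2 * (n div 2) + 1)" by (rule of_nat_mono)
    then have "(real n - 1) / 2 \<le> real (n div 2)" by simp
    then have "(real n - 1) / 2 * (2 / 3) \<le> real (n div 2) * ln 2"
      using ln2_ge_two_thirds False by (intro mult_mono) auto
    then have "(real n - 1) / 6 \<le> real (n div 2) * ln 2 / 2" by linarith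
    from volume_arith[OF this 1 l34 n14] show ?thesis .
  qed
  moreover have "?\<eta>\<^sup>2 \<le> (\<sigma> * sqrt (real n) / 5)\<^sup>2" using \<eta> by (intro power_mono) auto
  then have "?\<eta>\<^sup>2 \<le> \<sigma>\<^sup>2 * real n / 25" by (simp add: power_divide power_mult_distrib)
  then have "?\<eta>\<^sup>2 / \<sigma>\<^sup>2 \<le> real n / 25" using \<sigma> by (simp add: divide_le_eq mult.commute)
  ultimately show "?\<eta>\<^sup>2 / \<sigma>\<^sup>2 \<le> ln (real ?M)" by linarith
qed (use \<sigma> in auto)

text \<open>A large tail makes \<open>covering_lower\<close> demand a covering of log-size of order
  \<open>m\<close>, at a radius proportional to the root of the tail. Refining local packings
  reaches this radius with log-size at most \<open>ell * (2 * eta_star)^2 / \<sigma>^2\<close>, and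
  the lower bound on \<open>d\<close> makes that too small.\<close>

lemma tail_small:
  fixes N m :: nat and w :: "nat \<Rightarrow> real" and p :: "nat \<Rightarrow> rvec"
  assumes \<sigma>: "0 < \<sigma>" and kb: "1 \<le> \<kappa>" "\<kappa> \<le> kb"
    and d: "400 * \<sigma> \<le> d" "600 * sqrt (Upsilon_fac 4 200 kb (T2 n K)) * eta_star 4 n \<sigma> K \<le> d"
    and m: "d\<^sup>2 / (200\<^sup>2 * \<sigma>\<^sup>2) \<le> real m" "m \<le> n"
    and w: "\<And>k. k < N \<Longrightarrow> 0 \<le> w k" "(\<Sum>k<N. w k) = 1"
    and p: "\<And>k. k < N \<Longrightarrow> p k \<in> K" "\<And>k. k < N \<Longrightarrow> enorm n (p k) \<le> d / 2"
    and U: "orthogonal_mat n U"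
    and cov: "\<And>x. (\<Sum>k<N. w k * (ip n (p k) x)\<^sup>2) = (\<Sum>a<n. l a * (ip n (col U a) x)\<^sup>2)"
    and l: "\<And>a. a < n \<Longrightarrow> 0 \<le> l a" and B: "B \<subseteq> {..<n}" "card B = n - m"
    and lB: "\<And>a b. a \<in> B \<Longrightarrow> b \<in> {..<n} - B \<Longrightarrow> l a \<le> l b"
  shows "\<kappa> * (\<Sum>a\<in>B. l a) \<le> d\<^sup>2 / 20000"
proof (rule ccontr)
  assume neg: "\<not> ?thesis"
  define e where "e = eta_star 4 n \<sigma> K"
  define t where "t = T2 n K"
  define \<tau> where "\<tau> = (\<Sum>a\<in>B. l a)"
  define \<Lambda> where "\<Lambda> = Lambda_fac 4 kb t"
  have e: "0 < e" unfolding e_def by (rule eta_star_pos[OF \<sigma>]) simp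
  have t: "1 \<le> t" unfolding t_def by (rule T2_ge_1)
  have d0: "0 < d" using \<sigma> d(1) by linarith
  have \<tau>: "d\<^sup>2 / (20000 * \<kappa>) < \<tau>" using neg kb(1) by (simp add: \<tau>_def divide_less_eq not_le mult_ac)
  have \<tau>0: "0 < \<tau>" using \<tau> d0 kb(1) by (meson divide_nonneg_pos less_le_trans mult_pos_pos order_le_less_trans zero_le_power2 zero_less_numeral zero_less_one)
  define q where "q = sqrt \<kappa>"
  have q: "1 \<le> q" "q\<^sup>2 = \<kappa>" using kb(1) by (auto simp: q_def)
  have qkb: "q \<le> sqrt kb" using kb by (simp add: q_def)
  \<comment> \<open>The radius \<open>D / T\<close> of \<open>covering_lower\<close> for
    \<open>D = d / 2\<close> and the type 2 bound \<open>T = 2 * t\<close>.\<close>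
  define \<eta>0 where "\<eta>0 = (d / 2) / (2 * t)"
  have \<eta>0: "0 < \<eta>0" using d0 t by (simp add: \<eta>0_def)
  \<comment> \<open>The largest radius with \<open>(2 * T * s)\<^sup>2 \<le> \<tau> / 2\<close> for
    \<open>T = 2 * t\<close>.\<close>
  define s where "s = sqrt (\<tau> / 2) / (4 * t)"
  have sq1: "sqrt (Upsilon_fac 4 200 kb t) = max 1 (max (2 * sqrt 2 * t * sqrt kb) (2 * 200 * sqrt \<Lambda>))"
    unfolding Upsilon_fac_def \<Lambda>_def by (simp add: real_sqrt_abs)
  have log0: "0 \<le> log 4 q" using q(1) by simp
  have \<Lambda>: "1 + log 4 q \<le> \<Lambda>" "1 \<le> \<Lambda>"
  proof -
    have "1 * 1 \<le> sqrt 2 * t" using t by (intro mult_mono) auto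
    then have "q * 1 \<le> sqrt kb * (sqrt 2 * t)" using qkb q(1) kb by (intro mult_mono) auto
    then have "q \<le> sqrt kb * sqrt 2 * t" by (simp add: mult.assoc)
    then have "log 4 q \<le> log 4 (sqrt kb * sqrt 2 * t)" using q(1) by simp
    also have "\<dots> \<le> of_int \<lceil>log 4 (sqrt kb * sqrt 2 * t)\<rceil>" by (rule le_of_int_ceiling)
    finally show "1 + log 4 q \<le> \<Lambda>" unfolding \<Lambda>_def Lambda_fac_def by simp
    then show "1 \<le> \<Lambda>" using log0 by linarith
  qed
  \<comment> \<open>From the second member of the maximum in \<open>Upsilon_fac\<close>; it keeps
    all scales of the chain above \<open>2 * e\<close>.\<close>
  have dA: "600 * (2 * sqrt 2 * t * sqrt kb) * e \<le> d"
  proof -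
    have "600 * (2 * sqrt 2 * t * sqrt kb) * e \<le> 600 * sqrt (Upsilon_fac 4 200 kb t) * e"
      unfolding sq1 using e by (intro mult_right_mono mult_left_mono) auto
    then show ?thesis using d(2) unfolding e_def t_def by (rule order_trans)
  qed
  \<comment> \<open>From the third member; it makes the entropy of all refinements together small
    against \<open>m\<close>.\<close>
  have dB: "600 * (400 * sqrt \<Lambda>) * e \<le> d"
  proof -
    have "600 * (400 * sqrt \<Lambda>) * e \<le> 600 * sqrt (Upsilon_fac 4 200 kb t) * e"
      unfolding sq1 using e by (intro mult_right_mono mult_left_mono) auto
    then show ?thesis using d(2) unfolding e_def t_def by (rule order_trans)
  qed
  \<comment> \<open>The number of divisions by 4 that takes \<open>\<eta>0\<close> below
    \<open>s\<close>. A factor \<open>200 * q\<close> is enough because the tail exceeds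
    \<open>d\<^sup>2 / (20000 * \<kappa>)\<close>.\<close>
  define ell where "ell = nat \<lceil>log 4 (200 * q)\<rceil>"
  have logpos: "0 < log 4 (200 * q)" using q(1) by simp
  have ell1: "log 4 (200 * q) \<le> real ell" "real ell < log 4 (200 * q) + 1"
    using logpos by (simp_all add: ell_def) linarith+
  have ell0: "0 < ell" using ell1(1) logpos by linarith
  have powell: "200 * q \<le> 4 ^ ell"
    using ell1(1) q(1) by (simp add: log_le_iff powr_realpow)
  have pow: "4 ^ i \<le> 200 * q" if "i < ell" for i
  proof -
    have "real i \<le> log 4 (200 * q)" using that ell1(2) by linarith
    then show ?thesis using q(1) by (simp add: le_log_iff powr_realpow)
  qed
  \<comment> \<open>The factor 200 costs at most 4 refinements since \<open>200 \<le> 4 ^ 4\<close>,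
    and rounding up costs one more. Since \<open>\<Lambda> \<ge> 1 + log 4 q\<close>, the factor 5
    covers everything.\<close>
  have ell\<Lambda>: "real ell \<le> 5 * \<Lambda>"
  proof -
    have "log 4 (200 :: real) \<le> log 4 (4 ^ 4)" by simp
    also have "\<dots> = 4" by (subst log_nat_power) simp_all
    finally have "log 4 200 \<le> (4 :: real)" .
    moreover have "log 4 (200 * q) = log 4 200 + log 4 q" using q(1) by (intro log_mult_pos) auto
    ultimately have "log 4 (200 * q) \<le> 4 + log 4 q" by linarith
    then have "real ell \<le> 5 + log 4 q" using ell1(2) by linarith
    then show ?thesis using \<Lambda> log0 by linarith
  qed
  have sqrt2: "1.4 \<le> sqrt (2::real)" by (rule real_le_rsqrt) (simp add: power2_eq_square)
  \<comment> \<open>Only scales that are refined further matter, hence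
    \<open>4 ^ i \<le> 200 * q\<close>. The bound needs the constant 2 * 200 * 4 = 1600, and
    \<open>dA\<close> supplies 600 * 2 * 1.4 = 1680.\<close>
  have key: "2 * e \<le> \<eta>0 / 4 ^ i" if "i < ell" for i
  proof -
    have "1680 * (t * q) * e \<le> 600 * (2 * sqrt 2 * t * sqrt kb) * e"
    proof (rule mult_right_mono)
      have "1.4 * (t * q) \<le> sqrt 2 * (t * sqrt kb)" using sqrt2 t q qkb by (intro mult_mono) auto
      then show "1680 * (t * q) \<le> 600 * (2 * sqrt 2 * t * sqrt kb)" by (simp add: mult_ac)
    qed (use e in simp)
    then have "1680 * (t * q) * e \<le> d" using dA by linarith
    have a: "2 * e * 4 ^ i \<le> 2 * e * (200 * q)" using pow[OF that] e by (intro mult_left_mono) auto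
    have "2 * e * 4 ^ i * (4 * t) \<le> 2 * e * (200 * q) * (4 * t)" by (rule mult_right_mono[OF a]) (use t in simp)
    also have "\<dots> = 1600 * (t * q * e)" by simp
    also have "\<dots> \<le> 1680 * (t * q * e)" using t q(1) e by (intro mult_right_mono) auto
    also have "\<dots> = 1680 * (t * q) * e" by simp
    also have "\<dots> \<le> d" by fact
    finally have le: "2 * e * (4 ^ i * (4 * t)) \<le> d" by (simp only: mult.assoc)
    have pos: "0 < 4 ^ i * (4 * t)" using t by simp
    have eq: "\<eta>0 / 4 ^ i = d / (4 ^ i * (4 * t))" by (simp add: \<eta>0_def)
    show ?thesis using le by (simp only: eq pos_le_divide_eq[OF pos])
  qed
  have e2: "0 < 2 * e" using e by simp
  have "\<exists>A. finite A \<and> A \<subseteq> K \<and> card A \<le> local_packing 4 n K (2 * e) ^ ell \<and>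
    (\<forall>z\<in>K. enorm n z \<le> \<eta>0 \<longrightarrow> (\<exists>a\<in>A. edist n z a \<le> \<eta>0 / 4 ^ ell))"
    by (rule covering_chain[OF _ e2 \<eta>0]) (use key in auto)
  then obtain A where A: "finite A" "A \<subseteq> K" "card A \<le> local_packing 4 n K (2 * e) ^ ell"
    "\<forall>z\<in>K. enorm n z \<le> \<eta>0 \<longrightarrow> (\<exists>a\<in>A. edist n z a \<le> \<eta>0 / 4 ^ ell)" by (elim exE conjE)
  have sge: "\<eta>0 / 4 ^ ell \<le> s"
  proof -
    have "(d / (200 * q))\<^sup>2 = d\<^sup>2 / (40000 * \<kappa>)" using q(2) by (simp add: power_divide power_mult_distrib)
    also have "\<dots> \<le> \<tau> / 2" using \<tau> by simp
    finally have "d / (200 * q) \<le> sqrt (\<tau> / 2)" by (rule real_le_rsqrt)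
    moreover have "d / 4 ^ ell \<le> d / (200 * q)" using powell d0 q(1) by (intro divide_left_mono) auto
    ultimately have "d / 4 ^ ell / (4 * t) \<le> sqrt (\<tau> / 2) / (4 * t)" using t by (intro divide_right_mono) auto
    moreover have "\<eta>0 / 4 ^ ell = d / 4 ^ ell / (4 * t)" by (simp add: \<eta>0_def)
    ultimately show ?thesis unfolding s_def by linarith
  qed
  have low: "1 / 2 \<le> real (card A) * (1 / sqrt 2) ^ m"
  proof (rule covering_lower[where T = "2 * t" and D = "d / 2" and s = s and w = w and p = p and N = N and l = l and U = U and B = B])
    show "type2_bound n K (2 * t)" unfolding t_def by (rule type2_twice)
    show "(2 * (2 * t) * s)\<^sup>2 \<le> (\<Sum>a\<in>B. l a) / 2"
      using t \<tau>0 by (simp add: s_def \<tau>_def power_mult_distrib power_divide)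
    show "0 < (\<Sum>a\<in>B. l a)" using \<tau>0 by (simp add: \<tau>_def)
    show "A \<subseteq> Rn n" using A(2) K_Rn by auto
    show "1 \<le> 2 * t" "0 < d / 2" "0 \<le> s" using t d0 \<tau>0 by (simp_all add: s_def)
    fix z assume z: "z \<in> K" "enorm n z \<le> d / 2 / (2 * t)"
    then obtain a where "a \<in> A" "edist n z a \<le> \<eta>0 / 4 ^ ell" using A(4) unfolding \<eta>0_def by blast
    then show "\<exists>a\<in>A. edist n z a \<le> s" using sge by (intro bexI[of _ a]) auto
  qed (fact w p U cov l B m lB A)+
  let ?M = "local_packing 4 n K (2 * e)"
  have M1: "1 \<le> ?M" by (rule local_packing_ge_1[OF e2]) simp
  have "real (card A) \<le> real (?M ^ ell)" using A(3) of_nat_mono by blast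
  then have c: "real (card A) \<le> real ?M ^ ell" by (simp only: of_nat_power)
  have "1 / 2 \<le> real ?M ^ ell * (1 / sqrt 2) ^ m"
    by (rule order_trans[OF low mult_right_mono[OF c]]) simp
  then have "ln (1 / 2) \<le> ln (real ?M ^ ell * (1 / sqrt 2) ^ m)" using M1 by (subst ln_le_cancel_iff) auto
  also have "\<dots> = ln (real ?M ^ ell) + ln ((1 / sqrt 2) ^ m)"
    by (rule ln_mult_pos) (use M1 in auto)
  also have "\<dots> = real ell * ln (real ?M) - real m * ln 2 / 2"
    unfolding ln_inv_sqrt2_power using M1 by (simp add: ln_realpow)
  finally have 1: "real m * ln 2 / 2 - ln 2 \<le> real ell * ln (real ?M)" by (simp add: ln_div)
  \<comment> \<open>The scale is \<open>2 * e\<close> and not \<open>e\<close> because the entropy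
    inequality is reversed only strictly above the critical radius.\<close>
  have "ln (real ?M) < (2 * e)\<^sup>2 / \<sigma>\<^sup>2"
    by (rule above_eta_star[OF _ \<sigma>]) (use e e_def in auto)
  then have 2: "real ell * ln (real ?M) < real ell * ((2 * e)\<^sup>2 / \<sigma>\<^sup>2)"
    by (rule mult_strict_left_mono) (use ell0 in simp)
  \<comment> \<open>Uses \<open>d \<ge> 400 * \<sigma>\<close>. With \<open>m \<ge> 4\<close> the
    loss of \<open>ln 2\<close>, due to mass 1/2 in place of 1, is absorbed into half of the main
    term.\<close>
  have m4: "4 \<le> real m"
  proof -
    have "(400 * \<sigma>)\<^sup>2 \<le> d\<^sup>2" using d(1) \<sigma> by (intro power_mono) auto
    then have "4 \<le> d\<^sup>2 / (200\<^sup>2 * \<sigma>\<^sup>2)" using \<sigma> by (simp add: le_divide_eq power_mult_distrib)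
    then show ?thesis using m(1) by linarith
  qed
  have "real m / 4 * ln 2 \<le> real m * ln 2 / 2 - ln 2"
    using mult_right_mono[OF m4, of "ln 2"] by simp
  moreover have "real m / 4 * (2 / 3) \<le> real m / 4 * ln 2" using ln2_ge_two_thirds by (intro mult_left_mono) auto
  ultimately have 3: "real m / 6 < real ell * ((2 * e)\<^sup>2 / \<sigma>\<^sup>2)" using 1 2 by linarith
  have "real ell * (2 * e)\<^sup>2 \<le> 5 * \<Lambda> * (2 * e)\<^sup>2" using ell\<Lambda> by (intro mult_right_mono) auto
  also have "\<dots> = 20 * \<Lambda> * e\<^sup>2" by (simp add: power_mult_distrib)
  finally have 4: "real ell * (2 * e)\<^sup>2 \<le> 20 * \<Lambda> * e\<^sup>2" .
  \<comment> \<open>The squared form of \<open>dB\<close> puts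
    \<open>20 * \<Lambda> * e\<^sup>2\<close> below \<open>d\<^sup>2 / 240000\<close>. The number
    240000 is 6 times \<open>200\<^sup>2\<close>, which turns the bound into
    \<open>m / 6\<close>.\<close>
  have "(600 * (400 * sqrt \<Lambda>) * e)\<^sup>2 \<le> d\<^sup>2" using dB e \<Lambda> by (intro power_mono) auto
  then have "360000 * 160000 * (\<Lambda> * e\<^sup>2) \<le> d\<^sup>2" using \<Lambda> by (simp add: power_mult_distrib)
  moreover have "0 \<le> \<Lambda> * e\<^sup>2" using \<Lambda> by simp
  moreover have "20 * \<Lambda> * e\<^sup>2 = 20 * (\<Lambda> * e\<^sup>2)" by simp
  ultimately have "20 * \<Lambda> * e\<^sup>2 \<le> d\<^sup>2 / 240000" by linarith
  then have "real ell * (2 * e)\<^sup>2 / \<sigma>\<^sup>2 \<le> d\<^sup>2 / 240000 / \<sigma>\<^sup>2" using 4 by (intro divide_right_mono) auto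
  also have "\<dots> = d\<^sup>2 / (200\<^sup>2 * \<sigma>\<^sup>2) / 6" by simp
  also have "\<dots> \<le> real m / 6" using m(1) by simp
  finally show False using 3 by simp
qed

end

subsection \<open>Measurability and failure of the oracle calls\<close>

lemma measurable_coord2:
  fixes f :: "'a \<Rightarrow> rmat"
  assumes "f \<in> borel_measurable M"
  shows "(\<lambda>x. f x i j) \<in> borel_measurable M"
  using measurable_product_then_coordinatewise[OF measurable_product_then_coordinatewise[OF assms]] .

lemma measurable_rmatI:
  fixes f :: "'a \<Rightarrow> rmat"
  assumes "\<And>i j. (\<lambda>x. f x i j) \<in> borel_measurable M"
  shows "f \<in> borel_measurable M"
  by (rule measurable_coordinatewise_then_product, rule measurable_coordinatewise_then_product, rule assms)

lemma measurable_quad: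
  assumes "f \<in> borel_measurable M" "g \<in> borel_measurable M"
  shows "(\<lambda>x. quad n (f x) (g x)) \<in> borel_measurable M"
  unfolding quad_def
  by (intro borel_measurable_sum borel_measurable_times measurable_coord2[OF assms(1)]
      measurable_product_then_coordinatewise[OF assms(2)])

lemma measurable_enorm:
  assumes "g \<in> borel_measurable M"
  shows "(\<lambda>x. enorm n (g x)) \<in> borel_measurable M"
proof -
  have "(\<lambda>x. \<Sum>i<n. g x i * g x i) \<in> borel_measurable M"
    by (intro borel_measurable_sum borel_measurable_times measurable_product_then_coordinatewise[OF assms])
  then show ?thesis unfolding enorm_eq_sqrt ip_def by measurable
qed

lemma sdp_iterate_cong:
  "(\<And>i. i < k \<Longrightarrow> Q i = Q' i) \<Longrightarrow> sdp_iterate n m C \<kappa> Q k = sdp_iterate n m C \<kappa> Q' k"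
proof (induction k)
  case (Suc k)
  then have "sdp_iterate n m C \<kappa> Q k = sdp_iterate n m C \<kappa> Q' k" "Q k = Q' k" by auto
  then show ?case by simp
qed simp

text \<open>One round in isolation. The index \<open>j\<close> only selects the seeds
  \<open>s (j, k)\<close> that answer its calls.\<close>

locale sdp_oracle =
  fixes n m :: nat and C \<kappa> :: real and S :: "real measure" and K' :: "rvec set" and q :: real
    and Or :: "rmat \<Rightarrow> real \<Rightarrow> rvec" and j :: nat
  assumes n0: "0 < n" and mn: "m \<le> n" and C0: "0 < C" and S: "prob_space S"
    and orc: "qfm_oracle S n K' \<kappa> q Or" and cK: "compact K'" and KR: "K' \<subseteq> Rn n" and Kne: "K' \<noteq> {}"
begin

abbreviation Seeds :: "(nat \<times> nat \<Rightarrow> real) measure" where "Seeds \<equiv> PiM UNIV (\<lambda>_. S)"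

definition Q :: "(nat \<times> nat \<Rightarrow> real) \<Rightarrow> nat \<Rightarrow> rmat \<Rightarrow> rvec" where
  "Q s = (\<lambda>k Z. Or Z (s (j, k)))"

abbreviation It :: "nat \<Rightarrow> (nat \<times> nat \<Rightarrow> real) \<Rightarrow> rmat" where
  "It k s \<equiv> sdp_iterate n m C \<kappa> (Q s) k"

lemma k1: "1 \<le> \<kappa>"
  using orc by (simp add: qfm_oracle_def)

lemma Or_mem: "psd n Z \<Longrightarrow> s \<in> space S \<Longrightarrow> Or Z s \<in> K'"
  using orc by (simp add: qfm_oracle_def)

lemma seed: "s \<in> space Seeds \<Longrightarrow> s i \<in> space S"
  by (cases i) (auto simp: space_PiM PiE_iff)

lemma Q_mem: "s \<in> space Seeds \<Longrightarrow> psd n Z \<Longrightarrow> Q s k Z \<in> K'"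
  unfolding Q_def by (intro Or_mem seed)

lemma Q_Rn: "s \<in> space Seeds \<Longrightarrow> psd n Z \<Longrightarrow> Q s k Z \<in> Rn n"
  using Q_mem KR by blast

lemma It_fantope: "s \<in> space Seeds \<Longrightarrow> It k s \<in> fantope n m"
  by (rule sdp_iterate_fantope[OF mn n0 Q_Rn, of k]) simp_all

lemma It_psd: "s \<in> space Seeds \<Longrightarrow> psd n (It k s)"
  by (rule contr_psd[OF fantope_contr[OF It_fantope]])

section \<open>Measurability of the iterates\<close>

lemma measurable_answer:
  assumes "It k \<in> borel_measurable Seeds"
  shows "(\<lambda>s. Q s k (It k s)) \<in> borel_measurable Seeds"
proof -
  have "(\<lambda>s. (It k s, s (j, k))) \<in> measurable Seeds (borel \<Otimes>\<^sub>M S)"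
    by (intro measurable_Pair assms measurable_component_singleton) simp
  moreover have "(\<lambda>(X, s). Or X s) \<in> borel_measurable (borel \<Otimes>\<^sub>M S)"
    using orc by (simp add: qfm_oracle_def)
  ultimately show ?thesis
    using measurable_compose[of "\<lambda>s. (It k s, s (j, k))" Seeds "borel \<Otimes>\<^sub>M S" "\<lambda>(X, s). Or X s" borel]
    by (simp add: Q_def)
qed

lemma measurable_step:
  assumes "f \<in> borel_measurable M"
  shows "(\<lambda>s. sdp_step n C \<kappa> (f s)) \<in> borel_measurable M"
  unfolding sdp_step_def by (intro borel_measurable_divide borel_measurable_const borel_measurable_power measurable_enorm assms)

lemma measurable_It: "It k \<in> borel_measurable Seeds"
proof (induction k)
  case 0
  show ?case by simp
next
  case (Suc k)
  note p = measurable_answer[OF Suc]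
  let ?g = "\<lambda>s. sdp_step n C \<kappa> (Q s k (It k s))" and ?p = "\<lambda>s. Q s k (It k s)"
  let ?Y = "\<lambda>s i l. It k s i l - ?g s * (?p s i * ?p s l)"
  have Ym: "?Y \<in> borel_measurable Seeds"
    by (intro measurable_rmatI borel_measurable_diff borel_measurable_times measurable_coord2[OF Suc] measurable_step[OF p]
        measurable_product_then_coordinatewise[OF p])
  have "(\<lambda>Y. sdp_proj n m (sym_part n Y)) \<in> borel_measurable borel"
    by (rule borel_measurable_continuous_onI[OF continuous_sdp_proj_sym_part[OF mn n0]])
  then have "(\<lambda>s. sdp_proj n m (sym_part n (?Y s))) \<in> borel_measurable Seeds"
    by (rule measurable_compose[OF Ym])
  moreover have "It (Suc k) s = sdp_proj n m (sym_part n (?Y s))" if s: "s \<in> space Seeds" for s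
  proof -
    have X: "It k s \<in> Mn n" "mtrans (It k s) = It k s" using It_fantope[OF s] by (auto simp: fantope_def)
    have Xs: "It k s a b = It k s b a" for a b using X(2) by (metis mtrans_def)
    have pR: "?p s \<in> Rn n" by (rule Q_Rn[OF s It_psd[OF s]])
    have "?Y s \<in> Mn n" using X(1) pR by (auto simp: Mn_def Rn_def)
    moreover have "mtrans (?Y s) = ?Y s"
    proof (intro ext)
      fix a b
      show "mtrans (?Y s) a b = ?Y s a b" unfolding mtrans_def using Xs[of a b] by (simp add: mult.commute)
    qed
    ultimately have "sym_part n (?Y s) = ?Y s" by (rule sym_part_id)
    then show ?thesis by (simp add: Let_def sdp_update_eq_proj)
  qed
  ultimately show ?case by (simp cong: measurable_cong)
qed

abbreviation supq :: "rmat \<Rightarrow> real" where "supq X \<equiv> (SUP p\<in>K'. quad n X p)"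

text \<open>The supremum is over an uncountable set, but \<open>quad n X p\<close> is linear in
  \<open>X\<close>, so sublevel sets are intersections of closed sets and therefore closed.\<close>

lemma measurable_supq: "supq \<in> borel_measurable borel"
proof (subst borel_measurable_iff_le, intro allI)
  fix c
  have "{X \<in> space borel. supq X \<le> c} = (\<Inter>p\<in>K'. {X. quad n X p \<le> c})"
  proof -
    have "bdd_above (quad n X ` K')" for X
      by (rule bounded_imp_bdd_above[OF compact_imp_bounded[OF compact_continuous_image[OF continuous_on_quad cK]]])
    then show ?thesis using cSUP_le_iff[OF Kne] by auto
  qed
  also have "closed \<dots>"
  proof (intro closed_INT ballI closed_Collect_le continuous_on_const)
    fix p
    have e: "continuous_on UNIV (\<lambda>Y::rmat. Y a b)" for a b
      by (rule continuous_on_product_then_coordinatewise, rule continuous_on_coord)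
    show "continuous_on UNIV (\<lambda>X. quad n X p)"
      unfolding quad_def by (intro continuous_on_sum continuous_on_mult continuous_on_const e)
  qed
  finally show "{X \<in> space borel. supq X \<le> c} \<in> sets borel" by (rule borel_closed)
qed

section \<open>Probability that an oracle call fails\<close>

definition bad :: "nat \<Rightarrow> (nat \<times> nat \<Rightarrow> real) set" where
  "bad k = {s \<in> space Seeds. quad n (It k s) (Q s k (It k s)) < (1 / \<kappa>) * supq (It k s)}"

lemma bad_sets: "bad k \<in> sets Seeds"
  unfolding bad_def
  by (intro borel_measurable_less measurable_quad measurable_It measurable_answer borel_measurable_times borel_measurable_const
      measurable_compose[OF measurable_It measurable_supq])

lemma oracle_fail:
  assumes Z: "psd n Z"
  shows "emeasure S {x \<in> space S. quad n Z (Or Z x) < (1 / \<kappa>) * supq Z} \<le> ennreal q"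
proof -
  interpret S: prob_space S by (rule S)
  have Om: "Or Z \<in> borel_measurable S"
  proof -
    have "(\<lambda>x. (Z, x)) \<in> measurable S (borel \<Otimes>\<^sub>M S)" by simp
    moreover have "(\<lambda>(X, s). Or X s) \<in> borel_measurable (borel \<Otimes>\<^sub>M S)" using orc by (simp add: qfm_oracle_def)
    ultimately show ?thesis using measurable_compose[of "\<lambda>x. (Z, x)" S "borel \<Otimes>\<^sub>M S" "\<lambda>(X, s). Or X s" borel] by simp
  qed
  let ?G = "{x \<in> space S. quad n Z (Or Z x) \<ge> (1 / \<kappa>) * supq Z}"
  have qm: "(\<lambda>x. quad n Z (Or Z x)) \<in> borel_measurable S"
    by (intro measurable_quad borel_measurable_const Om)
  have Gm: "?G \<in> sets S" by (intro borel_measurable_le borel_measurable_const qm)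
  have "1 - q \<le> measure S ?G" using orc Z by (simp add: qfm_oracle_def)
  moreover have "{x \<in> space S. quad n Z (Or Z x) < (1 / \<kappa>) * supq Z} = space S - ?G" by auto
  ultimately show ?thesis
    using S.prob_compl[OF Gm] by (simp add: S.emeasure_eq_measure ennreal_leI)
qed

text \<open>The queried matrix is random, while the oracle guarantee is for a fixed input. The
  iterate depends only on the seeds of earlier calls, so splitting off the seed
  \<open>(j, k)\<close> by Fubini leaves a fixed input to a call with a fresh seed.\<close>

lemma bad_le: "emeasure Seeds (bad k) \<le> ennreal q"
proof -
  let ?i = "(j, k)" and ?I = "UNIV - {(j, k)}"
  let ?M = "PiM ?I (\<lambda>_::nat \<times> nat. S)"
  interpret S: prob_space S by (rule S)
  interpret M: prob_space ?M by (intro prob_space_PiM S)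
  interpret P: pair_prob_space S ?M ..
  have ins: "insert ?i ?I = UNIV" by auto
  have D: "distr (S \<Otimes>\<^sub>M ?M) Seeds (\<lambda>(x, X). X(?i := x)) = Seeds"
    using distr_pair_PiM_eq_PiM[of ?I "\<lambda>_. S" ?i] S unfolding ins by simp
  have fm: "(\<lambda>(x, X). X(?i := x)) \<in> measurable (S \<Otimes>\<^sub>M ?M) Seeds"
  proof -
    have "(\<lambda>z. (snd z)(?i := fst z)) \<in> measurable (S \<Otimes>\<^sub>M ?M) (PiM (insert ?i ?I) (\<lambda>_. S))"
      by (rule measurable_fun_upd[where J = ?I]) auto
    then show ?thesis unfolding ins by (simp add: case_prod_unfold)
  qed
  have "emeasure Seeds (bad k) = emeasure (distr (S \<Otimes>\<^sub>M ?M) Seeds (\<lambda>(x, X). X(?i := x))) (bad k)" by (simp only: D)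
  also have "\<dots> = emeasure (S \<Otimes>\<^sub>M ?M) ((\<lambda>(x, X). X(?i := x)) -` bad k \<inter> space (S \<Otimes>\<^sub>M ?M))"
    by (rule emeasure_distr[OF fm bad_sets])
  also have "\<dots> = (\<integral>\<^sup>+X. emeasure S ((\<lambda>x. (x, X)) -` ((\<lambda>(x, X). X(?i := x)) -` bad k \<inter> space (S \<Otimes>\<^sub>M ?M))) \<partial>?M)"
    by (rule P.emeasure_pair_measure_alt2[OF measurable_sets[OF fm bad_sets]])
  also have "\<dots> \<le> (\<integral>\<^sup>+X. ennreal q \<partial>?M)"
  proof (rule nn_integral_mono)
    fix X assume X: "X \<in> space ?M"
    obtain x0 where x0: "x0 \<in> space S" using S.not_empty by blast
    have upd: "X(?i := x) \<in> space Seeds" if "x \<in> space S" for x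
      using X that by (auto simp: space_PiM PiE_iff)
    define Z where "Z = It k (X(?i := x0))"
    have Zeq: "It k (X(?i := x)) = Z" for x
      \<comment> \<open>The iterate number \<open>k\<close> uses the answers of the calls before
        \<open>k\<close> only, so replacing the seed \<open>(j, k)\<close> does not change
        it.\<close>
      unfolding Z_def by (rule sdp_iterate_cong) (simp add: Q_def)
    have "(\<lambda>x. (x, X)) -` ((\<lambda>(x, X). X(?i := x)) -` bad k \<inter> space (S \<Otimes>\<^sub>M ?M))
        = {x \<in> space S. quad n Z (Or Z x) < (1 / \<kappa>) * supq Z}"
    proof -
      have Qeq: "Q (X(?i := x)) k W = Or W x" for x W by (simp add: Q_def)
      show ?thesis using X upd by (auto simp: bad_def Zeq Qeq space_pair_measure simp del: fun_upd_apply)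
    qed
    moreover have "psd n Z" unfolding Z_def by (rule It_psd[OF upd[OF x0]])
    ultimately show "emeasure S ((\<lambda>x. (x, X)) -` ((\<lambda>(x, X). X(?i := x)) -` bad k \<inter> space (S \<Otimes>\<^sub>M ?M))) \<le> ennreal q"
      using oracle_fail by simp
  qed
  also have "\<dots> = ennreal q" by (simp add: M.emeasure_space_1)
  finally show ?thesis .
qed

abbreviation Nit :: nat where "Nit \<equiv> sdp_iters n m C \<kappa>"

definition fails :: "(nat \<times> nat \<Rightarrow> real) set" where "fails = (\<Union>k<Nit. bad k)"

lemma fails_sets: "fails \<in> sets Seeds"
  unfolding fails_def using bad_sets by auto

text \<open>Union bound over the calls. The maximum appears because \<open>ennreal q\<close> is 0
  for negative \<open>q\<close>.\<close>

lemma fails_le: "measure Seeds fails \<le> real Nit * max 0 q"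
proof -
  interpret P: prob_space Seeds by (intro prob_space_PiM S)
  have "measure Seeds (bad k) \<le> max 0 q" for k
    unfolding measure_def by (rule enn2real_leI) (use bad_le[of k] in \<open>auto simp: max_def ennreal_neg intro: order_trans\<close>)
  then have "(\<Sum>k<Nit. measure Seeds (bad k)) \<le> real Nit * max 0 q"
    using sum_mono[of "{..<Nit}" "\<lambda>k. measure Seeds (bad k)" "\<lambda>_. max 0 q"] by simp
  moreover have "measure Seeds fails \<le> (\<Sum>k<Nit. measure Seeds (bad k))"
    unfolding fails_def by (rule P.finite_measure_subadditive_finite) (use bad_sets in auto)
  ultimately show ?thesis by linarith
qed

section \<open>Measurability of the SDP output and of its square root\<close>

definition Xss :: "(nat \<times> nat \<Rightarrow> real) \<Rightarrow> rmat" where "Xss s = SDP n m C \<kappa> (Q s)"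

lemma Xss_contr: "s \<in> space Seeds \<Longrightarrow> contr n (Xss s)"
  unfolding Xss_def by (rule SDP_contr[OF mn n0 k1 Q_Rn])

lemma measurable_Xss: "Xss \<in> borel_measurable Seeds"
proof (cases "m = n")
  case True
  then show ?thesis unfolding Xss_def SDP_def by simp
next
  case False
  have g: "(\<lambda>s. sdp_step n C \<kappa> (Q s k (It k s))) \<in> borel_measurable Seeds" for k
    by (rule measurable_step[OF measurable_answer[OF measurable_It]])
  show ?thesis
    unfolding Xss_def SDP_def using False
    by (simp add: Let_def) (intro measurable_rmatI borel_measurable_divide borel_measurable_sum borel_measurable_times g measurable_coord2[OF measurable_It])
qed

definition Ass :: "(nat \<times> nat \<Rightarrow> real) \<Rightarrow> rmat" where "Ass s = comp_sqrt n (Xss s)"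

lemma measurable_Ass: "Ass \<in> borel_measurable Seeds"
proof -
  have z: "(\<lambda>s. sqrt_iter n (Xss s) k) \<in> borel_measurable Seeds" for k
  proof (induction k)
    case (Suc k)
    show ?case
      unfolding sqrt_iter.simps matmul_def
      by (intro measurable_rmatI borel_measurable_divide borel_measurable_add borel_measurable_sum borel_measurable_times
          borel_measurable_const measurable_coord2[OF Suc] measurable_coord2[OF measurable_Xss])
  qed simp
  have "(\<lambda>s i l. idm n i l - lim (\<lambda>k. sqrt_iter n (Xss s) k i l)) \<in> borel_measurable Seeds"
    by (intro measurable_rmatI borel_measurable_diff borel_measurable_const borel_measurable_lim_metric measurable_coord2[OF z])
  moreover have "Ass s = (\<lambda>i l. idm n i l - lim (\<lambda>k. sqrt_iter n (Xss s) k i l))" if "s \<in> space Seeds" for s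
    unfolding Ass_def by (intro ext comp_sqrt_limit Xss_contr that)
  ultimately show ?thesis by (simp cong: measurable_cong)
qed

end

text \<open>Supplies the weights for \<open>subgaussian_quadratic_mgf\<close>: they lie in the unit
  interval and add up to \<open>m\<close>, so the transformed noise is as small as
  \<open>m\<close>-dimensional noise.\<close>

lemma fantope_noise_mgf:
  assumes "X \<in> fantope n m"
  obtains U x where "orthogonal_mat n U" "\<forall>a<n. 0 \<le> x a \<and> x a \<le> 1" "(\<Sum>a<n. 1 - x a) = real m"
    "\<And>y. (enorm n (matvec n (comp_sqrt n X) y))\<^sup>2 = (\<Sum>a<n. (1 - x a) * (ip n (col U a) y)\<^sup>2)"
proof -
  obtain U x where U: "orthogonal_mat n U" "X = spec n U x" and x: "\<forall>a<n. 0 \<le> x a \<and> x a \<le> 1"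
    using contr_spec[OF fantope_contr[OF assms]] .
  have "(\<Sum>a<n. x a) = real n - real m"
    using assms tr_spec[OF U(1), of x] by (simp add: fantope_def U(2))
  then have s: "(\<Sum>a<n. 1 - x a) = real m" by (simp add: sum_subtractf)
  have "(enorm n (matvec n (comp_sqrt n X) y))\<^sup>2 = (\<Sum>a<n. (1 - x a) * (ip n (col U a) y)\<^sup>2)" for y
    unfolding U(2) comp_sqrt_spec[OF U(1) x] enorm_sq norm_matvec_spec[OF U(1)]
    by (intro sum.cong refl) (use x in simp)
  then show ?thesis by (rule that[OF U(1) x s])
qed

subsection \<open>The estimator\<close>

text \<open>With this choice every round halves the radius \<open>dtil\<close>.\<close>

definition L0 :: real where "L0 = 4 * (sqrt 3 + 1)\<^sup>2"

lemma Ltil_L0: "Ltil L0 = 4 * (sqrt 3 + 1)"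
proof -
  have "sqrt 3 + 1 \<noteq> (0::real)" using real_sqrt_ge_zero[of 3] by linarith
  then show ?thesis by (simp add: Ltil_def L0_def power2_eq_square)
qed

lemma sqrt3: "173 / 100 \<le> sqrt (3::real)"
  by (rule real_le_rsqrt) (simp add: power2_eq_square)

lemma L0_pos: "0 < L0" and Ltil_L0_pos: "0 < Ltil L0"
proof -
  have "0 < sqrt 3 + (1::real)" using sqrt3 by linarith
  then show "0 < L0" "0 < Ltil L0" unfolding Ltil_L0 by (simp_all add: L0_def)
qed

lemma dtil_L0: "dtil L0 R j = 2 * R / 2 ^ j"
proof (induction j)
  case (Suc j)
  have s: "sqrt 3 + 1 \<noteq> (0::real)" using sqrt3 by linarith
  have "2 * (sqrt 3 + 1) * x / Ltil L0 = x / 2" for x :: real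
    unfolding Ltil_L0 using s by (simp add: field_simps)
  then have "dtil L0 R (Suc j) = dtil L0 R j / 2" by (simp only: dtil.simps)
  then show ?case by (simp add: Suc)
qed simp

lemma dtil_half: "dtil L0 R (Suc j) = dtil L0 R j / 2"
  by (simp add: dtil_L0 del: dtil.simps)

lemma sum_inverse_dtil:
  assumes "0 < R"
  shows "(\<Sum>j<Suc J. 1 / dtil L0 R j) \<le> 2 / dtil L0 R J"
proof (induction J)
  case 0
  show ?case using assms by (simp add: field_simps)
next
  case (Suc J)
  have "2 / dtil L0 R J + 1 / dtil L0 R (Suc J) = 2 / dtil L0 R (Suc J)"
    using assms by (simp add: dtil_L0 field_simps del: dtil.simps)
  then show ?case using Suc unfolding sum.lessThan_Suc[of _ "Suc J"] by linarith
qed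

lemma sum_dtil:
  "J \<le> e \<Longrightarrow> (\<Sum>i=J..<e. 3 * dtil L0 R i) = 6 * dtil L0 R J - 6 * dtil L0 R e"
proof (induction e)
  case (Suc e)
  show ?case
  proof (cases "J = Suc e")
    case False
    then have "J \<le> e" using Suc.prems by simp
    then have "(\<Sum>i=J..<Suc e. 3 * dtil L0 R i) = (\<Sum>i=J..<e. 3 * dtil L0 R i) + 3 * dtil L0 R e" by simp
    then show ?thesis using Suc.IH[OF \<open>J \<le> e\<close>] unfolding dtil_half by linarith
  qed simp
qed simp

lemma ecball_closed: "closed (ecball n x s)"
proof -
  have "ecball n x s = Rn n \<inter> {y. edist n x y \<le> s}" by (auto simp: ecball_def)
  moreover have "closed {y. edist n x y \<le> s}"
    by (intro closed_Collect_le continuous_on_edist continuous_on_const continuous_on_id)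
  ultimately show ?thesis using closed_Int[OF closed_Rn] by (simp only:)
qed

lemma enorm_diff_le: "edist n x y \<le> enorm n x + enorm n y"
  using edist_triangle[of n x y "\<lambda>_. 0"] edist_commute[of n "\<lambda>_. 0" y] by (simp add: edist_def)

lemma weak_projection_le:
  assumes "weak_projection n P" "convex_body n K'" "0 < \<epsilon>" "z \<in> Rn n"
  shows "P K' \<epsilon> z \<in> K'" "x \<in> K' \<Longrightarrow> edist n z (P K' \<epsilon> z) \<le> edist n z x + \<epsilon>" "P K' \<epsilon> \<in> borel_measurable borel"
proof -
  show "P K' \<epsilon> z \<in> K'" "P K' \<epsilon> \<in> borel_measurable borel" using assms by (auto simp: weak_projection_def)
  assume x: "x \<in> K'"
  have "(INF x\<in>K'. edist n z x) \<le> edist n z x"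
    by (rule cINF_lower[OF _ x]) (rule bdd_belowI2[of _ 0], simp)
  moreover have "edist n z (P K' \<epsilon> z) \<le> (INF x\<in>K'. edist n z x) + \<epsilon>"
    using assms by (simp add: weak_projection_def)
  ultimately show "edist n z (P K' \<epsilon> z) \<le> edist n z x + \<epsilon>" by linarith
qed

context symmetric_body
begin

section \<open>Truncated bodies and the effect of one round\<close>

lemma convex_body_truncated:
  assumes "0 < d"
  shows "convex_body n (K \<inter> ecball n (\<lambda>_. 0) d)"
  unfolding convex_body_def
proof (intro conjI ballI)
  show "K \<inter> ecball n (\<lambda>_. 0) d \<subseteq> Rn n" using K_Rn by auto
  show "compact (K \<inter> ecball n (\<lambda>_. 0) d)" by (rule compact_Int_closed[OF K_compact ecball_closed])
  show "\<exists>x\<in>Rn n. \<exists>e>0. ecball n x e \<subseteq> K \<inter> ecball n (\<lambda>_. 0) d"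
    by (rule bexI[OF _ Rn_zero], rule exI[of _ "min r d"]) (use r0 assms ball_mem in \<open>auto simp: ecball_def\<close>)
next
  fix x y and t :: real assume xy: "x \<in> K \<inter> ecball n (\<lambda>_. 0) d" "y \<in> K \<inter> ecball n (\<lambda>_. 0) d" and t: "t \<in> {0..1}"
  let ?z = "\<lambda>i. (1 - t) * x i + t * y i"
  have z: "?z \<in> K" using xy t by (intro K_convex) auto
  have "enorm n ?z \<le> \<bar>1 - t\<bar> * enorm n x + \<bar>t\<bar> * enorm n y"
    using enorm_triangle[of n "\<lambda>i. (1 - t) * x i" "\<lambda>i. t * y i"] by (simp add: enorm_scale)
  also have "\<dots> \<le> (1 - t) * d + t * d"
    using xy t by (intro add_mono mult_mono) (auto simp: ecball_def)
  finally have "enorm n ?z \<le> d" by (simp add: algebra_simps)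
  then show "?z \<in> K \<inter> ecball n (\<lambda>_. 0) d" using z K_Rn[OF z] by (simp add: ecball_def)
qed

lemma dtil_pos: "0 < dtil L0 R j"
  using R0 by (simp add: dtil_L0)

lemma body_convex: "convex_body n (body n L0 K R j)"
  using cb convex_body_truncated[of "dtil L0 R j / 2"] dtil_pos[of j] by (simp add: body_def)

lemma body_sub: "body n L0 K R j \<subseteq> K"
  by (auto simp: body_def)

text \<open>For \<open>j = 0\<close> there is no truncation, and half of the initial radius
  \<open>2 * R\<close> is the outer radius of \<open>K\<close>.\<close>

lemma body_le: "x \<in> body n L0 K R j \<Longrightarrow> enorm n x \<le> dtil L0 R j / 2"
  using K_le[of x] by (cases "j = 0") (auto simp: body_def ecball_def)

lemma body_mem: "x \<in> K \<Longrightarrow> enorm n x \<le> dtil L0 R j / 2 \<Longrightarrow> x \<in> body n L0 K R j"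
  using K_Rn[of x] by (auto simp: body_def ecball_def)

lemma body_inner: "ecball n (\<lambda>_. 0) (min r (dtil L0 R j / 2)) \<subseteq> body n L0 K R j"
  using ball_mem by (auto simp: ecball_def intro!: body_mem)

lemma body_zero: "(\<lambda>_. 0) \<in> body n L0 K R j"
  using dtil_pos[of j] by (intro body_mem zero_mem) simp

text \<open>The projection \<open>b\<close> estimates \<open>(\<mu> - h) / 2\<close>, which lies in
  \<open>K\<close> by symmetry and convexity, and in the truncated body once \<open>h\<close> is
  within \<open>d\<close> of \<open>\<mu>\<close>. Then \<open>2 b + h\<close> estimates
  \<open>\<mu>\<close>. The bound on the displacement needs no accuracy of \<open>z\<close>.\<close>

lemma step_displacement:
  fixes P :: "rvec set \<Rightarrow> real \<Rightarrow> rvec \<Rightarrow> rvec" and h z :: rvec and j :: nat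
  assumes P: "weak_projection n P" and h: "h \<in> K" and z: "z \<in> Rn n"
  defines "d \<equiv> dtil L0 R j"
  defines "b \<equiv> P (body n L0 K R j) (d / L0) z"
  defines "h' \<equiv> P K (2 * d / Ltil L0) (\<lambda>i. 2 * b i + h i)"
  shows "h' \<in> K" "edist n h' h \<le> 3 * d"
    and "\<mu> \<in> K \<Longrightarrow> edist n h \<mu> \<le> d \<Longrightarrow> edist n z (\<lambda>i. (\<mu> i - h i) / 2) \<le> d / 48 \<Longrightarrow> edist n h' \<mu> \<le> d / 2"
proof -
  have d: "0 < d" unfolding d_def by (rule dtil_pos)
  have e1: "0 < d / L0" and e2: "0 < 2 * d / Ltil L0" using d L0_pos Ltil_L0_pos by auto
  have b: "b \<in> body n L0 K R j" unfolding b_def by (rule weak_projection_le(1)[OF P body_convex e1 z])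
  then have bK: "b \<in> K" and bn: "enorm n b \<le> d / 2" using body_sub body_le by (auto simp: d_def)
  let ?w = "\<lambda>i. 2 * b i + h i"
  have w: "?w \<in> Rn n" by (intro Rn_add Rn_scale K_Rn bK h)
  show hK: "h' \<in> K" unfolding h'_def by (rule weak_projection_le(1)[OF P cb e2 w])
  have le: "edist n ?w h' \<le> edist n ?w x + 2 * d / Ltil L0" if "x \<in> K" for x
    unfolding h'_def by (rule weak_projection_le(2)[OF P cb e2 w that])
  have "edist n ?w h = 2 * enorm n b" by (simp add: edist_def enorm_scale)
  then have wh: "edist n ?w h \<le> d" using bn by simp
  \<comment> \<open>From \<open>sqrt 3 \<ge> 1.73\<close>, since
    \<open>Ltil L0 = 4 * (sqrt 3 + 1)\<close> is at least 10.92.\<close>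
  have Lt: "2 * d / Ltil L0 \<le> 184 / 1000 * d"
  proof -
    have "2 / Ltil L0 \<le> 2 / (1092 / 100)" unfolding Ltil_L0 using sqrt3 by (intro frac_le) auto
    also have "\<dots> \<le> 184 / 1000" by simp
    finally show ?thesis using mult_right_mono[of "2 / Ltil L0" "184 / 1000" d] d by simp
  qed
  have L0': "d / L0 \<le> 336 / 10000 * d"
  proof -
    have "(273 / 100)\<^sup>2 \<le> (sqrt 3 + (1::real))\<^sup>2" using sqrt3 by (intro power_mono) auto
    then have "298 / 10 \<le> L0" unfolding L0_def by (simp add: power2_eq_square)
    then have "1 / L0 \<le> 1 / (298 / 10)" by (intro frac_le) auto
    also have "\<dots> \<le> 336 / 10000" by simp
    finally show ?thesis using mult_right_mono[of "1 / L0" "336 / 10000" d] d by simp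
  qed
  have "edist n h' h \<le> edist n ?w h' + edist n ?w h"
    using edist_triangle[of n h' h ?w] by (simp add: edist_commute[of n h' ?w])
  then show "edist n h' h \<le> 3 * d" using le[OF h] wh Lt d by linarith
  assume \<mu>: "\<mu> \<in> K" and hd: "edist n h \<mu> \<le> d" and zp: "edist n z (\<lambda>i. (\<mu> i - h i) / 2) \<le> d / 48"
  let ?p = "\<lambda>i. (\<mu> i - h i) / 2"
  have "enorm n ?p = edist n \<mu> h / 2"
    using enorm_scale[of n "1/2" "\<lambda>i. \<mu> i - h i"] by (simp add: edist_def)
  then have "?p \<in> body n L0 K R j"
    using hd by (intro body_mem K_half_diff \<mu> h) (simp add: d_def edist_commute)
  then have "edist n z b \<le> edist n z ?p + d / L0"
    unfolding b_def by (rule weak_projection_le(2)[OF P body_convex e1 z])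
  moreover have "edist n b ?p \<le> edist n z b + edist n z ?p"
    using edist_triangle[of n b ?p z] by (simp add: edist_commute[of n b z])
  ultimately have bp: "edist n b ?p \<le> d / 48 + d / 48 + 336 / 10000 * d" using zp L0' by linarith
  have "(\<lambda>i. ?w i - \<mu> i) = (\<lambda>i. 2 * (b i - ?p i))" by (rule ext) (simp add: field_simps)
  then have "edist n ?w \<mu> = enorm n (\<lambda>i. 2 * (b i - ?p i))" by (simp only: edist_def)
  also have "\<dots> = 2 * edist n b ?p" unfolding enorm_scale edist_def by simp
  finally have "edist n ?w \<mu> = 2 * edist n b ?p" .
  moreover have "edist n h' \<mu> \<le> edist n ?w h' + edist n ?w \<mu>"
    using edist_triangle[of n h' \<mu> ?w] by (simp add: edist_commute[of n h' ?w])
  \<comment> \<open>The error budget: 4 * (1/48 + 1/48 + 0.0336) + 0.184 is below 1/2. This is where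
    the tolerance 1/48 comes from.\<close>
  ultimately show "edist n h' \<mu> \<le> d / 2" using le[OF \<mu>] bp Lt d by linarith
qed

end

text \<open>Chernoff with \<open>subgaussian_quadratic_mgf\<close>. The expected size
  \<open>m / 2\<close> of the exponent is small against the level \<open>E\<close> since
  \<open>C = 200\<close> is well above 48, so the bound decays exponentially in
  \<open>d^2 / \<sigma>^2\<close>; only a fourth power of \<open>\<sigma> / d\<close> is
  kept.\<close>

lemma subgaussian_noise_tail:
  assumes \<nu>: "prob_space \<nu>" "sets \<nu> = sets borel" and sg: "subgaussian_bound \<nu> (\<sigma>\<^sup>2)" and \<sigma>: "0 < \<sigma>"
    and X: "X \<in> fantope n m" and d: "400 * \<sigma> \<le> d" and m: "real m \<le> d\<^sup>2 / (200\<^sup>2 * \<sigma>\<^sup>2) + 1"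
  shows "emeasure (PiM {..<n} (\<lambda>_. \<nu>)) {\<xi> \<in> space (PiM {..<n} (\<lambda>_. \<nu>)). d / 48 < enorm n (matvec n (comp_sqrt n X) \<xi>)}
    \<le> ennreal (8 * 10 ^ 8 * \<sigma> ^ 4 / d ^ 4)"
proof -
  let ?P = "PiM {..<n} (\<lambda>_. \<nu>)"
  interpret P: prob_space ?P by (intro prob_space_PiM \<nu>)
  note [measurable_cong] = \<nu>(2)
  obtain U x where U: "orthogonal_mat n U" and x: "\<forall>a<n. 0 \<le> x a \<and> x a \<le> 1" and sx: "(\<Sum>a<n. 1 - x a) = real m"
    and nrm: "\<And>y. (enorm n (matvec n (comp_sqrt n X) y))\<^sup>2 = (\<Sum>a<n. (1 - x a) * (ip n (col U a) y)\<^sup>2)"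
    using fantope_noise_mgf[OF X] by blast
  let ?F = "\<lambda>\<xi>. ennreal (exp ((\<Sum>a<n. (1 - x a) * (ip n (col U a) \<xi>)\<^sup>2) / (4 * \<sigma>\<^sup>2)))"
  have d0: "0 < d" using d \<sigma> by linarith
  \<comment> \<open>The level \<open>(d / 48)\<^sup>2\<close> divided by
    \<open>4 * \<sigma>\<^sup>2\<close>; 9216 is 4 times the square of 48.\<close>
  define E where "E = d\<^sup>2 / (9216 * \<sigma>\<^sup>2)"
  have Fm: "?F \<in> borel_measurable ?P" unfolding ip_def by measurable
  have mgf: "(\<integral>\<^sup>+\<xi>. ?F \<xi> \<partial>?P) \<le> ennreal (exp (real m / 2))"
    using subgaussian_quadratic_mgf[OF \<nu> sg \<sigma> U, of "\<lambda>a. 1 - x a"] x unfolding sx by simp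
  have "emeasure ?P {\<xi> \<in> space ?P. d / 48 < enorm n (matvec n (comp_sqrt n X) \<xi>)}
     \<le> emeasure ?P {\<xi> \<in> space ?P. 1 \<le> ennreal (exp (- E)) * ?F \<xi>}"
  proof (rule emeasure_mono)
    show "{\<xi> \<in> space ?P. 1 \<le> ennreal (exp (- E)) * ?F \<xi>} \<in> sets ?P" using Fm by measurable
    show "{\<xi> \<in> space ?P. d / 48 < enorm n (matvec n (comp_sqrt n X) \<xi>)} \<subseteq> {\<xi> \<in> space ?P. 1 \<le> ennreal (exp (- E)) * ?F \<xi>}"
    proof
      fix \<xi> assume "\<xi> \<in> {\<xi> \<in> space ?P. d / 48 < enorm n (matvec n (comp_sqrt n X) \<xi>)}"
      then have \<xi>: "\<xi> \<in> space ?P" "d / 48 < enorm n (matvec n (comp_sqrt n X) \<xi>)" by auto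
      have "(d / 48)\<^sup>2 \<le> (enorm n (matvec n (comp_sqrt n X) \<xi>))\<^sup>2" using \<xi>(2) d0 by (intro power_mono) auto
      then have "(d / 48)\<^sup>2 / (4 * \<sigma>\<^sup>2) \<le> (\<Sum>a<n. (1 - x a) * (ip n (col U a) \<xi>)\<^sup>2) / (4 * \<sigma>\<^sup>2)"
        unfolding nrm by (rule divide_right_mono) simp
      moreover have "(d / 48)\<^sup>2 / (4 * \<sigma>\<^sup>2) = E" by (simp add: E_def power_divide)
      ultimately have "1 \<le> exp (- E) * exp ((\<Sum>a<n. (1 - x a) * (ip n (col U a) \<xi>)\<^sup>2) / (4 * \<sigma>\<^sup>2))"
        by (simp flip: exp_add)
      then have "ennreal 1 \<le> ennreal (exp (- E)) * ?F \<xi>"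
        by (subst ennreal_mult[symmetric]) (auto intro!: ennreal_leI)
      then show "\<xi> \<in> {\<xi> \<in> space ?P. 1 \<le> ennreal (exp (- E)) * ?F \<xi>}" using \<xi>(1) by simp
    qed
  qed
  also have "\<dots> \<le> ennreal (exp (- E)) * (\<integral>\<^sup>+\<xi>. ?F \<xi> * indicator (space ?P) \<xi> \<partial>?P)"
    by (rule nn_integral_Markov_inequality) (use Fm in measurable)
  also have "(\<integral>\<^sup>+\<xi>. ?F \<xi> * indicator (space ?P) \<xi> \<partial>?P) = (\<integral>\<^sup>+\<xi>. ?F \<xi> \<partial>?P)"
    by (rule nn_integral_cong) simp
  also have "ennreal (exp (- E)) * \<dots> \<le> ennreal (exp (- E)) * ennreal (exp (real m / 2))"
    by (rule mult_left_mono[OF mgf]) simp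
  also have "\<dots> = ennreal (exp (real m / 2 - E))" by (simp add: ennreal_mult[symmetric] exp_add[symmetric])
  also have "\<dots> \<le> ennreal (8 * 10 ^ 8 * \<sigma> ^ 4 / d ^ 4)"
  proof (rule ennreal_leI)
    define y where "y = d\<^sup>2 / \<sigma>\<^sup>2"
    have "(400 * \<sigma>)\<^sup>2 \<le> d\<^sup>2" using d \<sigma> by (intro power_mono) auto
    then have y: "160000 \<le> y" using \<sigma> by (simp add: y_def le_divide_eq power_mult_distrib)
    have my: "real m \<le> y / 40000 + 1" using m \<sigma> by (simp add: y_def)
    have Ey: "E = y / 9216" by (simp add: E_def y_def)
    \<comment> \<open>The lower bound on \<open>y\<close>, that is
      \<open>d \<ge> 400 * \<sigma>\<close>, absorbs the unit lost by rounding \<open>m\<close>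
      up.\<close>
    have "real m / 2 - E \<le> - (y / 20000)" using my y unfolding Ey by linarith
    then have "exp (real m / 2 - E) \<le> exp (- (y / 20000))" by simp
    also have "\<dots> \<le> 2 / (y / 20000)\<^sup>2"
    proof -
      have "1 + y / 20000 + (y / 20000)\<^sup>2 / 2 \<le> exp (y / 20000)" using y by (intro exp_lower_Taylor_quadratic) simp
      then have "(y / 20000)\<^sup>2 / 2 \<le> exp (y / 20000)" using y by linarith
      then have "1 / exp (y / 20000) \<le> 1 / ((y / 20000)\<^sup>2 / 2)" using y by (intro divide_left_mono) auto
      then show ?thesis by (simp add: exp_minus inverse_eq_divide)
    qed
    also have "\<dots> = 8 * 10 ^ 8 / y\<^sup>2" by (simp add: power_divide)
    also have "y\<^sup>2 = d ^ 4 / \<sigma> ^ 4" by (simp add: y_def power_divide flip: power_mult)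
    finally show "exp (real m / 2 - E) \<le> 8 * 10 ^ 8 * \<sigma> ^ 4 / d ^ 4" by simp
  qed
  finally show ?thesis .
qed

text \<open>The pointwise bound \<open>y\<^sup>2 \<le> exp y + exp (- y)\<close> at
  \<open>y = x / \<sigma>\<close>, where each exponential has mean at most
  \<open>exp (1 / 2) \<le> 2\<close>.\<close>

lemma subgaussian_second_moment:
  assumes "prob_space \<nu>" "sets \<nu> = sets borel" and sg: "subgaussian_bound \<nu> (\<sigma>\<^sup>2)" and \<sigma>: "0 < \<sigma>"
  shows "(\<integral>\<^sup>+x. ennreal (x\<^sup>2) \<partial>\<nu>) \<le> ennreal (4 * \<sigma>\<^sup>2)"
proof -
  note [measurable_cong] = assms(2)
  have pt: "y\<^sup>2 \<le> exp y + exp (- y)" for y :: real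
  proof -
    have "z\<^sup>2 \<le> exp z + exp (- z)" if "0 \<le> z" for z :: real
    proof -
      have "1 + z + z\<^sup>2 / 2 \<le> exp z" using that by (rule exp_lower_Taylor_quadratic)
      moreover have "1 - z \<le> exp (- z)" using exp_ge_add_one_self[of "- z"] by simp
      moreover have "exp z * exp (- z) = 1" by (simp flip: exp_add)
      ultimately show ?thesis
      proof -
        assume a: "1 + z + z\<^sup>2 / 2 \<le> exp z" and b: "1 - z \<le> exp (- z)"
        show "z\<^sup>2 \<le> exp z + exp (- z)"
        proof (cases "z \<le> 2")
          case True
          then have "z * z \<le> 2 * z" using that by (intro mult_right_mono)
          then show ?thesis using a b True unfolding power2_eq_square by linarith
        next
          case False
          have "1 + z / 2 + (z / 2)\<^sup>2 / 2 \<le> exp (z / 2)" using that by (intro exp_lower_Taylor_quadratic) simp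
          moreover have "z \<le> 1 + z / 2 + (z / 2)\<^sup>2 / 2"
            using zero_le_power2[of "z - 2"] by (simp add: power2_eq_square field_simps)
          ultimately have "z \<le> exp (z / 2)" by linarith
          then have "z\<^sup>2 \<le> (exp (z / 2))\<^sup>2" using that by (intro power_mono)
          also have "\<dots> = exp z" by (simp add: power2_eq_square flip: exp_add)
          finally show ?thesis using exp_ge_zero[of "- z"] by linarith
        qed
      qed
    qed
    from this[of "\<bar>y\<bar>"] show ?thesis by (cases "0 \<le> y") auto
  qed
  let ?t = "1 / \<sigma>"
  have e: "(\<integral>\<^sup>+x. ennreal (exp (t * x)) \<partial>\<nu>) \<le> ennreal 2" if "t\<^sup>2 * \<sigma>\<^sup>2 = 1" for t
  proof -
    have "(\<integral>\<^sup>+x. ennreal (exp (t * x)) \<partial>\<nu>) = ennreal (LINT x|\<nu>. exp (t * x))"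
      using sg by (intro nn_integral_eq_integral) (auto simp: subgaussian_bound_def)
    also have "\<dots> \<le> ennreal (exp (t\<^sup>2 * \<sigma>\<^sup>2 / 2))"
      using sg by (intro ennreal_leI) (auto simp: subgaussian_bound_def)
    also have "\<dots> \<le> ennreal 2"
    proof (rule ennreal_leI)
      have "exp (1 / 2 :: real) \<le> 1 + 1 / 2 + (1 / 2)\<^sup>2" by (rule exp_bound) auto
      also have "\<dots> \<le> 2" by (simp add: power2_eq_square)
      finally show "exp (t\<^sup>2 * \<sigma>\<^sup>2 / 2) \<le> 2" unfolding that .
    qed
    finally show ?thesis .
  qed
  have "(\<integral>\<^sup>+x. ennreal (x\<^sup>2) \<partial>\<nu>) \<le> (\<integral>\<^sup>+x. ennreal (\<sigma>\<^sup>2) * (ennreal (exp (?t * x)) + ennreal (exp (- ?t * x))) \<partial>\<nu>)"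
  proof (rule nn_integral_mono)
    fix x
    have "x\<^sup>2 = \<sigma>\<^sup>2 * (?t * x)\<^sup>2" using \<sigma> by (simp add: power_mult_distrib power_divide)
    also have "\<dots> \<le> \<sigma>\<^sup>2 * (exp (?t * x) + exp (- ?t * x))"
      using pt[of "?t * x"] by (intro mult_left_mono) auto
    finally show "ennreal (x\<^sup>2) \<le> ennreal (\<sigma>\<^sup>2) * (ennreal (exp (?t * x)) + ennreal (exp (- ?t * x)))"
      by (subst ennreal_plus[symmetric], simp, simp, subst ennreal_mult[symmetric]) (auto intro: ennreal_leI)
  qed
  also have "\<dots> = ennreal (\<sigma>\<^sup>2) * ((\<integral>\<^sup>+x. ennreal (exp (?t * x)) \<partial>\<nu>) + (\<integral>\<^sup>+x. ennreal (exp (- ?t * x)) \<partial>\<nu>))"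
    by (subst nn_integral_cmult, measurable, subst nn_integral_add) auto
  also have "\<dots> \<le> ennreal (\<sigma>\<^sup>2) * (ennreal 2 + ennreal 2)"
    using \<sigma> by (intro mult_left_mono add_mono e) (auto simp: power_divide)
  also have "\<dots> = ennreal (4 * \<sigma>\<^sup>2)" by (simp add: ennreal_mult mult.commute)
  finally show ?thesis .
qed

lemma nn_integral_bound_imp_integral:
  assumes f: "f \<in> borel_measurable M" "\<And>x. 0 \<le> f x" and c: "0 \<le> c" and le: "(\<integral>\<^sup>+x. ennreal (f x) \<partial>M) \<le> ennreal c"
  shows "integrable M f \<and> integral\<^sup>L M f \<le> c"
proof
  show "integrable M f"
    using f le_less_trans[OF le ennreal_less_top] by (intro integrableI_nonneg) auto
  have "integral\<^sup>L M f = enn2real (\<integral>\<^sup>+x. ennreal (f x) \<partial>M)"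
    by (rule integral_eq_nn_integral) (use f in auto)
  also have "\<dots> \<le> c" by (rule enn2real_leI[OF c le])
  finally show "integral\<^sup>L M f \<le> c" .
qed

section \<open>Algorithm E as a sequence of rounds\<close>

locale estimation = symmetric_body +
  fixes \<sigma> :: real and \<nu> S :: "real measure" and \<kappa> :: "rvec set \<Rightarrow> real"
    and Orc :: "rvec set \<Rightarrow> real \<Rightarrow> rmat \<Rightarrow> real \<Rightarrow> rvec" and P :: "rvec set \<Rightarrow> real \<Rightarrow> rvec \<Rightarrow> rvec"
  assumes \<sigma>: "0 < \<sigma>" and law: "subgaussian_law \<nu> (\<sigma>\<^sup>2)" and S: "prob_space S"
    and orcs: "\<forall>j<rounds L0 r R.
           qfm_oracle S n (body n L0 K R j) (\<kappa> (body n L0 K R j)) (fail_prob n 200 L0 \<kappa> K \<sigma> R j)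
             (Orc (body n L0 K R j) (fail_prob n 200 L0 \<kappa> K \<sigma> R j))"
    and P: "weak_projection n P"
begin

abbreviation d :: "nat \<Rightarrow> real" where "d \<equiv> dtil L0 R"
abbreviation Kb :: "nat \<Rightarrow> rvec set" where "Kb \<equiv> body n L0 K R"
abbreviation m :: "nat \<Rightarrow> nat" where "m \<equiv> round_dim n 200 L0 \<sigma> R"
abbreviation q :: "nat \<Rightarrow> real" where "q \<equiv> fail_prob n 200 L0 \<kappa> K \<sigma> R"
abbreviation NR :: nat where "NR \<equiv> rounds L0 r R"
abbreviation Noise :: "rvec measure" where "Noise \<equiv> PiM {..<n} (\<lambda>_. \<nu>)"
abbreviation Seeds :: "(nat \<times> nat \<Rightarrow> real) measure" where "Seeds \<equiv> PiM UNIV (\<lambda>_. S)"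
abbreviation \<Omega> :: "(rvec \<times> (nat \<times> nat \<Rightarrow> real)) measure" where "\<Omega> \<equiv> sample_space n \<nu> S"

lemma \<nu>: "prob_space \<nu>" "sets \<nu> = sets borel" "subgaussian_bound \<nu> (\<sigma>\<^sup>2)"
  using law by (auto simp: subgaussian_law_def has_subgaussian_parameter_def)

lemma Omega: "\<Omega> = Noise \<Otimes>\<^sub>M Seeds"
  by (simp add: sample_space_def)

lemma prob_Noise: "prob_space Noise"
  by (intro prob_space_PiM \<nu>)

lemma prob_Seeds: "prob_space Seeds"
  by (intro prob_space_PiM S)

lemma oracle_round: "j < NR \<Longrightarrow> sdp_oracle n (m j) 200 (\<kappa> (Kb j)) S (Kb j) (q j) (Orc (Kb j) (q j))"
proof (rule sdp_oracle.intro)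
  assume j: "j < NR"
  show "0 < n" using n1 by simp
  show "m j \<le> n" by (simp add: round_dim_def)
  show "prob_space S" by (rule S)
  show "qfm_oracle S n (Kb j) (\<kappa> (Kb j)) (q j) (Orc (Kb j) (q j))" using orcs j by simp
  show "compact (Kb j)" using body_convex by (simp add: convex_body_def)
  show "Kb j \<subseteq> Rn n" using body_sub K_Rn by blast
  show "Kb j \<noteq> {}" using body_zero by (metis empty_iff)
qed simp

definition Xr :: "nat \<Rightarrow> (nat \<times> nat \<Rightarrow> real) \<Rightarrow> rmat" where
  "Xr j s = SDP n (m j) 200 (\<kappa> (Kb j)) (\<lambda>k Z. Orc (Kb j) (q j) Z (s (j, k)))"

definition Ar :: "nat \<Rightarrow> (nat \<times> nat \<Rightarrow> real) \<Rightarrow> rmat" where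
  "Ar j s = comp_sqrt n (Xr j s)"

definition zr :: "nat \<Rightarrow> (nat \<times> nat \<Rightarrow> real) \<Rightarrow> rvec \<Rightarrow> rvec \<Rightarrow> rvec" where
  "zr j s Y h = (\<lambda>i. (matvec n (Ar j s) Y i - matvec n (Ar j s) h i) / 2)"

lemma round_update_eq:
  "round_update n 200 L0 \<kappa> Orc P K R \<sigma> Y s j h
    = P K (2 * d j / Ltil L0) (\<lambda>i. 2 * P (Kb j) (d j / L0) (zr j s Y h) i + h i)"
  by (simp add: round_update_def Let_def zr_def Ar_def Xr_def comp_sqrt_def)

text \<open>The estimates of successive rounds, continued past the stopping rule. The output of the
  loop is a term of this sequence at a deterministic index.\<close>

definition mu :: "rvec \<Rightarrow> (nat \<times> nat \<Rightarrow> real) \<Rightarrow> nat \<Rightarrow> rvec" where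
  "mu Y s = rec_nat (\<lambda>_. 0) (\<lambda>j h. round_update n 200 L0 \<kappa> Orc P K R \<sigma> Y s j h)"

lemma mu_0 [simp]: "mu Y s 0 = (\<lambda>_. 0)"
  by (simp add: mu_def)

lemma mu_Suc: "mu Y s (Suc j) = round_update n 200 L0 \<kappa> Orc P K R \<sigma> Y s j (mu Y s j)"
  by (simp add: mu_def)

text \<open>The stopping rule looks only at the deterministic radii, hence one \<open>e\<close>
  serves all \<open>Y\<close> and \<open>s\<close>. Induction over the remaining rounds.\<close>

lemma algE_loop_mu:
  "\<exists>e. e \<le> j + i \<and> (e = j + i \<or> d e \<le> max (2 * r) (200 * \<sigma>)) \<and>
     (\<forall>Y s. algE_loop i n 200 L0 \<kappa> Orc P K r R \<sigma> Y s j (mu Y s j) = mu Y s e)"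
proof (induction i arbitrary: j)
  case 0
  show ?case by (rule exI[of _ j]) simp
next
  case (Suc i)
  show ?case
  proof (cases "d (Suc j) \<le> max (2 * r) (200 * \<sigma>)")
    case True
    then show ?thesis by (intro exI[of _ "Suc j"]) (simp add: Let_def mu_Suc del: dtil.simps)
  next
    case False
    obtain e where e: "e \<le> Suc j + i" "e = Suc j + i \<or> d e \<le> max (2 * r) (200 * \<sigma>)"
      "\<forall>Y s. algE_loop i n 200 L0 \<kappa> Orc P K r R \<sigma> Y s (Suc j) (mu Y s (Suc j)) = mu Y s e"
      using Suc[of "Suc j"] by (elim exE conjE)
    have "algE_loop (Suc i) n 200 L0 \<kappa> Orc P K r R \<sigma> Y s j (mu Y s j) = mu Y s e" for Y s
      using e(3) False by (simp add: Let_def mu_Suc[symmetric] del: dtil.simps)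
    then show ?thesis using e(1,2) by (intro exI[of _ e]) simp
  qed
qed

lemma last_dtil: "d NR \<le> 2 * r"
proof -
  have s: "sqrt 3 + 1 \<noteq> (0::real)" using sqrt3 by linarith
  \<comment> \<open>The base of the logarithm in \<open>rounds\<close> is 2, so \<open>NR\<close>
    halvings take the initial radius \<open>2 * R\<close> to at most \<open>2 * r\<close>.\<close>
  have two: "Ltil L0 / (2 * (sqrt 3 + 1)) = 2" unfolding Ltil_L0 using s by (simp add: field_simps)
  have "log 2 (R / r) \<le> real NR" unfolding rounds_def two by linarith
  then have "R / r \<le> 2 ^ NR" using R0 r0 by (simp add: log_le_iff powr_realpow)
  then show ?thesis using r0 by (simp add: dtil_L0 divide_le_eq mult.commute)
qed

definition stop :: nat where
  "stop = (SOME e. e \<le> 0 + NR \<and> (e = 0 + NR \<or> d e \<le> max (2 * r) (200 * \<sigma>)) \<and>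
     (\<forall>Y s. algE_loop NR n 200 L0 \<kappa> Orc P K r R \<sigma> Y s 0 (mu Y s 0) = mu Y s e))"

lemma stop: "stop \<le> NR" "d stop \<le> max (2 * r) (200 * \<sigma>)"
  "algE_loop NR n 200 L0 \<kappa> Orc P K r R \<sigma> Y s 0 (\<lambda>_. 0) = mu Y s stop"
proof -
  have *: "stop \<le> 0 + NR \<and> (stop = 0 + NR \<or> d stop \<le> max (2 * r) (200 * \<sigma>)) \<and>
     (\<forall>Y s. algE_loop NR n 200 L0 \<kappa> Orc P K r R \<sigma> Y s 0 (mu Y s 0) = mu Y s stop)"
    unfolding stop_def by (rule someI_ex[OF algE_loop_mu[of 0 NR]])
  show "stop \<le> NR" using * by simp
  show "d stop \<le> max (2 * r) (200 * \<sigma>)" using * last_dtil by auto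
  show "algE_loop NR n 200 L0 \<kappa> Orc P K r R \<sigma> Y s 0 (\<lambda>_. 0) = mu Y s stop"
    using * mu_0[of Y s] by simp
qed

lemma Xr_contr: "j < NR \<Longrightarrow> s \<in> space Seeds \<Longrightarrow> contr n (Xr j s)"
  using sdp_oracle.Xss_contr[OF oracle_round, of j s j]
  by (simp add: sdp_oracle.Xss_def[OF oracle_round] sdp_oracle.Q_def[OF oracle_round] Xr_def)

lemma measurable_Ar: "j < NR \<Longrightarrow> Ar j \<in> borel_measurable Seeds"
proof -
  assume j: "j < NR"
  interpret O: sdp_oracle n "m j" 200 "\<kappa> (Kb j)" S "Kb j" "q j" "Orc (Kb j) (q j)" j by (rule oracle_round[OF j])
  have "Ar j = O.Ass" by (intro ext) (simp add: Ar_def Xr_def O.Ass_def O.Xss_def O.Q_def)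
  then show ?thesis using O.measurable_Ass by simp
qed

lemma zr_Rn: "j < NR \<Longrightarrow> s \<in> space Seeds \<Longrightarrow> zr j s Y h \<in> Rn n"
proof -
  assume "j < NR" "s \<in> space Seeds"
  then have "Ar j s \<in> Mn n" unfolding Ar_def by (intro comp_sqrt_Mn Xr_contr)
  then have "(\<lambda>i. (1 / 2) * (matvec n (Ar j s) Y i - matvec n (Ar j s) h i)) \<in> Rn n"
    by (intro Rn_scale Rn_diff Rn_matvec)
  then show ?thesis by (simp add: zr_def)
qed

lemma mu_mem:
  assumes s: "s \<in> space Seeds"
  shows "j \<le> NR \<Longrightarrow> mu Y s j \<in> K"
proof (induction j)
  case 0
  show ?case by (simp add: zero_mem)
next
  case (Suc j)
  then show ?case
    unfolding mu_Suc round_update_eq by (intro step_displacement(1)[OF P] zr_Rn[OF _ s]) auto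
qed

lemma mu_displacement:
  assumes s: "s \<in> space Seeds" and j: "j < NR"
  shows "edist n (mu Y s (Suc j)) (mu Y s j) \<le> 3 * d j"
  unfolding mu_Suc round_update_eq
  by (rule step_displacement(2)[OF P mu_mem[OF s] zr_Rn[OF j s]]) (use j in simp)

section \<open>Measurability of the estimates\<close>

lemma space_Omega: "\<omega> \<in> space \<Omega> \<longleftrightarrow> fst \<omega> \<in> space Noise \<and> snd \<omega> \<in> space Seeds"
  by (cases \<omega>) (simp add: Omega space_pair_measure)

lemma measurable_matvec:
  assumes "f \<in> borel_measurable M" "g \<in> borel_measurable M"
  shows "(\<lambda>x. matvec n (f x) (g x) i) \<in> borel_measurable M"
  unfolding matvec_def
  by (intro borel_measurable_sum borel_measurable_times measurable_coord2[OF assms(1)]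
      measurable_product_then_coordinatewise[OF assms(2)])

lemma measurable_noise_coord: "i < n \<Longrightarrow> (\<lambda>\<omega>. fst \<omega> i) \<in> borel_measurable \<Omega>"
proof -
  assume i: "i < n"
  have "(\<lambda>x. x i) \<in> measurable Noise \<nu>" using i by (intro measurable_component_singleton) simp
  then have "(\<lambda>\<omega>. fst \<omega> i) \<in> measurable \<Omega> \<nu>" unfolding Omega by (rule measurable_compose[OF measurable_fst])
  then show ?thesis unfolding measurable_cong_sets[OF refl \<nu>(2)] .
qed

lemma measurable_observation: "(\<lambda>\<omega>. observation n \<mu> (fst \<omega>)) \<in> borel_measurable \<Omega>"
proof (rule measurable_coordinatewise_then_product)
  fix i
  show "(\<lambda>\<omega>. observation n \<mu> (fst \<omega>) i) \<in> borel_measurable \<Omega>"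
  proof (cases "i < n")
    case True
    then show ?thesis using measurable_noise_coord[OF True] by (simp add: observation_def)
  qed (simp add: observation_def)
qed

lemma measurable_Ar_snd: "j < NR \<Longrightarrow> (\<lambda>\<omega>. Ar j (snd \<omega>)) \<in> borel_measurable \<Omega>"
  unfolding Omega by (rule measurable_compose[OF measurable_snd measurable_Ar])

lemma measurable_mu: "j \<le> NR \<Longrightarrow> (\<lambda>\<omega>. mu (observation n \<mu> (fst \<omega>)) (snd \<omega>) j) \<in> borel_measurable \<Omega>"
proof (induction j)
  case 0
  show ?case by simp
next
  case (Suc j)
  then have j: "j < NR" and h: "(\<lambda>\<omega>. mu (observation n \<mu> (fst \<omega>)) (snd \<omega>) j) \<in> borel_measurable \<Omega>" by simp_all
  have e: "0 < d j / L0" "0 < 2 * d j / Ltil L0" using dtil_pos[of j] L0_pos Ltil_L0_pos by auto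
  have Pm: "P K' \<epsilon> \<in> borel_measurable borel" if "convex_body n K'" "0 < \<epsilon>" for K' \<epsilon>
    using P that by (simp add: weak_projection_def)
  have z: "(\<lambda>\<omega>. zr j (snd \<omega>) (observation n \<mu> (fst \<omega>)) (mu (observation n \<mu> (fst \<omega>)) (snd \<omega>) j)) \<in> borel_measurable \<Omega>"
    unfolding zr_def
    by (rule measurable_coordinatewise_then_product)
      (intro borel_measurable_divide borel_measurable_diff borel_measurable_const measurable_matvec
        measurable_Ar_snd[OF j] measurable_observation h)
  note b = measurable_compose[OF z Pm[OF body_convex e(1)]]
  show ?case
    unfolding mu_Suc round_update_eq
    by (rule measurable_compose[OF _ Pm[OF cb e(2)]], rule measurable_coordinatewise_then_product)
      (intro borel_measurable_add borel_measurable_times borel_measurable_const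
        measurable_product_then_coordinatewise[OF b] measurable_product_then_coordinatewise[OF h])
qed

definition \<Upsilon> :: real where "\<Upsilon> = Upsilon_fac 4 200 (kappa_bar n L0 \<kappa> K r R) (T2 n K)"
definition \<eta> :: real where "\<eta> = eta_star 4 n \<sigma> K"
text \<open>The scale down to which rounds are analysed: the first member is the hypothesis of
  \<open>tail_small\<close>, the second that of the noise tail.\<close>

definition \<theta> :: real where "\<theta> = max (600 * sqrt \<Upsilon> * \<eta>) (400 * \<sigma>)"

definition failed :: "nat \<Rightarrow> (nat \<times> nat \<Rightarrow> real) set" where
  "failed j = sdp_oracle.fails n (m j) 200 (\<kappa> (Kb j)) S (Kb j) (Orc (Kb j) (q j)) j"

lemma kappa_le: "j < NR \<Longrightarrow> \<kappa> (Kb j) \<le> kappa_bar n L0 \<kappa> K r R"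
  unfolding kappa_bar_def by (intro Max_ge) auto

text \<open>The tail bound \<open>d^2 / 20000\<close> and the regret
  \<open>(d / 2)^2 / 200^2\<close> together stay below \<open>(d / 96)^2\<close>. The bias thus
  takes half of the tolerance 1/48, and the noise, which enters with a factor 1/2, takes the other
  half.\<close>

lemma good_round:
  assumes j: "j < NR" and s: "s \<in> space Seeds" and good: "s \<notin> failed j" and big: "\<theta> \<le> d j"
  shows "Xr j s \<in> fantope n (m j)" "p \<in> Kb j \<Longrightarrow> quad n (Xr j s) p \<le> (d j / 96)\<^sup>2"
proof -
  interpret O: sdp_oracle n "m j" 200 "\<kappa> (Kb j)" S "Kb j" "q j" "Orc (Kb j) (q j)" j by (rule oracle_round[OF j])
  have X: "Xr j s = SDP n (m j) 200 (\<kappa> (Kb j)) (O.Q s)" by (simp add: Xr_def O.Q_def)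
  have "Xr j s \<in> fantope n (m j) \<and> (\<forall>p\<in>Kb j. quad n (Xr j s) p \<le> (d j / 96)\<^sup>2)"
  proof (cases "m j = n")
    case True
    \<comment> \<open>In full dimension the procedure returns the zero matrix, so there is no
      bias.\<close>
    have "Xr j s = sdp_start n n" by (simp add: X SDP_def True)
    moreover have "quad n (sdp_start n n) p = 0" for p by (simp add: sdp_start_def quad_def)
    ultimately show ?thesis using sdp_start_fantope[of n n] n1 True by simp
  next
    case False
    then have mj: "m j < n" using O.mn by simp
    \<comment> \<open>Because \<open>m j < n\<close>, the minimum in \<open>round_dim\<close> is the
      ceiling.\<close>
    have mge: "(d j)\<^sup>2 / (200\<^sup>2 * \<sigma>\<^sup>2) \<le> real (m j)"
      using mj unfolding round_dim_def by linarith
    have e: "0 < min r (d j / 2)" using r0 dtil_pos[of j] by simp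
    have gd: "quad n (sdp_iterate n (m j) 200 (\<kappa> (Kb j)) (O.Q s) k) (O.Q s k (sdp_iterate n (m j) 200 (\<kappa> (Kb j)) (O.Q s) k))
        \<ge> (1 / \<kappa> (Kb j)) * (SUP p\<in>Kb j. quad n (sdp_iterate n (m j) 200 (\<kappa> (Kb j)) (O.Q s) k) p)"
      if "k < O.Nit" for k
    proof -
      have "s \<notin> O.bad k" using good that by (auto simp: failed_def O.fails_def)
      then show ?thesis using s by (simp add: O.bad_def not_less)
    qed
    have Qm: "O.Q s k Z \<in> Kb j" if "k < O.Nit" "psd n Z" for k Z by (rule O.Q_mem[OF s that(2)])
    obtain w :: "nat \<Rightarrow> real" and p :: "nat \<Rightarrow> rvec" and U l B and N :: nat where G:
      "\<And>k. k < N \<Longrightarrow> 0 \<le> w k \<and> p k \<in> Kb j" "(\<Sum>k<N. w k) = 1" "orthogonal_mat n U"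
      "\<And>x. (\<Sum>k<N. w k * (ip n (p k) x)\<^sup>2) = (\<Sum>a<n. l a * (ip n (col U a) x)\<^sup>2)"
      "\<And>a. a < n \<Longrightarrow> 0 \<le> l a" "B \<subseteq> {..<n}" "card B = n - m j"
      "\<And>a b. a \<in> B \<Longrightarrow> b \<in> {..<n} - B \<Longrightarrow> l a \<le> l b"
      "\<And>x. x \<in> Kb j \<Longrightarrow> quad n (SDP n (m j) 200 (\<kappa> (Kb j)) (O.Q s)) x \<le> \<kappa> (Kb j) * (\<Sum>a\<in>B. l a) + (d j / 2)\<^sup>2 / 200\<^sup>2"
      "SDP n (m j) 200 (\<kappa> (Kb j)) (O.Q s) \<in> fantope n (m j)"
    proof (rule sdp_guarantee[where n = n and m = "m j" and \<kappa> = "\<kappa> (Kb j)" and C = 200 and Q = "O.Q s"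
            and K' = "Kb j" and d = "d j / 2" and e = "min r (d j / 2)"], goal_cases)
      case 1 show ?case by (rule mj)
    next
      case 2 show ?case by (rule O.k1)
    next
      case 3 show ?case by (rule O.C0)
    next
      case 4 show ?case by (rule Qm[OF 4(2,3)])
    next
      case 5 show ?case by (rule O.KR)
    next
      case 6 show ?case by (rule body_le[OF 6(2)])
    next
      case 7 show ?case by (rule e)
    next
      case 8 show ?case by (rule body_inner)
    next
      case 9 show ?case by (rule gd[OF 9(2)])
    next
      case 10 show ?case by (rule 10(1)) (fact 10)+
    qed
    have "\<kappa> (Kb j) * (\<Sum>a\<in>B. l a) \<le> (d j)\<^sup>2 / 20000"
    proof (rule tail_small[where w = w and p = p and N = N and l = l and U = U and B = B and m = "m j" and \<sigma> = \<sigma> and kb = "kappa_bar n L0 \<kappa> K r R"])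
      show "400 * \<sigma> \<le> d j" using big by (simp add: \<theta>_def)
      show "600 * sqrt (Upsilon_fac 4 200 (kappa_bar n L0 \<kappa> K r R) (T2 n K)) * eta_star 4 n \<sigma> K \<le> d j"
        using big by (simp add: \<theta>_def \<Upsilon>_def \<eta>_def)
      show "0 \<le> w k" "p k \<in> K" "enorm n (p k) \<le> d j / 2" if "k < N" for k
        using G(1)[OF that] subsetD[OF body_sub, of "p k" j] body_le[of "p k" j] by simp_all
    qed (fact \<sigma> O.k1 kappa_le[OF j] mge O.mn G)+
    moreover have "(d j)\<^sup>2 / 20000 + (d j / 2)\<^sup>2 / 200\<^sup>2 \<le> (d j / 96)\<^sup>2"
      by (simp add: power_divide)
    ultimately have "quad n (Xr j s) x \<le> (d j / 96)\<^sup>2" if "x \<in> Kb j" for x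
      using G(9)[OF that] unfolding X by linarith
    then show ?thesis using G(10) by (simp add: X)
  qed
  then show "Xr j s \<in> fantope n (m j)" "p \<in> Kb j \<Longrightarrow> quad n (Xr j s) p \<le> (d j / 96)\<^sup>2" by auto
qed

definition Bad :: "nat \<Rightarrow> (rvec \<times> (nat \<times> nat \<Rightarrow> real)) set" where
  "Bad j = {\<omega> \<in> space \<Omega>. snd \<omega> \<in> failed j \<or> d j / 48 < enorm n (matvec n (Ar j (snd \<omega>)) (fst \<omega>))}"

lemma failed_sets: "j < NR \<Longrightarrow> failed j \<in> sets Seeds"
  unfolding failed_def by (rule sdp_oracle.fails_sets[OF oracle_round])

text \<open>The union bound over the calls of the round cancels the division by their number in
  \<open>fail_prob\<close>; what remains is \<open>1 / (1 + d^3 / \<sigma>^3)\<close>.\<close>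

lemma failed_le: "j < NR \<Longrightarrow> emeasure Seeds (failed j) \<le> ennreal (\<sigma> ^ 3 / d j ^ 3)"
proof -
  assume j: "j < NR"
  interpret O: sdp_oracle n "m j" 200 "\<kappa> (Kb j)" S "Kb j" "q j" "Orc (Kb j) (q j)" j by (rule oracle_round[OF j])
  interpret Se: prob_space Seeds by (rule prob_Seeds)
  have N: "0 < real O.Nit" by (simp add: sdp_iters_def)
  have x: "0 < d j ^ 3 / \<sigma> ^ 3" using dtil_pos[of j] \<sigma> by simp
  have "q j = 1 / real O.Nit / (1 + d j ^ 3 / \<sigma> ^ 3)" by (simp add: fail_prob_def)
  moreover from this have "0 \<le> q j" using N x by simp
  ultimately have q: "real O.Nit * max 0 (q j) = 1 / (1 + d j ^ 3 / \<sigma> ^ 3)" using N by (simp only: max_absorb2) simp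
  have "1 / (1 + d j ^ 3 / \<sigma> ^ 3) \<le> 1 / (d j ^ 3 / \<sigma> ^ 3)" using x by (intro frac_le) auto
  then have "measure Seeds (failed j) \<le> \<sigma> ^ 3 / d j ^ 3"
    using O.fails_le unfolding failed_def q by simp
  then show ?thesis by (simp add: Se.emeasure_eq_measure ennreal_leI)
qed

lemma measurable_noise_norm: "j < NR \<Longrightarrow> (\<lambda>\<omega>. enorm n (matvec n (Ar j (snd \<omega>)) (fst \<omega>))) \<in> borel_measurable \<Omega>"
proof -
  assume j: "j < NR"
  have "(\<lambda>\<omega>. \<Sum>l<n. Ar j (snd \<omega>) i l * fst \<omega> l) \<in> borel_measurable \<Omega>" for i
    by (intro borel_measurable_sum borel_measurable_times measurable_coord2[OF measurable_Ar_snd[OF j]] measurable_noise_coord) simp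
  then show ?thesis
    by (intro measurable_enorm measurable_coordinatewise_then_product) (simp add: matvec_def)
qed

lemma Bad_sets: "j < NR \<Longrightarrow> Bad j \<in> sets \<Omega>"
proof -
  assume j: "j < NR"
  have "snd \<in> measurable \<Omega> Seeds" unfolding Omega by (rule measurable_snd)
  then have 1: "{\<omega> \<in> space \<Omega>. snd \<omega> \<in> failed j} \<in> sets \<Omega>" by (rule sets_Collect_mem[OF _ failed_sets[OF j]])
  have 2: "{\<omega> \<in> space \<Omega>. d j / 48 < enorm n (matvec n (Ar j (snd \<omega>)) (fst \<omega>))} \<in> sets \<Omega>"
    by (intro borel_measurable_less borel_measurable_const measurable_noise_norm j)
  have "Bad j = {\<omega> \<in> space \<Omega>. snd \<omega> \<in> failed j} \<union> {\<omega> \<in> space \<Omega>. d j / 48 < enorm n (matvec n (Ar j (snd \<omega>)) (fst \<omega>))}"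
    by (auto simp: Bad_def)
  then show ?thesis using sets.Un[OF 1 2] by simp
qed

text \<open>For fixed seeds the matrix \<open>Ar j s\<close> is deterministic, and the noise is
  independent of the seeds. So the noise tail applies inside the integral over the seeds, and failed
  seeds are charged with full mass.\<close>

lemma Bad_le:
  assumes j: "j < NR" and big: "\<theta> \<le> d j"
  shows "emeasure \<Omega> (Bad j) \<le> ennreal (\<sigma> ^ 3 / d j ^ 3 + 8 * 10 ^ 8 * \<sigma> ^ 4 / d j ^ 4)"
proof -
  interpret No: prob_space Noise by (rule prob_Noise)
  interpret Se: prob_space Seeds by (rule prob_Seeds)
  interpret PP: pair_prob_space Noise Seeds ..
  let ?c = "8 * 10 ^ 8 * \<sigma> ^ 4 / d j ^ 4"
  have d4: "400 * \<sigma> \<le> d j" using big by (simp add: \<theta>_def)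
  have c0: "0 \<le> ?c" using \<sigma> dtil_pos[of j] by simp
  have "emeasure \<Omega> (Bad j) = (\<integral>\<^sup>+s. emeasure Noise ((\<lambda>\<xi>. (\<xi>, s)) -` Bad j) \<partial>Seeds)"
    using Bad_sets[OF j] unfolding Omega by (rule PP.emeasure_pair_measure_alt2)
  also have "\<dots> \<le> (\<integral>\<^sup>+s. indicator (failed j) s + ennreal ?c \<partial>Seeds)"
  proof (rule nn_integral_mono)
    fix s assume s: "s \<in> space Seeds"
    show "emeasure Noise ((\<lambda>\<xi>. (\<xi>, s)) -` Bad j) \<le> indicator (failed j) s + ennreal ?c"
    proof (cases "s \<in> failed j")
      case True
      have "emeasure Noise ((\<lambda>\<xi>. (\<xi>, s)) -` Bad j) \<le> 1" by (rule No.emeasure_le_1)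
      then show ?thesis using True by (simp add: add_increasing2)
    next
      case False
      have "(\<lambda>\<xi>. (\<xi>, s)) -` Bad j = {\<xi> \<in> space Noise. d j / 48 < enorm n (matvec n (comp_sqrt n (Xr j s)) \<xi>)}"
        using s False by (auto simp: Bad_def space_Omega Ar_def)
      moreover have "real (m j) \<le> (d j)\<^sup>2 / (200\<^sup>2 * \<sigma>\<^sup>2) + 1"
      proof -
        have "0 \<le> (d j)\<^sup>2 / (200\<^sup>2 * \<sigma>\<^sup>2)" by simp
        then show ?thesis unfolding round_dim_def by linarith
      qed
      ultimately show ?thesis
        using subgaussian_noise_tail[OF \<nu> \<sigma> good_round(1)[OF j s False big] d4] False by simp
    qed
  qed
  also have "\<dots> = emeasure Seeds (failed j) + ennreal ?c"
    using failed_sets[OF j] by (subst nn_integral_add) (auto simp: Se.emeasure_space_1)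
  also have "\<dots> \<le> ennreal (\<sigma> ^ 3 / d j ^ 3) + ennreal ?c" by (intro add_mono failed_le j) simp
  also have "\<dots> = ennreal (\<sigma> ^ 3 / d j ^ 3 + ?c)" using c0 \<sigma> dtil_pos[of j] by (subst ennreal_plus) auto
  finally show ?thesis .
qed

text \<open>The estimate \<open>h\<close> depends on the same noise, but the argument is
  deterministic: outside \<open>Bad j\<close> the bias bound holds for every point of the truncated
  body, in particular for \<open>(\<mu> - h) / 2\<close>.\<close>

lemma good_step:
  assumes \<mu>: "\<mu> \<in> K" and \<omega>: "\<omega> \<in> space \<Omega>" and j: "j < NR" and big: "\<theta> \<le> d j" and good: "\<omega> \<notin> Bad j"
    and err: "edist n (mu (observation n \<mu> (fst \<omega>)) (snd \<omega>) j) \<mu> \<le> d j"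
  shows "edist n (mu (observation n \<mu> (fst \<omega>)) (snd \<omega>) (Suc j)) \<mu> \<le> d (Suc j)"
proof -
  define s where "s = snd \<omega>"
  define \<xi> where "\<xi> = fst \<omega>"
  define Y where "Y = observation n \<mu> \<xi>"
  define h where "h = mu Y s j"
  have s: "s \<in> space Seeds" using \<omega> by (simp add: s_def space_Omega)
  have g1: "s \<notin> failed j" and g2: "enorm n (matvec n (Ar j s) \<xi>) \<le> d j / 48"
    using good \<omega> by (auto simp: Bad_def s_def \<xi>_def not_less)
  have hK: "h \<in> K" unfolding h_def using j by (intro mu_mem[OF s]) simp
  let ?p = "\<lambda>i. (\<mu> i - h i) / 2"
  have pK: "?p \<in> K" by (rule K_half_diff[OF \<mu> hK])
  have he: "edist n h \<mu> \<le> d j" using err by (simp add: h_def Y_def s_def \<xi>_def)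
  have "enorm n ?p = edist n \<mu> h / 2"
    using enorm_scale[of n "1/2" "\<lambda>i. \<mu> i - h i"] by (simp add: edist_def)
  then have pb: "?p \<in> Kb j" using he by (intro body_mem pK) (simp add: edist_commute)
  have "(edist n ?p (matvec n (Ar j s) ?p))\<^sup>2 \<le> (d j / 96)\<^sup>2"
    unfolding Ar_def using comp_sqrt_error[OF Xr_contr[OF j s] K_Rn[OF pK]] good_round(2)[OF j s g1 big pb] by linarith
  then have e1: "edist n ?p (matvec n (Ar j s) ?p) \<le> d j / 96"
    by (rule power2_le_imp_le) (use dtil_pos[of j] in simp)
  \<comment> \<open>Linearity: the statistic of the round is the compressed target plus half of the
    compressed noise, and only the first term depends on \<open>h\<close>.\<close>
  have z: "zr j s Y h = (\<lambda>i. matvec n (Ar j s) ?p i + (1 / 2) * matvec n (Ar j s) \<xi> i)"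
  proof
    fix i
    have "matvec n (Ar j s) Y i = matvec n (Ar j s) \<mu> i + matvec n (Ar j s) \<xi> i"
      by (simp add: matvec_def Y_def observation_def distrib_left sum.distrib)
    moreover have "matvec n (Ar j s) ?p i = (matvec n (Ar j s) \<mu> i - matvec n (Ar j s) h i) / 2"
      by (simp add: matvec_def right_diff_distrib sum_subtractf diff_divide_distrib sum_divide_distrib)
    ultimately show "zr j s Y h i = matvec n (Ar j s) ?p i + (1 / 2) * matvec n (Ar j s) \<xi> i"
      by (simp add: zr_def field_simps)
  qed
  have "edist n (zr j s Y h) (matvec n (Ar j s) ?p) = enorm n (matvec n (Ar j s) \<xi>) / 2"
    unfolding z edist_def using enorm_scale[of n "1/2" "matvec n (Ar j s) \<xi>"] by simp
  then have "edist n (zr j s Y h) ?p \<le> d j / 48"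
    using e1 g2 edist_triangle[of n "zr j s Y h" ?p "matvec n (Ar j s) ?p"]
    by (simp add: edist_commute[of n "matvec n (Ar j s) ?p" ?p])
  from step_displacement(3)[OF P hK zr_Rn[OF j s] \<mu> he this]
  have "edist n (mu Y s (Suc j)) \<mu> \<le> d j / 2" unfolding mu_Suc round_update_eq h_def .
  moreover have "d (Suc j) = d j / 2" by (rule dtil_half)
  ultimately show ?thesis by (simp add: Y_def s_def \<xi>_def del: dtil.simps)
qed

lemma drift:
  assumes s: "s \<in> space Seeds"
  shows "J \<le> e \<Longrightarrow> e \<le> NR \<Longrightarrow> edist n (mu Y s e) \<mu> \<le> edist n (mu Y s J) \<mu> + (\<Sum>i=J..<e. 3 * d i)"
proof (induction e)
  case (Suc e)
  show ?case
  proof (cases "J = Suc e")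
    case False
    then have "edist n (mu Y s e) \<mu> \<le> edist n (mu Y s J) \<mu> + (\<Sum>i=J..<e. 3 * d i)" using Suc by simp
    moreover have "edist n (mu Y s (Suc e)) (mu Y s e) \<le> 3 * d e" using Suc.prems by (intro mu_displacement s) simp
    moreover have "edist n (mu Y s (Suc e)) \<mu> \<le> edist n (mu Y s (Suc e)) (mu Y s e) + edist n (mu Y s e) \<mu>"
      by (rule edist_triangle)
    moreover have "(\<Sum>i=J..<Suc e. 3 * d i) = (\<Sum>i=J..<e. 3 * d i) + 3 * d e" using False Suc.prems by simp
    ultimately show ?thesis by linarith
  qed simp
qed simp

text \<open>Let \<open>i\<close> be the first bad round. The error before it is at most \<open>d i\<close>, and all later displacements
  together are at most \<open>6 * d i\<close>.\<close>

lemma pathwise: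
  assumes \<mu>: "\<mu> \<in> K" and \<omega>: "\<omega> \<in> space \<Omega>" and J: "J \<le> e" "e \<le> NR" and big: "\<forall>j<J. \<theta> \<le> d j"
  shows "(edist n (mu (observation n \<mu> (fst \<omega>)) (snd \<omega>) e) \<mu>)\<^sup>2
    \<le> 49 * (d J)\<^sup>2 + (\<Sum>j<J. 49 * (d j)\<^sup>2 * indicator (Bad j) \<omega>)"
proof -
  let ?E = "\<lambda>j. edist n (mu (observation n \<mu> (fst \<omega>)) (snd \<omega>) j) \<mu>"
  have s: "snd \<omega> \<in> space Seeds" using \<omega> by (simp add: space_Omega)
  have step: "?E i \<le> d i" if "i \<le> J" "\<forall>j<i. \<omega> \<notin> Bad j" for i
    using that
  proof (induction i)
    case 0
    have "?E 0 \<le> R" using K_le[OF \<mu>] by simp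
    then show ?case using R0 by simp
  next
    case (Suc i)
    then show ?case using J big by (intro good_step[OF \<mu> \<omega>]) auto
  qed
  have final: "(?E e)\<^sup>2 \<le> 49 * (d i)\<^sup>2" if "i \<le> J" "\<forall>j<i. \<omega> \<notin> Bad j" for i
  proof -
    have "i \<le> e" using that(1) J by simp
    then have "?E e \<le> ?E i + (\<Sum>k=i..<e. 3 * d k)" using J(2) by (intro drift s) auto
    also have "\<dots> \<le> d i + (6 * d i - 6 * d e)" using step[OF that] sum_dtil[OF \<open>i \<le> e\<close>] by simp
    also have "\<dots> \<le> 7 * d i" using dtil_pos[of e] by simp
    finally have "(?E e)\<^sup>2 \<le> (7 * d i)\<^sup>2" by (intro power_mono) auto
    then show ?thesis by (simp add: power_mult_distrib)
  qed
  have nn: "0 \<le> (\<Sum>j<J. 49 * (d j)\<^sup>2 * indicator (Bad j) \<omega>)" by (intro sum_nonneg) (simp add: indicator_def)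
  show ?thesis
  proof (cases "\<exists>j<J. \<omega> \<in> Bad j")
    case False
    then show ?thesis using final[of J] nn by auto
  next
    case True
    define i where "i = (LEAST j. \<omega> \<in> Bad j)"
    have iB: "\<omega> \<in> Bad i" using True unfolding i_def by (elim exE conjE) (rule LeastI)
    have i: "i < J" using True unfolding i_def by (elim exE conjE) (rule le_less_trans[OF Least_le])
    have "\<forall>j<i. \<omega> \<notin> Bad j" unfolding i_def using not_less_Least by blast
    then have "(?E e)\<^sup>2 \<le> 49 * (d i)\<^sup>2" using i by (intro final) auto
    also have "\<dots> = 49 * (d i)\<^sup>2 * indicator (Bad i) \<omega>" using iB by simp
    also have "\<dots> \<le> (\<Sum>j<J. 49 * (d j)\<^sup>2 * indicator (Bad j) \<omega>)"
      using i by (intro member_le_sum) (auto simp: indicator_def)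
    also have "\<dots> \<le> 49 * (d J)\<^sup>2 + \<dots>" by simp
    finally show ?thesis .
  qed
qed

text \<open>Expectation of \<open>pathwise\<close>. A bad round contributes its squared scale times
  a probability of order \<open>(\<sigma> / d j)^3\<close>, hence \<open>\<sigma>^3 / d j\<close>;
  these terms grow geometrically up to the last round before \<open>J\<close>, where
  \<open>d j\<close> is still at least \<open>400 * \<sigma>\<close>.\<close>

lemma risk_bound:
  assumes \<mu>: "\<mu> \<in> K" and J: "J \<le> e" "e \<le> NR" and big: "\<forall>j<J. \<theta> \<le> d j"
  shows "(\<integral>\<^sup>+\<omega>. ennreal ((edist n (mu (observation n \<mu> (fst \<omega>)) (snd \<omega>) e) \<mu>)\<^sup>2) \<partial>\<Omega>)
    \<le> ennreal (49 * (d J)\<^sup>2 + 500000 * \<sigma>\<^sup>2)"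
proof -
  interpret No: prob_space Noise by (rule prob_Noise)
  interpret Se: prob_space Seeds by (rule prob_Seeds)
  interpret PP: pair_prob_space Noise Seeds ..
  have O1: "emeasure \<Omega> (space \<Omega>) = 1" unfolding Omega by (rule PP.emeasure_space_1)
  have Bm: "Bad j \<in> sets \<Omega>" if "j < J" for j using that J by (intro Bad_sets) simp
  have "(\<integral>\<^sup>+\<omega>. ennreal ((edist n (mu (observation n \<mu> (fst \<omega>)) (snd \<omega>) e) \<mu>)\<^sup>2) \<partial>\<Omega>)
    \<le> (\<integral>\<^sup>+\<omega>. ennreal (49 * (d J)\<^sup>2) + (\<Sum>j<J. ennreal (49 * (d j)\<^sup>2) * indicator (Bad j) \<omega>) \<partial>\<Omega>)"
  proof (rule nn_integral_mono)
    fix \<omega> assume \<omega>: "\<omega> \<in> space \<Omega>"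
    have "ennreal ((edist n (mu (observation n \<mu> (fst \<omega>)) (snd \<omega>) e) \<mu>)\<^sup>2)
      \<le> ennreal (49 * (d J)\<^sup>2 + (\<Sum>j<J. 49 * (d j)\<^sup>2 * indicator (Bad j) \<omega>))"
      by (intro ennreal_leI pathwise[OF \<mu> \<omega> J big])
    also have "\<dots> = ennreal (49 * (d J)\<^sup>2) + ennreal (\<Sum>j<J. 49 * (d j)\<^sup>2 * indicator (Bad j) \<omega>)"
      by (rule ennreal_plus) (auto intro!: sum_nonneg simp: indicator_def)
    also have "ennreal (\<Sum>j<J. 49 * (d j)\<^sup>2 * indicator (Bad j) \<omega>) = (\<Sum>j<J. ennreal (49 * (d j)\<^sup>2 * indicator (Bad j) \<omega>))"
      by (rule sum_ennreal[symmetric]) (simp add: indicator_def)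
    also have "\<dots> = (\<Sum>j<J. ennreal (49 * (d j)\<^sup>2) * indicator (Bad j) \<omega>)"
      by (intro sum.cong refl) (simp add: indicator_def)
    finally show "ennreal ((edist n (mu (observation n \<mu> (fst \<omega>)) (snd \<omega>) e) \<mu>)\<^sup>2)
      \<le> ennreal (49 * (d J)\<^sup>2) + (\<Sum>j<J. ennreal (49 * (d j)\<^sup>2) * indicator (Bad j) \<omega>)" .
  qed
  also have "\<dots> = ennreal (49 * (d J)\<^sup>2) + (\<Sum>j<J. ennreal (49 * (d j)\<^sup>2) * emeasure \<Omega> (Bad j))"
  proof -
    have m: "(\<lambda>\<omega>. ennreal (49 * (d j)\<^sup>2) * indicator (Bad j) \<omega>) \<in> borel_measurable \<Omega>" if "j \<in> {..<J}" for j
    proof -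
      have [measurable]: "Bad j \<in> sets \<Omega>" using that by (intro Bm) simp
      show ?thesis by measurable
    qed
    have "(\<integral>\<^sup>+\<omega>. ennreal (49 * (d J)\<^sup>2) + (\<Sum>j<J. ennreal (49 * (d j)\<^sup>2) * indicator (Bad j) \<omega>) \<partial>\<Omega>)
      = (\<integral>\<^sup>+\<omega>. ennreal (49 * (d J)\<^sup>2) \<partial>\<Omega>) + (\<integral>\<^sup>+\<omega>. (\<Sum>j<J. ennreal (49 * (d j)\<^sup>2) * indicator (Bad j) \<omega>) \<partial>\<Omega>)"
      by (rule nn_integral_add[OF borel_measurable_const borel_measurable_sum[OF m]])
    also have "(\<integral>\<^sup>+\<omega>. ennreal (49 * (d J)\<^sup>2) \<partial>\<Omega>) = ennreal (49 * (d J)\<^sup>2)" by (simp add: O1)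
    also have "(\<integral>\<^sup>+\<omega>. (\<Sum>j<J. ennreal (49 * (d j)\<^sup>2) * indicator (Bad j) \<omega>) \<partial>\<Omega>)
      = (\<Sum>j<J. \<integral>\<^sup>+\<omega>. ennreal (49 * (d j)\<^sup>2) * indicator (Bad j) \<omega> \<partial>\<Omega>)" by (rule nn_integral_sum[OF m])
    also have "\<dots> = (\<Sum>j<J. ennreal (49 * (d j)\<^sup>2) * emeasure \<Omega> (Bad j))"
      by (intro sum.cong refl nn_integral_cmult_indicator Bm) simp
    finally show ?thesis .
  qed
  also have "\<dots> \<le> ennreal (49 * (d J)\<^sup>2) + (\<Sum>j<J. ennreal (49 * 2000001 * \<sigma> ^ 3 * (1 / d j)))"
  proof (intro add_mono sum_mono order_refl)
    fix j assume "j \<in> {..<J}"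
    then have j: "j < NR" "\<theta> \<le> d j" using J big by auto
    have dj: "0 < d j" by (rule dtil_pos)
    have "400 * \<sigma> \<le> d j" using j(2) by (simp add: \<theta>_def)
    \<comment> \<open>Lets one factor \<open>\<sigma> / d j\<close> of the fourth-power noise term
      be replaced by a constant, so that both parts are of third order.\<close>
    then have sd: "\<sigma> / d j \<le> 1 / 400" using dj by (simp add: divide_le_eq)
    have "ennreal (49 * (d j)\<^sup>2) * emeasure \<Omega> (Bad j) \<le> ennreal (49 * (d j)\<^sup>2) * ennreal (\<sigma> ^ 3 / d j ^ 3 + 8 * 10 ^ 8 * \<sigma> ^ 4 / d j ^ 4)"
      by (intro mult_left_mono Bad_le j) simp
    also have "\<dots> = ennreal (49 * (d j)\<^sup>2 * (\<sigma> ^ 3 / d j ^ 3 + 8 * 10 ^ 8 * \<sigma> ^ 4 / d j ^ 4))"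
      by (rule ennreal_mult[symmetric]) (use \<sigma> dj in auto)
    also have "49 * (d j)\<^sup>2 * (\<sigma> ^ 3 / d j ^ 3 + 8 * 10 ^ 8 * \<sigma> ^ 4 / d j ^ 4) = 49 * \<sigma> ^ 3 * (1 / d j) * (1 + 8 * 10 ^ 8 * (\<sigma> / d j))"
      using dj by (simp add: field_simps power2_eq_square power3_eq_cube power4_eq_xxxx)
    also have "ennreal \<dots> \<le> ennreal (49 * \<sigma> ^ 3 * (1 / d j) * 2000001)"
    proof (intro ennreal_leI mult_left_mono)
      have "8 * 10 ^ 8 * (\<sigma> / d j) \<le> 8 * 10 ^ 8 * (1 / 400)" using sd by (intro mult_left_mono) auto
      then show "1 + 8 * 10 ^ 8 * (\<sigma> / d j) \<le> 2000001" by simp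
    qed (use \<sigma> dj in auto)
    finally show "ennreal (49 * (d j)\<^sup>2) * emeasure \<Omega> (Bad j) \<le> ennreal (49 * 2000001 * \<sigma> ^ 3 * (1 / d j))"
      by (simp add: mult_ac)
  qed
  also have "(\<Sum>j<J. ennreal (49 * 2000001 * \<sigma> ^ 3 * (1 / d j))) = ennreal (49 * 2000001 * \<sigma> ^ 3 * (\<Sum>j<J. 1 / d j))"
    unfolding sum_distrib_left using \<sigma> dtil_pos by (intro sum_ennreal) (simp add: less_imp_le)
  also have "ennreal (49 * (d J)\<^sup>2) + \<dots> \<le> ennreal (49 * (d J)\<^sup>2) + ennreal (500000 * \<sigma>\<^sup>2)"
  proof (intro add_mono order_refl ennreal_leI)
    have "(\<Sum>j<J. 1 / d j) \<le> 1 / (200 * \<sigma>)"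
    proof (cases J)
      case 0
      then show ?thesis using \<sigma> by simp
    next
      case (Suc i)
      have "400 * \<sigma> \<le> d i" using big Suc by (simp add: \<theta>_def)
      then have "2 / d i \<le> 2 / (400 * \<sigma>)" using \<sigma> by (intro divide_left_mono mult_pos_pos) auto
      then show ?thesis using sum_inverse_dtil[OF R0, of i] unfolding Suc by simp
    qed
    then have "49 * 2000001 * \<sigma> ^ 3 * (\<Sum>j<J. 1 / d j) \<le> 49 * 2000001 * \<sigma> ^ 3 * (1 / (200 * \<sigma>))"
      using \<sigma> by (intro mult_left_mono) auto
    also have "\<dots> = 49 * 2000001 / 200 * \<sigma>\<^sup>2" using \<sigma> by (simp add: power2_eq_square power3_eq_cube)
    also have "\<dots> \<le> 500000 * \<sigma>\<^sup>2" by (intro mult_right_mono) auto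
    finally show "49 * 2000001 * \<sigma> ^ 3 * (\<Sum>j<J. 1 / d j) \<le> 500000 * \<sigma>\<^sup>2" .
  qed
  also have "\<dots> = ennreal (49 * (d J)\<^sup>2 + 500000 * \<sigma>\<^sup>2)" by (rule ennreal_plus[symmetric]) auto
  finally show ?thesis .
qed

section \<open>Risk of the output in the different regimes\<close>

lemma eta_pos: "0 < \<eta>"
  unfolding \<eta>_def by (rule eta_star_pos[OF \<sigma>]) simp

lemma Upsilon_ge_1: "1 \<le> \<Upsilon>"
  unfolding \<Upsilon>_def Upsilon_fac_def by (rule one_le_power) simp

text \<open>\<open>J\<close> is the first round at which the loop has stopped or the scale is below
  \<open>\<theta>\<close>. Its radius is then at most \<open>\<theta>\<close>, \<open>2 * r\<close>
  or \<open>200 * \<sigma>\<close>. If \<open>\<sigma> \<le> 2 * \<eta>\<close>, all three are at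
  most a constant times \<open>sqrt \<Upsilon> * \<eta>\<close>; otherwise \<open>K\<close> is so
  small that any of its points is accurate enough.\<close>

lemma loop_risk:
  assumes \<mu>: "\<mu> \<in> K" and big\<sigma>: "r / sqrt (real n) < \<sigma>"
  shows "(\<integral>\<^sup>+\<omega>. ennreal ((edist n (mu (observation n \<mu> (fst \<omega>)) (snd \<omega>) stop) \<mu>)\<^sup>2) \<partial>\<Omega>)
    \<le> ennreal (2 * 10 ^ 8 * \<Upsilon> * \<eta>\<^sup>2)"
proof (cases "\<sigma> \<le> 2 * \<eta>")
  case True
  define J where "J = (LEAST j. stop \<le> j \<or> d j < \<theta>)"
  have J1: "J \<le> stop" unfolding J_def by (rule Least_le) simp
  have J2: "stop \<le> J \<or> d J < \<theta>" unfolding J_def by (rule LeastI[of _ stop]) simp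
  have J3: "\<forall>j<J. \<theta> \<le> d j" unfolding J_def using not_less_Least not_less by blast
  have n0: "0 < sqrt (real n)" using n1 by simp
  have "r < \<sigma> * sqrt (real n)" using big\<sigma> n0 by (simp add: divide_less_eq)
  \<comment> \<open>In this regime \<open>r\<close> is the smaller member of the minimum in
    \<open>eta_star_ge_volume\<close>.\<close>
  then have r5: "r \<le> 5 * \<eta>" using eta_star_ge_volume[OF \<sigma>] by (simp add: \<eta>_def min_def split: if_splits)
  define u where "u = sqrt \<Upsilon> * \<eta>"
  have s1: "1 \<le> sqrt \<Upsilon>" using Upsilon_ge_1 by simp
  have u: "\<eta> \<le> u" "0 < u" using mult_right_mono[OF s1, of \<eta>] eta_pos by (simp_all add: u_def)
  have "d J \<le> 1420 * u"
  proof (cases "d J < \<theta>")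
    case True
    then show ?thesis using \<open>\<sigma> \<le> 2 * \<eta>\<close> u unfolding \<theta>_def by (simp add: u_def[symmetric] mult.assoc)
  next
    case False
    then have "J = stop" using J1 J2 by simp
    then show ?thesis using stop(2) r5 True u by (auto simp: max_def split: if_splits)
  qed
  then have "(d J)\<^sup>2 \<le> (1420 * u)\<^sup>2" using dtil_pos[of J] by (intro power_mono) auto
  moreover have "\<sigma>\<^sup>2 \<le> (2 * u)\<^sup>2" using True u \<sigma> by (intro power_mono) auto
  moreover have "u\<^sup>2 = \<Upsilon> * \<eta>\<^sup>2" using Upsilon_ge_1 by (simp add: u_def power_mult_distrib)
  ultimately have le: "49 * (d J)\<^sup>2 + 500000 * \<sigma>\<^sup>2 \<le> 49 * (2016400 * (\<Upsilon> * \<eta>\<^sup>2)) + 500000 * (4 * (\<Upsilon> * \<eta>\<^sup>2))"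
    by (intro add_mono mult_left_mono) (simp_all add: power_mult_distrib)
  also have "\<dots> \<le> 2 * 10 ^ 8 * \<Upsilon> * \<eta>\<^sup>2" using Upsilon_ge_1 by simp
  finally show ?thesis using order_trans[OF risk_bound[OF \<mu> J1 stop(1) J3] ennreal_leI] by (simp only:)
next
  case False
  \<comment> \<open>Since \<open>\<sigma> / 2\<close> exceeds \<open>\<eta>\<close>, the minimum in
    \<open>eta_star_ge_point\<close> must be the norm of \<open>x\<close>.\<close>
  have small: "enorm n x \<le> \<eta>" if "x \<in> K" for x
    using eta_star_ge_point[OF that \<sigma>, of 4] False by (simp add: \<eta>_def min_def split: if_splits)
  interpret No: prob_space Noise by (rule prob_Noise)
  interpret Se: prob_space Seeds by (rule prob_Seeds)
  interpret PP: pair_prob_space Noise Seeds ..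
  have O1: "emeasure \<Omega> (space \<Omega>) = 1" unfolding Omega by (rule PP.emeasure_space_1)
  have "(\<integral>\<^sup>+\<omega>. ennreal ((edist n (mu (observation n \<mu> (fst \<omega>)) (snd \<omega>) stop) \<mu>)\<^sup>2) \<partial>\<Omega>)
    \<le> (\<integral>\<^sup>+\<omega>. ennreal (2 * 10 ^ 8 * \<Upsilon> * \<eta>\<^sup>2) \<partial>\<Omega>)"
  proof (intro nn_integral_mono ennreal_leI)
    fix \<omega> assume "\<omega> \<in> space \<Omega>"
    then have "mu (observation n \<mu> (fst \<omega>)) (snd \<omega>) stop \<in> K"
      by (intro mu_mem stop(1)) (simp add: space_Omega)
    then have "edist n (mu (observation n \<mu> (fst \<omega>)) (snd \<omega>) stop) \<mu> \<le> 2 * \<eta>"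
      using small[of "mu (observation n \<mu> (fst \<omega>)) (snd \<omega>) stop"] small[OF \<mu>] enorm_diff_le[of n "mu (observation n \<mu> (fst \<omega>)) (snd \<omega>) stop" \<mu>] by simp
    then have "(edist n (mu (observation n \<mu> (fst \<omega>)) (snd \<omega>) stop) \<mu>)\<^sup>2 \<le> (2 * \<eta>)\<^sup>2" by (intro power_mono) auto
    also have "\<dots> = 4 * 1 * \<eta>\<^sup>2" by (simp add: power_mult_distrib)
    also have "\<dots> \<le> 2 * 10 ^ 8 * \<Upsilon> * \<eta>\<^sup>2" using Upsilon_ge_1 by (intro mult_right_mono mult_mono) auto
    finally show "(edist n (mu (observation n \<mu> (fst \<omega>)) (snd \<omega>) stop) \<mu>)\<^sup>2 \<le> 2 * 10 ^ 8 * \<Upsilon> * \<eta>\<^sup>2" .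
  qed
  also have "\<dots> = ennreal (2 * 10 ^ 8 * \<Upsilon> * \<eta>\<^sup>2)" by (simp add: O1)
  finally show ?thesis .
qed

text \<open>Returning \<open>Y\<close> costs at most \<open>4 * n * \<sigma>\<^sup>2\<close>. Here
  \<open>\<sigma> * sqrt n\<close> is the smaller member of the minimum in
  \<open>eta_star_ge_volume\<close>, so this is of the order of the squared critical radius.\<close>

lemma trivial_risk:
  assumes small: "\<sigma> \<le> r / sqrt (real n)"
  shows "(\<integral>\<^sup>+\<omega>. ennreal ((edist n (observation n \<mu> (fst \<omega>)) \<mu>)\<^sup>2) \<partial>\<Omega>) \<le> ennreal (2 * 10 ^ 8 * \<Upsilon> * \<eta>\<^sup>2)"
proof -
  interpret No: prob_space Noise by (rule prob_Noise)
  interpret Se: prob_space Seeds by (rule prob_Seeds)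
  have "(edist n (observation n \<mu> \<xi>) \<mu>)\<^sup>2 = (\<Sum>i<n. (\<xi> i)\<^sup>2)" for \<xi>
    unfolding edist_def enorm_sq ip_def by (intro sum.cong refl) (simp add: observation_def power2_eq_square)
  then have "(\<integral>\<^sup>+\<omega>. ennreal ((edist n (observation n \<mu> (fst \<omega>)) \<mu>)\<^sup>2) \<partial>\<Omega>) = (\<integral>\<^sup>+\<omega>. (\<Sum>i<n. ennreal ((fst \<omega> i)\<^sup>2)) \<partial>\<Omega>)"
    by (simp add: sum_ennreal)
  also have "\<dots> = (\<Sum>i<n. \<integral>\<^sup>+\<omega>. ennreal ((fst \<omega> i)\<^sup>2) \<partial>\<Omega>)"
    by (rule nn_integral_sum) (intro measurable_compose[OF measurable_noise_coord, of _ "\<lambda>x. ennreal (x\<^sup>2)" borel], simp_all)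
  also have "\<dots> \<le> (\<Sum>i<n. ennreal (4 * \<sigma>\<^sup>2))"
  proof (rule sum_mono)
    fix i assume "i \<in> {..<n}"
    then have i: "i < n" by simp
    have sq: "(\<lambda>x. ennreal (x\<^sup>2)) \<in> borel_measurable \<nu>"
      unfolding measurable_cong_sets[OF \<nu>(2) refl] by simp
    have co: "(\<lambda>x. x i) \<in> measurable Noise \<nu>" using i by (intro measurable_component_singleton) simp
    have fm: "(\<lambda>\<omega>. ennreal ((fst \<omega> i)\<^sup>2)) \<in> borel_measurable (Noise \<Otimes>\<^sub>M Seeds)"
      using measurable_compose[OF measurable_noise_coord[OF i, unfolded Omega], of "\<lambda>x. ennreal (x\<^sup>2)" borel] by simp
    have "(\<integral>\<^sup>+\<omega>. ennreal ((fst \<omega> i)\<^sup>2) \<partial>\<Omega>) = (\<integral>\<^sup>+\<xi>. (\<integral>\<^sup>+s. ennreal ((\<xi> i)\<^sup>2) \<partial>Seeds) \<partial>Noise)"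
      unfolding Omega using Se.nn_integral_fst[OF fm] by (simp only: fst_conv)
    also have "\<dots> = (\<integral>\<^sup>+\<xi>. ennreal ((\<xi> i)\<^sup>2) \<partial>Noise)" by (simp add: Se.emeasure_space_1)
    also have "\<dots> = (\<integral>\<^sup>+x. ennreal (x\<^sup>2) \<partial>distr Noise \<nu> (\<lambda>\<xi>. \<xi> i))"
      by (subst nn_integral_distr[OF co]) (use sq in simp_all)
    also have "distr Noise \<nu> (\<lambda>\<xi>. \<xi> i) = \<nu>"
      by (rule distr_PiM_component) (use i \<nu> in auto)
    also have "(\<integral>\<^sup>+x. ennreal (x\<^sup>2) \<partial>\<nu>) \<le> ennreal (4 * \<sigma>\<^sup>2)" by (rule subgaussian_second_moment[OF \<nu> \<sigma>])
    finally show "(\<integral>\<^sup>+\<omega>. ennreal ((fst \<omega> i)\<^sup>2) \<partial>\<Omega>) \<le> ennreal (4 * \<sigma>\<^sup>2)" .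
  qed
  also have "\<dots> = ennreal (real n * (4 * \<sigma>\<^sup>2))" by (simp add: ennreal_mult ennreal_of_nat_eq_real_of_nat)
  also have "\<dots> \<le> ennreal (2 * 10 ^ 8 * \<Upsilon> * \<eta>\<^sup>2)"
  proof (rule ennreal_leI)
    have n0: "0 < sqrt (real n)" using n1 by simp
    have "\<sigma> * sqrt (real n) \<le> r" using small n0 by (simp add: le_divide_eq)
    then have "\<sigma> * sqrt (real n) \<le> 5 * \<eta>" using eta_star_ge_volume[OF \<sigma>] by (simp add: \<eta>_def)
    then have "(\<sigma> * sqrt (real n))\<^sup>2 \<le> (5 * \<eta>)\<^sup>2" using \<sigma> by (intro power_mono) auto
    then have "real n * (4 * \<sigma>\<^sup>2) \<le> 100 * 1 * \<eta>\<^sup>2" by (simp add: power_mult_distrib mult.commute)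
    also have "\<dots> \<le> 2 * 10 ^ 8 * \<Upsilon> * \<eta>\<^sup>2" using Upsilon_ge_1 by (intro mult_right_mono mult_mono) auto
    finally show "real n * (4 * \<sigma>\<^sup>2) \<le> 2 * 10 ^ 8 * \<Upsilon> * \<eta>\<^sup>2" .
  qed
  finally show ?thesis .
qed

lemma measurable_estimate_error:
  assumes "f \<in> borel_measurable \<Omega>"
  shows "(\<lambda>\<omega>. (edist n (f \<omega>) \<mu>)\<^sup>2) \<in> borel_measurable \<Omega>"
  unfolding edist_def
  by (intro borel_measurable_power measurable_enorm measurable_coordinatewise_then_product borel_measurable_diff
      measurable_product_then_coordinatewise[OF assms] borel_measurable_const)

theorem algE_risk:
  assumes \<mu>: "\<mu> \<in> K"
  shows "integrable \<Omega> (\<lambda>(\<xi>, s). (edist n (algE n 200 L0 \<kappa> Orc P K r R \<sigma> (observation n \<mu> \<xi>) s) \<mu>)\<^sup>2) \<and>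
    (\<integral>(\<xi>, s). (edist n (algE n 200 L0 \<kappa> Orc P K r R \<sigma> (observation n \<mu> \<xi>) s) \<mu>)\<^sup>2 \<partial>\<Omega>)
      \<le> 2 * 10 ^ 8 * \<Upsilon> * \<eta>\<^sup>2"
proof -
  define f where "f = (\<lambda>\<omega>. algE n 200 L0 \<kappa> Orc P K r R \<sigma> (observation n \<mu> (fst \<omega>)) (snd \<omega>))"
  have c: "0 \<le> 2 * 10 ^ 8 * \<Upsilon> * \<eta>\<^sup>2" using Upsilon_ge_1 by simp
  have "f \<in> borel_measurable \<Omega> \<and> (\<integral>\<^sup>+\<omega>. ennreal ((edist n (f \<omega>) \<mu>)\<^sup>2) \<partial>\<Omega>) \<le> ennreal (2 * 10 ^ 8 * \<Upsilon> * \<eta>\<^sup>2)"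
  proof (cases "\<sigma> \<le> r / sqrt (real n)")
    case True
    then have "f = (\<lambda>\<omega>. observation n \<mu> (fst \<omega>))" by (simp add: f_def algE_def)
    then show ?thesis using measurable_observation trivial_risk[OF True] by simp
  next
    case False
    then have "f = (\<lambda>\<omega>. mu (observation n \<mu> (fst \<omega>)) (snd \<omega>) stop)" by (simp add: f_def algE_def stop(3))
    then show ?thesis using measurable_mu[OF stop(1)] loop_risk[OF \<mu>] False by simp
  qed
  then have "integrable \<Omega> (\<lambda>\<omega>. (edist n (f \<omega>) \<mu>)\<^sup>2) \<and> (\<integral>\<omega>. (edist n (f \<omega>) \<mu>)\<^sup>2 \<partial>\<Omega>) \<le> 2 * 10 ^ 8 * \<Upsilon> * \<eta>\<^sup>2"
    by (intro nn_integral_bound_imp_integral measurable_estimate_error c) auto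
  then show ?thesis by (simp add: f_def case_prod_unfold)
qed

end

theorem theorem2p14:
  "\<exists>(c::real) (C::real) (L::real) (D::real).
     1 < c \<and> 1 < C \<and> 2 * (sqrt 3 + 1) < Ltil L \<and> 0 < D \<and>
     (\<forall>(poly_bd::real poly) (polylog_bd::real poly)
        (n::nat) (K::rvec set) (r::real) (R::real) (\<sigma>::real) (\<nu>::real measure)
        (S::real measure) (\<kappa>::rvec set \<Rightarrow> real)
        (Orc::rvec set \<Rightarrow> real \<Rightarrow> rmat \<Rightarrow> real \<Rightarrow> rvec)
        (P::rvec set \<Rightarrow> real \<Rightarrow> rvec \<Rightarrow> rvec).
        1 \<le> n \<longrightarrow>
        convex_body n K \<longrightarrow> origin_symmetric K \<longrightarrow>
        0 < r \<longrightarrow> 0 < R \<longrightarrow> ecball n (\<lambda>_. 0) r \<subseteq> K \<longrightarrow> K \<subseteq> ecball n (\<lambda>_. 0) R \<longrightarrow>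
        0 < \<sigma> \<longrightarrow> subgaussian_law \<nu> (\<sigma>\<^sup>2) \<longrightarrow>
        prob_space S \<longrightarrow>
        (\<forall>j<rounds L r R.
           qfm_oracle S n (body n L K R j) (\<kappa> (body n L K R j)) (fail_prob n C L \<kappa> K \<sigma> R j)
             (Orc (body n L K R j) (fail_prob n C L \<kappa> K \<sigma> R j))) \<longrightarrow>
        weak_projection n P \<longrightarrow>
        ln (R / r) \<le> poly poly_bd (real n) \<longrightarrow>
        kappa_bar n L \<kappa> K r R \<le> poly polylog_bd (ln (real n)) \<longrightarrow>
        T2 n K \<le> poly polylog_bd (ln (real n)) \<longrightarrow>
        (\<forall>\<mu>\<in>K.
           integrable (sample_space n \<nu> S)
             (\<lambda>(\<xi>, s). (edist n (algE n C L \<kappa> Orc P K r R \<sigma> (observation n \<mu> \<xi>) s) \<mu>)\<^sup>2) \<and>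
           (\<integral>(\<xi>, s). (edist n (algE n C L \<kappa> Orc P K r R \<sigma> (observation n \<mu> \<xi>) s) \<mu>)\<^sup>2
              \<partial>sample_space n \<nu> S)
             \<le> D * Upsilon_fac c C (kappa_bar n L \<kappa> K r R) (T2 n K) * (eta_star c n \<sigma> K)\<^sup>2))"
proof (rule exI[of _ 4], rule exI[of _ 200], rule exI[of _ L0], rule exI[of _ "2 * 10 ^ 8"], intro conjI allI impI ballI)
  show "2 * (sqrt 3 + 1) < Ltil L0" unfolding Ltil_L0 using sqrt3 by simp
next
  fix n K r R \<sigma> \<nu> S \<kappa> Orc P \<mu>
  assume a: "1 \<le> n" "convex_body n K" "origin_symmetric K" "0 < r" "0 < R" "ecball n (\<lambda>_. 0) r \<subseteq> K"
    "K \<subseteq> ecball n (\<lambda>_. 0) R" "0 < \<sigma>" "subgaussian_law \<nu> (\<sigma>\<^sup>2)" "prob_space S"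
    "\<forall>j<rounds L0 r R.
           qfm_oracle S n (body n L0 K R j) (\<kappa> (body n L0 K R j)) (fail_prob n 200 L0 \<kappa> K \<sigma> R j)
             (Orc (body n L0 K R j) (fail_prob n 200 L0 \<kappa> K \<sigma> R j))"
    "weak_projection n P"
  have est: "estimation n K r R \<sigma> \<nu> S \<kappa> Orc P"
    by (intro estimation.intro symmetric_body.intro estimation_axioms.intro) (fact a)+
  assume "\<mu> \<in> K"
  note risk = estimation.algE_risk[OF est this, unfolded estimation.\<Upsilon>_def[OF est] estimation.\<eta>_def[OF est]]
  show "integrable (sample_space n \<nu> S)
             (\<lambda>(\<xi>, s). (edist n (algE n 200 L0 \<kappa> Orc P K r R \<sigma> (observation n \<mu> \<xi>) s) \<mu>)\<^sup>2)"
    by (rule risk[THEN conjunct1])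
  show "(\<integral>(\<xi>, s). (edist n (algE n 200 L0 \<kappa> Orc P K r R \<sigma> (observation n \<mu> \<xi>) s) \<mu>)\<^sup>2
              \<partial>sample_space n \<nu> S)
             \<le> 2 * 10 ^ 8 * Upsilon_fac 4 200 (kappa_bar n L0 \<kappa> K r R) (T2 n K) * (eta_star 4 n \<sigma> K)\<^sup>2"
    by (rule risk[THEN conjunct2])
qed simp_all

end
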